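(* Let $\Sigma$ be a finite alphabet, $w$ a positive integer, $\tau=(R_1,\dots,R_m)$ a relational vocabulary, and $\varphi$ a first-order sentence over $\tau$. There is a computable function $f$ such that, given a finite automaton $A$ over the alphabet $\mathcal{B}(\Sigma,w,\tau)$ representing a $(\Sigma,w)$-regular-decisional class $\mathcal{C}$ of $\tau$-structures, one can determine in time $f(\Sigma,w,\tau,\varphi)\cdot|A|$ whether some $\tau$-structure in $\mathcal{C}$ satisfies $\varphi$.
   Context: Padding and tensor products. Fix a padding symbol $\#$ not in any alphabet considered. For alphabets $\Gamma_1,\dots,\Gamma_a$, $\Gamma_1\otimes\cdots\otimes\Gamma_a$ is the Cartesian product regarded as an alphabet, and $\Gamma^{\otimes a}$ its $a$-fold power. For nonempty strings $u_i$ over $\Gamma_i$ of lengths $n_i$, $u_1\otimes\cdots\otimes u_a$ is the string of length $\max_i n_i$ whose $j$-th symbol is the tuple of $j$-th symbols of the $u_i$, with $\#$ in place of missing symbols for $j>n_i$. For languages, $L_1\otimes\cdots\otimes L_a=\{u_1\otimes\cdots\otimes u_a:u_i\in L_i\}$ and $L^{\otimes a}$ is the $a$-fold product. For a language $L$ over a tensor alphabet, $\mathcal{R}(L)=\{(u_1,\dots,u_a):u_1\otimes\cdots\otimes u_a\in L\}$. A relation $R$ of tuples of strings is regular if $\{u_1\otimes\cdots\otimes u_a:(u_1,\dots,u_a)\in R\}$ is accepted by a finite automaton. ODDs. For an alphabet $\Sigma$ and $w\ge1$, a $(\Sigma,w)$-layer is a tuple $B=(\ell,r,T,I,F,\iota,\phi)$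 with $\ell,r\subseteq\{0,\dots,w-1\}$, $T\subseteq\ell\times(\Sigma\sqcup\{\#\})\times r$, $I\subseteq\ell$, $F\subseteq r$, $\iota,\phi\in\{\mathrm{true},\mathrm{false}\}$, $I=\emptyset$ if $\iota$ is false and $F=\emptyset$ if $\phi$ is false. $\mathcal{B}(\Sigma,w)$ is the finite set of such layers, regarded as an alphabet. A $(\Sigma,w)$-ODD of length $k$ is a string $B_1\cdots B_k$ over $\mathcal{B}(\Sigma,w)$ with $\ell(B_{i+1})=r(B_i)$, $\iota(B_i)$ true iff $i=1$, $\phi(B_i)$ true iff $i=k$; $\mathcal{B}(\Sigma,w,k)$ is the set of them. A nonempty string $\sigma_1\cdots\sigma_{k'}$ over $\Sigma$, $k'\le k$, is accepted if, padding it with $\#$ to length $k$ (symbols $\hat\sigma_i$), there are $(p_i,\hat\sigma_i,q_i)\in T(B_i)$ with $p_{i+1}=q_i$, $p_1\in I(B_1)$, $q_k\in F(B_k)$; $L(D)$ is the set of accepted strings. Structures and classes. A relational vocabulary $\tau=(R_1,\dots,R_m)$ has arities $a_i$. A tuple $(D_0,\dots,D_m)$ is $(\Sigma,w,\tau)$-structural if for some $k\ge1$, $D_0\in\mathcal{B}(\Sigma,w,k)$, $D_i\in\mathcal{B}(\Sigma^{\otimes a_i},w,k)$ and $L(D_i)\subseteq L(D_0)^{\otimes a_i}$ for $i\in[m]$; its derived structure $\mathcal{S}(D_0,\dots,D_m)$ has domain $L(D_0)$ and interprets $R_i$ as $\mathcal{R}(L(D_i))$. $\mathcal{R}(\Sigma,w,\tau)$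 is the set of all such tuples. For $R\subseteq\mathcal{R}(\Sigma,w,\tau)$, $\mathcal{S}(R)$ is the class of all $\tau$-structures isomorphic to $\mathcal{S}(D)$ for some $D\in R$. A class $\mathcal{C}$ of finite $\tau$-structures is $(\Sigma,w)$-regular-decisional if $\mathcal{C}=\mathcal{S}(R)$ for some regular $R\subseteq\mathcal{R}(\Sigma,w,\tau)$. Let $\mathcal{B}(\Sigma,w,\tau)=\mathcal{B}(\Sigma,w)\otimes\mathcal{B}(\Sigma^{\otimes a_1},w)\otimes\cdots\otimes\mathcal{B}(\Sigma^{\otimes a_m},w)$. A finite automaton $A$ over $\mathcal{B}(\Sigma,w,\tau)$ represents $\mathcal{C}$ if $\mathcal{R}(L(A))\subseteq\mathcal{R}(\Sigma,w,\tau)$ and $\mathcal{C}=\mathcal{S}(\mathcal{R}(L(A)))$. The size of an automaton with state set $Q$, transition set $T$ and alphabet $\Gamma$ is $|A|=|Q|+|T|\log|\Gamma|$. *)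

theory Defs
  imports Complex_Main "HOL-Library.List_Lexorder" "HOL-Library.Infinite_Typeclass"
begin

section \<open>Padding and tensor products\<close>

text \<open>
  The padding symbol \<open>#\<close> is \<^const>\<open>None\<close>, so \<open>\<Gamma> \<squnion> {#}\<close> is \<open>padded \<Gamma>\<close>. Since the tensor
  \<open>u\<^sub>1 \<otimes> \<dots> \<otimes> u\<^sub>a\<close> of strings of different lengths has \<open>#\<close> in some components, every component
  of a symbol of a tensor alphabet may be \<open>#\<close>. Positions are counted from 0.
\<close>

definition padded :: "'a set \<Rightarrow> 'a option set" where
  "padded \<Gamma> = insert None (Some ` \<Gamma>)"

definition pad :: "'a list \<Rightarrow> nat \<Rightarrow> 'a option" where
  "pad u j = (if j < length u then Some (u ! j) else None)"

definition tensor_power :: "'a set \<Rightarrow> nat \<Rightarrow> 'a option list set" where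
  "tensor_power \<Gamma> a = {t. length t = a \<and> set t \<subseteq> padded \<Gamma>}"

definition tensor :: "'a list list \<Rightarrow> 'a option list list" where
  "tensor us = map (\<lambda>j. map (\<lambda>u. pad u j) us) [0..<Max (length ` set us)]"

definition lang_power :: "'a list set \<Rightarrow> nat \<Rightarrow> 'a option list list set" where
  "lang_power L a = {tensor us | us. length us = a \<and> set us \<subseteq> L}"

definition rel_of :: "nat \<Rightarrow> 'a option list list set \<Rightarrow> 'a list list set" where
  "rel_of a L = {us. length us = a \<and> (\<forall>u\<in>set us. u \<noteq> []) \<and> tensor us \<in> L}"


section \<open>Ordered decision diagrams\<close>

record 'a layer =
  lay_left :: "nat set"
  lay_right :: "nat set"
  lay_trans :: "(nat \<times> 'a option \<times> nat) set"
  lay_init :: "nat set"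
  lay_final :: "nat set"
  lay_isfirst :: bool
  lay_islast :: bool

definition layers :: "'a set \<Rightarrow> nat \<Rightarrow> 'a layer set" where
  "layers \<Sigma> w = {B. lay_left B \<subseteq> {..<w} \<and> lay_right B \<subseteq> {..<w} \<and>
     lay_trans B \<subseteq> lay_left B \<times> padded \<Sigma> \<times> lay_right B \<and>
     lay_init B \<subseteq> lay_left B \<and> lay_final B \<subseteq> lay_right B \<and>
     (\<not> lay_isfirst B \<longrightarrow> lay_init B = {}) \<and> (\<not> lay_islast B \<longrightarrow> lay_final B = {})}"

definition odds :: "'a set \<Rightarrow> nat \<Rightarrow> nat \<Rightarrow> 'a layer list set" where
  "odds \<Sigma> w k = {D. length D = k \<and> set D \<subseteq> layers \<Sigma> w \<and>
     (\<forall>i. Suc i < k \<longrightarrow> lay_left (D ! Suc i) = lay_right (D ! i)) \<and>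
     (\<forall>i<k. lay_isfirst (D ! i) \<longleftrightarrow> i = 0) \<and>
     (\<forall>i<k. lay_islast (D ! i) \<longleftrightarrow> Suc i = k)}"

text \<open>For \<open>D\<close> in \<open>odds \<Sigma> w k\<close>, an accepted string is automatically a string over \<open>\<Sigma>\<close>.\<close>

definition odd_lang :: "'a layer list \<Rightarrow> 'a list set" where
  "odd_lang D = {s. s \<noteq> [] \<and> length s \<le> length D \<and>
     (\<exists>p q. (\<forall>i<length D. (p i, pad s i, q i) \<in> lay_trans (D ! i)) \<and>
            (\<forall>i. Suc i < length D \<longrightarrow> p (Suc i) = q i) \<and>
            p 0 \<in> lay_init (D ! 0) \<and> q (length D - 1) \<in> lay_final (D ! (length D - 1)))}"


section \<open>Finite automata\<close>

record ('s, 'a) nfa =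
  nfa_states :: "'s set"
  nfa_trans :: "('s \<times> 'a \<times> 's) set"
  nfa_init :: "'s set"
  nfa_final :: "'s set"

definition is_nfa :: "'a set \<Rightarrow> ('s, 'a) nfa \<Rightarrow> bool" where
  "is_nfa \<Gamma> A \<longleftrightarrow> finite (nfa_states A) \<and> nfa_states A \<noteq> {} \<and>
     nfa_trans A \<subseteq> nfa_states A \<times> \<Gamma> \<times> nfa_states A \<and>
     nfa_init A \<subseteq> nfa_states A \<and> nfa_final A \<subseteq> nfa_states A"

definition nfa_lang :: "('s, 'a) nfa \<Rightarrow> 'a list set" where
  "nfa_lang A = {u. \<exists>\<rho>. \<rho> 0 \<in> nfa_init A \<and> \<rho> (length u) \<in> nfa_final A \<and>
     (\<forall>i<length u. (\<rho> i, u ! i, \<rho> (Suc i)) \<in> nfa_trans A)}"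

definition nfa_size :: "'a set \<Rightarrow> ('s, 'a) nfa \<Rightarrow> real" where
  "nfa_size \<Gamma> A = real (card (nfa_states A)) + real (card (nfa_trans A)) * log 2 (real (card \<Gamma>))"


section \<open>Structures and first-order logic\<close>

text \<open>
  A vocabulary \<open>\<tau> = (R\<^sub>1, \<dots>, R\<^sub>m)\<close> is the list of its arities; the relation symbol with index
  \<open>i < m\<close> has arity \<open>\<tau> ! i\<close>. Domains may be empty, because \<open>odd_lang D\<close> may be.
\<close>

definition vocabulary :: "nat list \<Rightarrow> bool" where
  "vocabulary \<tau> \<longleftrightarrow> (\<forall>a\<in>set \<tau>. 1 \<le> a)"

record 'u struc =
  str_dom :: "'u set"
  str_rel :: "'u list set list"

definition is_struc :: "nat list \<Rightarrow> 'u struc \<Rightarrow> bool" where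
  "is_struc \<tau> S \<longleftrightarrow> length (str_rel S) = length \<tau> \<and>
     (\<forall>i<length \<tau>. \<forall>t\<in>str_rel S ! i. length t = \<tau> ! i \<and> set t \<subseteq> str_dom S)"

definition struc_iso :: "nat list \<Rightarrow> 'u struc \<Rightarrow> 'v struc \<Rightarrow> bool" where
  "struc_iso \<tau> S S' \<longleftrightarrow> (\<exists>h. bij_betw h (str_dom S) (str_dom S') \<and>
     (\<forall>i<length \<tau>. \<forall>t. length t = \<tau> ! i \<and> set t \<subseteq> str_dom S \<longrightarrow>
        (t \<in> str_rel S ! i \<longleftrightarrow> map h t \<in> str_rel S' ! i)))"

datatype fo =
    Rel nat "nat list"
  | Eq nat nat
  | Neg fo
  | Conj fo fo
  | Disj fo fo
  | Ex nat fo
  | All nat fo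

fun fo_free :: "fo \<Rightarrow> nat set" where
  "fo_free (Rel i xs) = set xs"
| "fo_free (Eq x y) = {x, y}"
| "fo_free (Neg \<phi>) = fo_free \<phi>"
| "fo_free (Conj \<phi> \<psi>) = fo_free \<phi> \<union> fo_free \<psi>"
| "fo_free (Disj \<phi> \<psi>) = fo_free \<phi> \<union> fo_free \<psi>"
| "fo_free (Ex x \<phi>) = fo_free \<phi> - {x}"
| "fo_free (All x \<phi>) = fo_free \<phi> - {x}"

fun fo_over :: "nat list \<Rightarrow> fo \<Rightarrow> bool" where
  "fo_over \<tau> (Rel i xs) \<longleftrightarrow> i < length \<tau> \<and> length xs = \<tau> ! i"
| "fo_over \<tau> (Eq x y) \<longleftrightarrow> True"
| "fo_over \<tau> (Neg \<phi>) \<longleftrightarrow> fo_over \<tau> \<phi>"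
| "fo_over \<tau> (Conj \<phi> \<psi>) \<longleftrightarrow> fo_over \<tau> \<phi> \<and> fo_over \<tau> \<psi>"
| "fo_over \<tau> (Disj \<phi> \<psi>) \<longleftrightarrow> fo_over \<tau> \<phi> \<and> fo_over \<tau> \<psi>"
| "fo_over \<tau> (Ex x \<phi>) \<longleftrightarrow> fo_over \<tau> \<phi>"
| "fo_over \<tau> (All x \<phi>) \<longleftrightarrow> fo_over \<tau> \<phi>"

definition fo_sentence :: "nat list \<Rightarrow> fo \<Rightarrow> bool" where
  "fo_sentence \<tau> \<phi> \<longleftrightarrow> fo_over \<tau> \<phi> \<and> fo_free \<phi> = {}"

fun fo_sat :: "'u struc \<Rightarrow> (nat \<Rightarrow> 'u) \<Rightarrow> fo \<Rightarrow> bool" where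
  "fo_sat S e (Rel i xs) \<longleftrightarrow> map e xs \<in> str_rel S ! i"
| "fo_sat S e (Eq x y) \<longleftrightarrow> e x = e y"
| "fo_sat S e (Neg \<phi>) \<longleftrightarrow> \<not> fo_sat S e \<phi>"
| "fo_sat S e (Conj \<phi> \<psi>) \<longleftrightarrow> fo_sat S e \<phi> \<and> fo_sat S e \<psi>"
| "fo_sat S e (Disj \<phi> \<psi>) \<longleftrightarrow> fo_sat S e \<phi> \<or> fo_sat S e \<psi>"
| "fo_sat S e (Ex x \<phi>) \<longleftrightarrow> (\<exists>d\<in>str_dom S. fo_sat S (e(x := d)) \<phi>)"
| "fo_sat S e (All x \<phi>) \<longleftrightarrow> (\<forall>d\<in>str_dom S. fo_sat S (e(x := d)) \<phi>)"

text \<open>For a sentence the assignment is irrelevant.\<close>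

definition fo_models :: "'u struc \<Rightarrow> fo \<Rightarrow> bool" where
  "fo_models S \<phi> \<longleftrightarrow> (\<forall>e. fo_sat S e \<phi>)"


section \<open>Regular-decisional classes\<close>

text \<open>
  A tuple \<open>(D\<^sub>0, D\<^sub>1, \<dots>, D\<^sub>m)\<close> is the pair of \<open>D\<^sub>0\<close> and the list of \<open>D\<^sub>1, \<dots>, D\<^sub>m\<close>, because
  \<open>D\<^sub>0\<close> is over \<open>\<Sigma>\<close> and the others are over tensor powers of \<open>\<Sigma>\<close>; the tensor product of such
  a tuple and its alphabet are paired accordingly.
\<close>

type_synonym 'a odd_tuple = "'a layer list \<times> 'a option list layer list list"
type_synonym 'a odd_symbol = "'a layer option \<times> 'a option list layer option list"

definition odd_alphabet :: "'a set \<Rightarrow> nat \<Rightarrow> nat list \<Rightarrow> 'a odd_symbol set" where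
  "odd_alphabet \<Sigma> w \<tau> = {(b, bs). b \<in> padded (layers \<Sigma> w) \<and> length bs = length \<tau> \<and>
     (\<forall>i<length \<tau>. bs ! i \<in> padded (layers (tensor_power \<Sigma> (\<tau> ! i)) w))}"

fun odd_tensor :: "'a odd_tuple \<Rightarrow> 'a odd_symbol list" where
  "odd_tensor (D0, Ds) = map (\<lambda>j. (pad D0 j, map (\<lambda>D. pad D j) Ds))
     [0..<Max (insert (length D0) (length ` set Ds))]"

definition odd_rel_of :: "nat \<Rightarrow> 'a odd_symbol list set \<Rightarrow> 'a odd_tuple set" where
  "odd_rel_of m L = {(D0, Ds). length Ds = m \<and> D0 \<noteq> [] \<and> (\<forall>D\<in>set Ds. D \<noteq> []) \<and>
     odd_tensor (D0, Ds) \<in> L}"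

definition structural :: "'a set \<Rightarrow> nat \<Rightarrow> nat list \<Rightarrow> 'a odd_tuple set" where
  "structural \<Sigma> w \<tau> = {(D0, Ds). length Ds = length \<tau> \<and> (\<exists>k\<ge>1. D0 \<in> odds \<Sigma> w k \<and>
     (\<forall>i<length \<tau>. Ds ! i \<in> odds (tensor_power \<Sigma> (\<tau> ! i)) w k \<and>
        odd_lang (Ds ! i) \<subseteq> lang_power (odd_lang D0) (\<tau> ! i)))}"

fun derived :: "nat list \<Rightarrow> 'a odd_tuple \<Rightarrow> 'a list struc" where
  "derived \<tau> (D0, Ds) = \<lparr>str_dom = odd_lang D0,
     str_rel = map (\<lambda>i. rel_of (\<tau> ! i) (odd_lang (Ds ! i))) [0..<length \<tau>]\<rparr>"

definition struc_class :: "nat list \<Rightarrow> 'a odd_tuple set \<Rightarrow> 'u struc set" where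
  "struc_class \<tau> R = {S. is_struc \<tau> S \<and> (\<exists>D\<in>R. struc_iso \<tau> S (derived \<tau> D))}"

definition regular_rel :: "'a set \<Rightarrow> nat \<Rightarrow> nat list \<Rightarrow> 'a odd_tuple set \<Rightarrow> bool" where
  "regular_rel \<Sigma> w \<tau> R \<longleftrightarrow>
     (\<exists>A :: (nat, 'a odd_symbol) nfa. is_nfa (odd_alphabet \<Sigma> w \<tau>) A \<and> nfa_lang A = odd_tensor ` R)"

definition regular_decisional :: "'a set \<Rightarrow> nat \<Rightarrow> nat list \<Rightarrow> 'u struc set \<Rightarrow> bool" where
  "regular_decisional \<Sigma> w \<tau> C \<longleftrightarrow> (\<forall>S\<in>C. is_struc \<tau> S \<and> finite (str_dom S)) \<and>
     (\<exists>R \<subseteq> structural \<Sigma> w \<tau>. regular_rel \<Sigma> w \<tau> R \<and> C = struc_class \<tau> R)"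

definition represents ::
    "'a set \<Rightarrow> nat \<Rightarrow> nat list \<Rightarrow> ('s, 'a odd_symbol) nfa \<Rightarrow> 'u struc set \<Rightarrow> bool" where
  "represents \<Sigma> w \<tau> A C \<longleftrightarrow> is_nfa (odd_alphabet \<Sigma> w \<tau>) A \<and>
     odd_rel_of (length \<tau>) (nfa_lang A) \<subseteq> structural \<Sigma> w \<tau> \<and>
     C = struc_class \<tau> (odd_rel_of (length \<tau>) (nfa_lang A))"


section \<open>Random access machines\<close>

text \<open>
  Unit-cost RAM over the natural numbers with structured control flow. Only addition and
  (truncated) subtraction are available, so unit cost is not abused. A store consists of the
  registers and of memory banks; a program mentions only finitely many registers and banks, and
  several banks can be interleaved into one with constant-factor overhead. In \<open>exec c s t s'\<close>,
  \<open>t\<close> is the number of executed instructions and tests.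
\<close>

datatype com =
    Const nat nat
  | Add nat nat nat
  | Sub nat nat nat
  | Load nat nat nat
  | Store nat nat nat
  | Seq com com
  | If nat com com
  | While nat com

type_synonym store = "(nat \<Rightarrow> nat) \<times> (nat \<Rightarrow> nat \<Rightarrow> nat)"

inductive exec :: "com \<Rightarrow> store \<Rightarrow> nat \<Rightarrow> store \<Rightarrow> bool" where
  "exec (Const x n) (r, m) 1 (r(x := n), m)"
| "exec (Add x y z) (r, m) 1 (r(x := r y + r z), m)"
| "exec (Sub x y z) (r, m) 1 (r(x := r y - r z), m)"
| "exec (Load x b y) (r, m) 1 (r(x := m b (r y)), m)"
| "exec (Store b x y) (r, m) 1 (r, m(b := (m b)(r x := r y)))"
| "exec c s t s' \<Longrightarrow> exec d s' t' s'' \<Longrightarrow> exec (Seq c d) s (t + t') s''"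
| "fst s x \<noteq> 0 \<Longrightarrow> exec c s t s' \<Longrightarrow> exec (If x c d) s (Suc t) s'"
| "fst s x = 0 \<Longrightarrow> exec d s t s' \<Longrightarrow> exec (If x c d) s (Suc t) s'"
| "fst s x = 0 \<Longrightarrow> exec (While x c) s 1 s"
| "fst s x \<noteq> 0 \<Longrightarrow> exec c s t s' \<Longrightarrow> exec (While x c) s' t' s'' \<Longrightarrow>
     exec (While x c) s (Suc (t + t')) s''"

text \<open>The input is given in bank 0 and its length in register 0; the output is left in register 0.\<close>

definition init_store :: "nat list \<Rightarrow> store" where
  "init_store xs = ((\<lambda>x. if x = 0 then length xs else 0),
     (\<lambda>b i. if b = 0 \<and> i < length xs then xs ! i else 0))"

definition computes :: "com \<Rightarrow> nat list \<Rightarrow> nat \<Rightarrow> nat \<Rightarrow> bool" where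
  "computes c xs t y \<longleftrightarrow> (\<exists>s. exec c (init_store xs) t s \<and> fst s 0 = y)"


section \<open>Encoding of inputs\<close>

text \<open>
  All encodings are self-delimiting. Finite sets are listed in the lexicographic order of the
  codes of their elements, except for the components of an automaton, which may be listed in any
  order.
\<close>

definition enc_nat :: "nat \<Rightarrow> nat list" where
  "enc_nat n = [n]"

definition enc_bool :: "bool \<Rightarrow> nat list" where
  "enc_bool b = [if b then 1 else 0]"

fun enc_option :: "('a \<Rightarrow> nat list) \<Rightarrow> 'a option \<Rightarrow> nat list" where
  "enc_option e None = [0]"
| "enc_option e (Some x) = 1 # e x"

definition enc_list :: "('a \<Rightarrow> nat list) \<Rightarrow> 'a list \<Rightarrow> nat list" where
  "enc_list e xs = length xs # concat (map e xs)"

definition enc_set :: "('a \<Rightarrow> nat list) \<Rightarrow> 'a set \<Rightarrow> nat list" where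
  "enc_set e X = enc_list id (sorted_list_of_set (e ` X))"

definition enc_triple ::
    "('a \<Rightarrow> nat list) \<Rightarrow> ('b \<Rightarrow> nat list) \<Rightarrow> ('c \<Rightarrow> nat list) \<Rightarrow> 'a \<times> 'b \<times> 'c \<Rightarrow> nat list" where
  "enc_triple e f g = (\<lambda>(x, y, z). e x @ f y @ g z)"

definition enc_layer :: "('a \<Rightarrow> nat list) \<Rightarrow> 'a layer \<Rightarrow> nat list" where
  "enc_layer e B = enc_set enc_nat (lay_left B) @ enc_set enc_nat (lay_right B) @
     enc_set (enc_triple enc_nat (enc_option e) enc_nat) (lay_trans B) @
     enc_set enc_nat (lay_init B) @ enc_set enc_nat (lay_final B) @
     enc_bool (lay_isfirst B) @ enc_bool (lay_islast B)"

definition enc_symbol :: "nat odd_symbol \<Rightarrow> nat list" where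
  "enc_symbol = (\<lambda>(b, bs). enc_option (enc_layer enc_nat) b @
     enc_list (enc_option (enc_layer (enc_list (enc_option enc_nat)))) bs)"

definition nfa_code :: "(nat, nat odd_symbol) nfa \<Rightarrow> nat list \<Rightarrow> bool" where
  "nfa_code A xs \<longleftrightarrow> (\<exists>qs ts is fs.
     distinct qs \<and> set qs = nfa_states A \<and> distinct ts \<and> set ts = nfa_trans A \<and>
     distinct is \<and> set is = nfa_init A \<and> distinct fs \<and> set fs = nfa_final A \<and>
     xs = enc_list enc_nat qs @ enc_list (enc_triple enc_nat enc_symbol enc_nat) ts @
          enc_list enc_nat is @ enc_list enc_nat fs)"

fun enc_fo :: "fo \<Rightarrow> nat list" where
  "enc_fo (Rel i xs) = 0 # i # enc_list enc_nat xs"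
| "enc_fo (Eq x y) = [1, x, y]"
| "enc_fo (Neg \<phi>) = 2 # enc_fo \<phi>"
| "enc_fo (Conj \<phi> \<psi>) = 3 # enc_fo \<phi> @ enc_fo \<psi>"
| "enc_fo (Disj \<phi> \<psi>) = 4 # enc_fo \<phi> @ enc_fo \<psi>"
| "enc_fo (Ex x \<phi>) = 5 # x # enc_fo \<phi>"
| "enc_fo (All x \<phi>) = 6 # x # enc_fo \<phi>"

definition parameters :: "nat set \<Rightarrow> nat \<Rightarrow> nat list \<Rightarrow> fo \<Rightarrow> bool" where
  "parameters \<Sigma> w \<tau> \<phi> \<longleftrightarrow> finite \<Sigma> \<and> 1 \<le> w \<and> vocabulary \<tau> \<and> fo_sentence \<tau> \<phi>"

definition enc_parameters :: "nat set \<Rightarrow> nat \<Rightarrow> nat list \<Rightarrow> fo \<Rightarrow> nat list" where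
  "enc_parameters \<Sigma> w \<tau> \<phi> = enc_set enc_nat \<Sigma> @ enc_nat w @ enc_list enc_nat \<tau> @ enc_fo \<phi>"

definition computable_parameter_function ::
    "(nat set \<Rightarrow> nat \<Rightarrow> nat list \<Rightarrow> fo \<Rightarrow> nat) \<Rightarrow> bool" where
  "computable_parameter_function f \<longleftrightarrow> (\<exists>c. \<forall>\<Sigma> w \<tau> \<phi>. parameters \<Sigma> w \<tau> \<phi> \<longrightarrow>
     (\<exists>t. computes c (enc_parameters \<Sigma> w \<tau> \<phi>) t (f \<Sigma> w \<tau> \<phi>)))"

end

theory Submission
  imports Defs "HOL-Library.Nat_Bijection"
begin

text \<open>
  For a fixed sentence \<open>\<phi>\<close> the truth of \<open>\<phi>\<close> in the structure of a word of layers depends only on a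
  finite state computed by recursion on \<open>\<phi>\<close>: an atomic formula contributes the set of ODD states reachable
  on the tuple of strings, and a quantifier the set of all states of its body over all strings. Appending a
  symbol acts on these states, so words fall into finitely many types, each named by the least code of a word
  of that type. Types, their transitions and their number are computable, and so is the running time of every
  program that is used, because a program can be instrumented with a clock. The decision procedure is
  therefore a search in the product of the automaton with the finite set of types, which costs a computable
  constant per state and transition.
\<close>

section \<open>Weakest preconditions with running time\<close>

text \<open>The constant factor must be a computable function of the parameters, although the number
  of types grows through nested power sets and no explicit bound for it is derived. So the constant
  is computed, not estimated. The number of types is the least \<open>M\<close> for which the
  numbers below \<open>M\<close> are closed under all transitions; finiteness serves only to
  guarantee that such an \<open>M\<close> exists. Running times are exact functions of one number
  and can be computed by clocked programs, which is why computability is defined with an exact time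
  instead of a bound. The parameters are decoded by search as well: every data type is coded
  bijectively, so the numbers run through all candidates, and prefix-freeness of the tokens lets
  only correct candidates agree with the input. Accepted words with a padded layer can be
  disregarded: the tensor product of diagrams of equal length has no padding, and a representing
  automaton accepts the tensor product of no other tuple of nonempty strings.\<close>

definition wp :: "com \<Rightarrow> (nat \<Rightarrow> store \<Rightarrow> bool) \<Rightarrow> store \<Rightarrow> bool" where
  "wp c Q s \<longleftrightarrow> (\<exists>t s'. exec c s t s' \<and> Q t s')"

inductive_simps exec_Const_iff: "exec (Const x n) s t s'"
inductive_simps exec_Add_iff: "exec (Add x y z) s t s'"
inductive_simps exec_Sub_iff: "exec (Sub x y z) s t s'"
inductive_simps exec_Load_iff: "exec (Load x b y) s t s'"
inductive_simps exec_Store_iff: "exec (Store b x y) s t s'"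
inductive_cases exec_SeqE: "exec (Seq c d) s t s'"
inductive_cases exec_IfE: "exec (If x c d) s t s'"
inductive_cases exec_WhileE: "exec (While x c) s t s'"

lemma wp_Const [simp]: "wp (Const x n) Q (r, m) \<longleftrightarrow> Q 1 (r(x := n), m)"
  unfolding wp_def by (simp add: exec_Const_iff)

lemma wp_Add [simp]: "wp (Add x y z) Q (r, m) \<longleftrightarrow> Q 1 (r(x := r y + r z), m)"
  unfolding wp_def by (simp add: exec_Add_iff)

lemma wp_Sub [simp]: "wp (Sub x y z) Q (r, m) \<longleftrightarrow> Q 1 (r(x := r y - r z), m)"
  unfolding wp_def by (simp add: exec_Sub_iff)

lemma wp_Load [simp]: "wp (Load x b y) Q (r, m) \<longleftrightarrow> Q 1 (r(x := m b (r y)), m)"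
  unfolding wp_def by (simp add: exec_Load_iff)

lemma wp_Store [simp]:
  "wp (Store b x y) Q (r, m) \<longleftrightarrow> Q 1 (r, m(b := (m b)(r x := r y)))"
  unfolding wp_def by (simp add: exec_Store_iff)

lemma wp_Seq [simp]:
  "wp (Seq c d) Q s \<longleftrightarrow> wp c (\<lambda>t s'. wp d (\<lambda>t' s''. Q (t + t') s'') s') s"
  unfolding wp_def by (auto elim!: exec_SeqE; blast intro: exec.intros)

lemma wp_If [simp]:
  "wp (If x c d) Q s \<longleftrightarrow>
    (if fst s x \<noteq> 0 then wp c (\<lambda>t. Q (Suc t)) s else wp d (\<lambda>t. Q (Suc t)) s)"
  unfolding wp_def by (auto elim!: exec_IfE; blast intro: exec.intros)

lemma wp_mono: "wp c Q s \<Longrightarrow> (\<And>t s'. Q t s' \<Longrightarrow> Q' t s') \<Longrightarrow> wp c Q' s"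
  unfolding wp_def by blast

lemma wp_While_stop: "fst s x = 0 \<Longrightarrow> Q 1 s \<Longrightarrow> wp (While x c) Q s"
  unfolding wp_def by (blast intro: exec.intros)

lemma wp_While_step:
  assumes "fst s x \<noteq> 0" "wp c (\<lambda>t. wp (While x c) (\<lambda>t'. Q (Suc (t + t')))) s"
  shows "wp (While x c) Q s"
  using assms unfolding wp_def by (blast intro: exec.intros)

text \<open>Exact accounting: an iteration costs its body and one test, and the outer
  \<open>Suc\<close> is the test that fails. The body time may depend on the iteration number but
  not on the store, so the total is a function of \<open>n\<close> and \<open>\<theta>\<close>
  alone.\<close>

lemma wp_While_count:
  assumes "I 0 s"
    and step: "\<And>i s. i < n \<Longrightarrow> I i s \<Longrightarrow>
      fst s x \<noteq> 0 \<and> wp c (\<lambda>t s'. t = \<theta> i \<and> I (Suc i) s') s"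
    and stop: "\<And>s. I n s \<Longrightarrow> fst s x = (0::nat)"
  shows "wp (While x c) (\<lambda>t s'. t = Suc (\<Sum>i<n. Suc (\<theta> i)) \<and> I n s') s"
proof -
  have "wp (While x c) (\<lambda>t s'. t = Suc (\<Sum>j\<in>{i..<n}. Suc (\<theta> j)) \<and> I n s') s'"
    if "i \<le> n" "I i s'" for i s'
    using that
  proof (induction i arbitrary: s' rule: inc_induct)
    case base
    then show ?case by (auto intro: wp_While_stop stop)
  next
    case (step i)
    have "wp c (\<lambda>t s''. t = \<theta> i \<and> I (Suc i) s'') s'" "fst s' x \<noteq> 0"
      using assms(2) step.hyps step.prems by auto
    then show ?case
    proof (intro wp_While_step)
      show "wp c (\<lambda>t. wp (While x c)
          (\<lambda>t' s'. Suc (t + t') = Suc (\<Sum>j\<in>{i..<n}. Suc (\<theta> j)) \<and> I n s')) s'"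
      proof (rule wp_mono[OF \<open>wp c _ s'\<close>])
        fix t s'' assume *: "t = \<theta> i \<and> I (Suc i) s''"
        then have "wp (While x c) (\<lambda>t s'. t = Suc (\<Sum>j\<in>{Suc i..<n}. Suc (\<theta> j)) \<and> I n s') s''"
          using step.IH by blast
        then show "wp (While x c)
          (\<lambda>t' s'. Suc (t + t') = Suc (\<Sum>j\<in>{i..<n}. Suc (\<theta> j)) \<and> I n s') s''"
          by (rule wp_mono) (use * step.hyps in \<open>simp add: sum.atLeast_Suc_lessThan\<close>)
      qed
    qed auto
  qed
  from this[of 0 s] show ?thesis using assms(1) by (simp add: atLeast0LessThan)
qed

section \<open>Computable functions on natural numbers\<close>

text \<open>The running time is exact and depends on the argument only, so that it is itself a function whose
  computability can be established.\<close>

definition impl :: "com \<Rightarrow> nat \<Rightarrow> (nat \<Rightarrow> nat) \<Rightarrow> (nat \<Rightarrow> nat) \<Rightarrow> bool" where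
  "impl c k f T \<longleftrightarrow> (\<forall>r m. wp c (\<lambda>t s. t = T (r k) \<and> snd s = m \<and> fst s k = f (r k) \<and>
     (\<forall>j<k. fst s j = r j)) (r, m))"

text \<open>The order of the quantifiers makes the running time independent of the register
  \<open>k\<close> at which the program works, so that one \<open>T\<close> serves however deeply
  programs are nested.\<close>

definition cmpn :: "(nat \<Rightarrow> nat) \<Rightarrow> bool" where
  "cmpn f \<longleftrightarrow> (\<exists>T. \<forall>k. \<exists>c. impl c k f T)"

lemma implI:
  assumes "\<And>r m. wp c (\<lambda>t s. t = T (r k) \<and> snd s = m \<and> fst s k = f (r k) \<and>
     (\<forall>j<k. fst s j = r j)) (r, m)"
  shows "impl c k f T"
  using assms unfolding impl_def by blast

lemma wp_impl:
  assumes "impl c k f T"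
    and "\<And>r'. r' k = f (r k) \<Longrightarrow> (\<And>j. j < k \<Longrightarrow> r' j = r j) \<Longrightarrow> Q (T (r k)) (r', m)"
  shows "wp c Q (r, m)"
  using assms(1)[unfolded impl_def, rule_format, of r m]
  by (rule wp_mono) (use assms(2) in auto)

lemma cmpnI: "(\<And>k. impl (c k) k f T) \<Longrightarrow> cmpn f"
  unfolding cmpn_def by blast

definition mov :: "nat \<Rightarrow> nat \<Rightarrow> com" where
  "mov x y = Seq (Const x 0) (Add x x y)"

lemma wp_mov [simp]: "x \<noteq> y \<Longrightarrow> wp (mov x y) Q (r, m) \<longleftrightarrow> Q 2 (r(x := r y), m)"
  by (simp add: mov_def numeral_2_eq_2)

lemma cmpn_const: "cmpn (\<lambda>_. n)"
  by (rule cmpnI[of "\<lambda>k. Const k n" _ "\<lambda>_. 1"]) (simp add: impl_def)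

lemma cmpn_id: "cmpn (\<lambda>x. x)"
  by (rule cmpnI[of "\<lambda>k. Const (Suc k) 0" _ "\<lambda>_. 1"]) (simp add: impl_def)

lemma cmpn_comp:
  assumes "cmpn f" "cmpn g"
  shows "cmpn (\<lambda>x. f (g x))"
proof -
  obtain c T where c: "\<And>k. impl (c k) k f T" using assms(1) unfolding cmpn_def by metis
  obtain d S where d: "\<And>k. impl (d k) k g S" using assms(2) unfolding cmpn_def by metis
  show ?thesis
  proof (rule cmpnI[of "\<lambda>k. Seq (d k) (c k)" _ "\<lambda>x. S x + T (g x)"], rule implI)
    fix k r m
    show "wp (Seq (d k) (c k)) (\<lambda>t s. t = S (r k) + T (g (r k)) \<and> snd s = m \<and>
        fst s k = f (g (r k)) \<and> (\<forall>j<k. fst s j = r j)) (r, m)"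
      by (auto intro!: wp_impl[OF c] wp_impl[OF d])
  qed
qed

text \<open>The argument stays in \<open>k\<close> while \<open>c\<close> works at
  \<open>k+1\<close> and \<open>d\<close> at \<open>k+2\<close>, each preserving all registers below
  its own; only the last move overwrites it with the value of \<open>f\<close>. The three moves cost
  the 6 steps in \<open>wp_both\<close>.\<close>

definition both :: "com \<Rightarrow> com \<Rightarrow> nat \<Rightarrow> com" where
  "both c d k = Seq (mov (k+1) k) (Seq c (Seq (mov (k+2) k) (Seq d (mov k (k+1)))))"

lemma wp_both:
  assumes "impl c (k+1) f T" "impl d (k+2) g S"
    and "\<And>r'. r' k = f (r k) \<Longrightarrow> r' (k+1) = f (r k) \<Longrightarrow> r' (k+2) = g (r k) \<Longrightarrow>
      (\<And>j. j < k \<Longrightarrow> r' j = r j) \<Longrightarrow> Q (6 + (T (r k) + S (r k))) (r', m)"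
  shows "wp (both c d k) Q (r, m)"
  unfolding both_def
  apply (simp del: One_nat_def)
  apply (rule wp_impl[OF assms(1)])
  apply (simp del: One_nat_def)
  apply (rule wp_impl[OF assms(2)])
  apply (simp del: One_nat_def)
  subgoal for r1 r2
    using assms(3)[of "r2(k := r2 (Suc k))"] by (auto simp: eval_nat_numeral algebra_simps)
  done

lemma cmpn_binop:
  assumes "cmpn f" "cmpn g"
    and op: "\<And>k r m. wp (p k) (\<lambda>t s. t = P (r k) (r (k+2)) \<and> snd s = m \<and>
      fst s k = h (r k) (r (k+2)) \<and> (\<forall>j<k. fst s j = r j)) (r, m)"
  shows "cmpn (\<lambda>x. h (f x) (g x))"
proof -
  obtain c T where c: "\<And>k. impl (c k) k f T" using assms(1) unfolding cmpn_def by metis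
  obtain d S where d: "\<And>k. impl (d k) k g S" using assms(2) unfolding cmpn_def by metis
  show ?thesis
  proof (rule cmpnI[of "\<lambda>k. Seq (both (c (k+1)) (d (k+2)) k) (p k)" _
        "\<lambda>x. 6 + (T x + S x) + P (f x) (g x)"], rule implI)
    fix k r m
    show "wp (Seq (both (c (k+1)) (d (k+2)) k) (p k))
        (\<lambda>t s. t = 6 + (T (r k) + S (r k)) + P (f (r k)) (g (r k)) \<and> snd s = m \<and>
        fst s k = h (f (r k)) (g (r k)) \<and> (\<forall>j<k. fst s j = r j)) (r, m)"
      unfolding wp_Seq
      by (rule wp_both[OF c d], rule wp_mono, rule op) auto
  qed
qed

lemma cmpn_add: "cmpn f \<Longrightarrow> cmpn g \<Longrightarrow> cmpn (\<lambda>x. f x + g x)"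
  by (rule cmpn_binop[where p = "\<lambda>k. Add k k (k+2)" and P = "\<lambda>_ _. 1" and h = "(+)"]) auto

lemma cmpn_sub: "cmpn f \<Longrightarrow> cmpn g \<Longrightarrow> cmpn (\<lambda>x. f x - g x)"
  by (rule cmpn_binop[where p = "\<lambda>k. Sub k k (k+2)" and P = "\<lambda>_ _. 1" and h = "(-)"]) auto

text \<open>\<open>prod_encode (m, n)\<close> is \<open>triangle (m + n) + m\<close>; the loop adds
  the numbers from \<open>m + n\<close> down to 1 to \<open>m\<close>.\<close>

definition pairing :: "nat \<Rightarrow> nat \<Rightarrow> com" where
  "pairing a b = Seq (Add b a b) (Seq (Const (Suc b) 1)
     (While b (Seq (Add a a b) (Sub b b (Suc b)))))"

lemma wp_pairing:
  assumes "a < b"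
    and "\<And>r'. r' a = prod_encode (r a, r b) \<Longrightarrow> (\<And>j. j < b \<Longrightarrow> j \<noteq> a \<Longrightarrow> r' j = r j) \<Longrightarrow>
      Q (3 + 3 * (r a + r b)) (r', m)"
  shows "wp (pairing a b) Q (r, m)"
proof -
  let ?n = "r a + r b"
  let ?I = "\<lambda>i s. snd s = m \<and> fst s b = ?n - i \<and> fst s (Suc b) = 1 \<and> i \<le> ?n \<and>
    fst s a + triangle (?n - i) = triangle ?n + r a \<and> (\<forall>j<b. j \<noteq> a \<longrightarrow> fst s j = r j)"
  have "wp (While b (Seq (Add a a b) (Sub b b (Suc b))))
     (\<lambda>t s. t = Suc (\<Sum>i<?n. Suc 2) \<and> ?I ?n s) (r(b := ?n, Suc b := 1), m)"
  proof (rule wp_While_count[where I = ?I])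
    fix i and s :: store
    assume "i < ?n" "?I i s"
    moreover obtain r' m' where "s = (r', m')" by force
    moreover have "triangle (?n - i) = triangle (?n - Suc i) + (?n - i)"
      using \<open>i < ?n\<close> by (metis Suc_diff_Suc triangle_Suc)
    ultimately show "fst s b \<noteq> 0 \<and>
      wp (Seq (Add a a b) (Sub b b (Suc b))) (\<lambda>t s'. t = 2 \<and> ?I (Suc i) s') s"
      using \<open>a < b\<close> by auto
  qed (use \<open>a < b\<close> in auto)
  then show ?thesis
    unfolding pairing_def using \<open>a < b\<close>
    apply (auto elim!: wp_mono)
    subgoal for r'
      using assms(2)[of r'] by (simp add: prod_encode_def algebra_simps eval_nat_numeral)
    done
qed

lemma cmpn_pair: "cmpn f \<Longrightarrow> cmpn g \<Longrightarrow> cmpn (\<lambda>x. prod_encode (f x, g x))"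
  by (rule cmpn_binop[where p = "\<lambda>k. pairing k (k+2)" and P = "\<lambda>x y. 3 + 3 * (x + y)"
        and h = "\<lambda>x y. prod_encode (x, y)"]) (auto intro!: wp_pairing)

text \<open>The loop follows \<open>prod_decode_aux\<close>: \<open>b\<close> is the current
  diagonal, \<open>a\<close> what remains of the code, and the truncated difference in
  \<open>d\<close> is nonzero exactly as long as another diagonal has to be removed.\<close>

definition unpairing :: "nat \<Rightarrow> nat \<Rightarrow> nat \<Rightarrow> nat \<Rightarrow> com" where
  "unpairing a b c d = Seq (Const b 0) (Seq (Const c 1) (Seq (Sub d a b)
    (Seq (While d (Seq (Add b b c) (Seq (Sub a a b) (Sub d a b)))) (Sub b b a))))"

text \<open>The time is not written in closed form. It is obtained along the recursion of
  \<open>prod_decode_aux\<close> and then chosen once for all registers and stores, which leaves it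
  a function of the argument.\<close>

lemma wp_unpairing:
  "\<exists>T. \<forall>a b c d r m. distinct [a, b, c, d] \<longrightarrow> wp (unpairing a b c d) (\<lambda>t s. t = T (r a) \<and>
     snd s = m \<and> (fst s a, fst s b) = prod_decode (r a) \<and>
     (\<forall>j. j \<notin> {a, b, c, d} \<longrightarrow> fst s j = r j)) (r, m)"
proof -
  define P where "P n y x \<longleftrightarrow> (\<forall>a b c d r m. distinct [a, b, c, d] \<longrightarrow> r c = 1 \<longrightarrow> r a = x \<longrightarrow>
    r b = y \<longrightarrow> r d = x - y \<longrightarrow> wp (While d (Seq (Add b b c) (Seq (Sub a a b) (Sub d a b))))
     (\<lambda>t s. t = n \<and> snd s = m \<and> (fst s a, fst s b - fst s a) = prod_decode_aux y x \<and>
        (\<forall>j. j \<notin> {a, b, c, d} \<longrightarrow> fst s j = r j)) (r, m))" for n y x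
  have ex: "\<exists>n. P n y x" for x y
  proof (induction y x rule: prod_decode_aux.induct)
    case (1 y x)
    show ?case
    proof (cases "x \<le> y")
      case True
      then show ?thesis unfolding P_def
        by (intro exI[of _ 1]) (auto intro!: wp_While_stop simp: prod_decode_aux.simps)
    next
      case False
      then obtain n where n: "P n (Suc y) (x - Suc y)"
        using 1 by blast
      \<comment> \<open>One test and the three instructions of the body precede the rest of the
        run.\<close>
      have "P (n + 4) y x"
        unfolding P_def
      proof (intro allI impI)
        fix a b c d :: nat and r m
        assume a: "distinct [a, b, c, d]" "r c = 1" "r a = x" "r b = y" "r d = x - y"
        let ?r = "r(b := Suc y, a := x - Suc y, d := x - Suc y - Suc y)"
        have "wp (While d (Seq (Add b b c) (Seq (Sub a a b) (Sub d a b))))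
          (\<lambda>t s. t = n \<and> snd s = m \<and>
          (fst s a, fst s b - fst s a) = prod_decode_aux (Suc y) (x - Suc y) \<and>
          (\<forall>j. j \<notin> {a, b, c, d} \<longrightarrow> fst s j = ?r j)) (?r, m)"
          by (rule n[unfolded P_def, rule_format]) (use a in auto)
        moreover have "prod_decode_aux y x = prod_decode_aux (Suc y) (x - Suc y)"
          using False by (subst prod_decode_aux.simps) simp
        ultimately show "wp (While d (Seq (Add b b c) (Seq (Sub a a b) (Sub d a b))))
          (\<lambda>t s. t = n + 4 \<and> snd s = m \<and> (fst s a, fst s b - fst s a) = prod_decode_aux y x \<and>
            (\<forall>j. j \<notin> {a, b, c, d} \<longrightarrow> fst s j = r j)) (r, m)"
          using a False
          by (intro wp_While_step) (auto elim!: wp_mono)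
      qed
      then show ?thesis ..
    qed
  qed
  define n where "n x y = (SOME n. P n y x)" for x y
  have n: "P (n x y) y x" for x y
    unfolding n_def by (rule someI_ex[OF ex])
  show ?thesis
  proof (intro exI[of _ "\<lambda>x. n x 0 + 4"] allI impI)
    fix a b c d :: nat and r and m :: "nat \<Rightarrow> nat \<Rightarrow> nat"
    assume a: "distinct [a, b, c, d]"
    let ?r = "r(b := 0, c := 1, d := r a) :: nat \<Rightarrow> nat"
    have "wp (While d (Seq (Add b b c) (Seq (Sub a a b) (Sub d a b))))
     (\<lambda>t s. t = n (r a) 0 \<and> snd s = m \<and> (fst s a, fst s b - fst s a) = prod_decode_aux 0 (r a) \<and>
        (\<forall>j. j \<notin> {a, b, c, d} \<longrightarrow> fst s j = ?r j)) (?r, m)"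
      by (rule n[unfolded P_def, rule_format]) (use a in auto)
    then show "wp (unpairing a b c d) (\<lambda>t s. t = n (r a) 0 + 4 \<and> snd s = m \<and>
       (fst s a, fst s b) = prod_decode (r a) \<and>
       (\<forall>j. j \<notin> {a, b, c, d} \<longrightarrow> fst s j = r j)) (r, m)"
      using a unfolding unpairing_def by (auto elim!: wp_mono simp: prod_decode_def)
  qed
qed

lemma unpairing_impl:
  obtains T where "\<And>k r m. wp (unpairing k (k+1) (k+2) (k+3)) (\<lambda>t s. t = T (r k) \<and>
     snd s = m \<and> fst s k = fst (prod_decode (r k)) \<and> fst s (k+1) = snd (prod_decode (r k)) \<and>
     (\<forall>j<k. fst s j = r j)) (r, m)"
proof -
  obtain T where T: "\<And>a b c d r m. distinct [a, b, c, d] \<Longrightarrow>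
     wp (unpairing a b c d) (\<lambda>t s. t = T (r a) \<and>
     snd s = m \<and> (fst s a, fst s b) = prod_decode (r a) \<and>
     (\<forall>j. j \<notin> {a, b, c, d} \<longrightarrow> fst s j = r j)) (r, m)"
    using wp_unpairing by blast
  show thesis
    by (rule that[of T], rule wp_mono, rule T) (auto simp: prod_eq_iff dest: sym)
qed

lemma cmpn_fst: "cmpn (\<lambda>x. fst (prod_decode x))"
proof -
  obtain T where T: "\<And>k r m. wp (unpairing k (k+1) (k+2) (k+3)) (\<lambda>t s. t = T (r k) \<and>
     snd s = m \<and> fst s k = fst (prod_decode (r k)) \<and> fst s (k+1) = snd (prod_decode (r k)) \<and>
     (\<forall>j<k. fst s j = r j)) (r, m)"
    using unpairing_impl by blast
  show ?thesis
    by (rule cmpnI[of "\<lambda>k. unpairing k (k+1) (k+2) (k+3)" _ T], rule implI, rule wp_mono, rule T) auto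
qed

lemma cmpn_snd: "cmpn (\<lambda>x. snd (prod_decode x))"
proof -
  obtain T where T: "\<And>k r m. wp (unpairing k (k+1) (k+2) (k+3)) (\<lambda>t s. t = T (r k) \<and>
     snd s = m \<and> fst s k = fst (prod_decode (r k)) \<and> fst s (k+1) = snd (prod_decode (r k)) \<and>
     (\<forall>j<k. fst s j = r j)) (r, m)"
    using unpairing_impl by blast
  have "impl (Seq (unpairing k (k+1) (k+2) (k+3)) (mov k (k+1))) k
      (\<lambda>x. snd (prod_decode x)) (\<lambda>x. T x + 2)" for k
    by (rule implI, unfold wp_Seq, rule wp_mono, rule T) (auto simp del: One_nat_def)
  then show ?thesis by (rule cmpnI)
qed

lemma cmpn_if:
  assumes "cmpn b" "cmpn f" "cmpn g"
  shows "cmpn (\<lambda>x. if b x \<noteq> 0 then f x else g x)"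
proof -
  obtain p P where p: "\<And>k. impl (p k) k b P" using assms(1) unfolding cmpn_def by metis
  obtain c T where c: "\<And>k. impl (c k) k f T" using assms(2) unfolding cmpn_def by metis
  obtain d S where d: "\<And>k. impl (d k) k g S" using assms(3) unfolding cmpn_def by metis
  show ?thesis
  proof (rule cmpnI[of "\<lambda>k. Seq (mov (k+1) k) (Seq (p (k+1)) (If (k+1) (c k) (d k)))" _
        "\<lambda>x. 3 + P x + (if b x \<noteq> 0 then T x else S x)"], rule implI)
    fix k r m
    show "wp (Seq (mov (k+1) k) (Seq (p (k+1)) (If (k+1) (c k) (d k))))
        (\<lambda>t s. t = 3 + P (r k) + (if b (r k) \<noteq> 0 then T (r k) else S (r k)) \<and> snd s = m \<and>
        fst s k = (if b (r k) \<noteq> 0 then f (r k) else g (r k)) \<and> (\<forall>j<k. fst s j = r j)) (r, m)"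
      by (simp del: One_nat_def)
        (auto simp del: One_nat_def intro!: wp_impl[OF p] wp_impl[OF c] wp_impl[OF d])
  qed
qed

lemma cmpn_iter:
  assumes "cmpn f" "cmpn h" "cmpn g"
  shows "cmpn (\<lambda>x. (g ^^ f x) (h x))"
proof -
  obtain c T where c: "\<And>k. impl (c k) k f T" using assms(1) unfolding cmpn_def by metis
  obtain d S where d: "\<And>k. impl (d k) k h S" using assms(2) unfolding cmpn_def by metis
  obtain p P where p: "\<And>k. impl (p k) k g P" using assms(3) unfolding cmpn_def by metis
  let ?L = "\<lambda>k. While k (Seq (p (k+2)) (Sub k k (k+1)))"
  let ?prog = "\<lambda>k. Seq (both (c (k+1)) (d (k+2)) k) (Seq (Const (k+1) 1) (Seq (?L k) (mov k (k+2))))"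
  let ?T = "\<lambda>x. 6 + (T x + S x) + (1 + (Suc (\<Sum>i<f x. Suc (P ((g ^^ i) (h x)) + 1)) + 2))"
  show ?thesis
  proof (rule cmpnI[of ?prog _ ?T], rule implI)
    fix k :: nat and r and m :: "nat \<Rightarrow> nat \<Rightarrow> nat"
    let ?n = "f (r k)"
    let ?I = "\<lambda>i s. snd s = m \<and> fst s k = ?n - i \<and> fst s (k+1) = 1 \<and>
      fst s (k+2) = (g ^^ i) (h (r k)) \<and> (\<forall>j<k. fst s j = r j)"
    have loop: "wp (?L k) (\<lambda>t s. t = Suc (\<Sum>i<?n. Suc (P ((g ^^ i) (h (r k))) + 1)) \<and> ?I ?n s) s"
      if "?I 0 s" for s
    proof (rule wp_While_count[where I = ?I])
      fix i and s :: store
      assume "i < ?n" and I: "?I i s"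
      obtain r' m' where s: "s = (r', m')" by force
      show "fst s k \<noteq> 0 \<and>
        wp (Seq (p (k+2)) (Sub k k (k+1))) (\<lambda>t s'. t = P ((g ^^ i) (h (r k))) + 1 \<and> ?I (Suc i) s') s"
        unfolding s wp_Seq
        by (rule conjI, use I s \<open>i < ?n\<close> in simp, rule wp_impl[OF p])
          (use I s \<open>i < ?n\<close> in \<open>simp del: One_nat_def\<close>)
    qed (use that in auto)
    show "wp (?prog k) (\<lambda>t s. t = ?T (r k) \<and> snd s = m \<and>
      fst s k = (g ^^ ?n) (h (r k)) \<and> (\<forall>j<k. fst s j = r j)) (r, m)"
      unfolding wp_Seq
      apply (rule wp_both[OF c d])
      apply (simp only: wp_Const)
      apply (rule wp_mono)
       apply (rule loop)
       apply simp
      subgoal for r' t s by (cases s) (simp del: One_nat_def)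
      done
  qed
qed

lemma wp_impl2:
  assumes "impl c k f T"
    and "\<And>r'. r' k = f (prod_encode (r k, r (k+1))) \<Longrightarrow> (\<And>j. j < k \<Longrightarrow> r' j = r j) \<Longrightarrow>
      Q (3 + 3 * (r k + r (k+1)) + T (prod_encode (r k, r (k+1)))) (r', m)"
  shows "wp (Seq (pairing k (k+1)) c) Q (r, m)"
  unfolding wp_Seq
  by (rule wp_pairing, simp, rule wp_impl[OF assms(1)])
    (use assms(2) in auto)

text \<open>Unbounded search, made total by the existence hypothesis. It gives access to numbers
  that are known to exist but for which no bound has been computed.\<close>

lemma cmpn_least:
  assumes "cmpn p" and ex: "\<And>x. \<exists>y. p (prod_encode (x, y)) = 0"
  shows "cmpn (\<lambda>x. LEAST y. p (prod_encode (x, y)) = 0)"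
proof -
  obtain c T where c: "\<And>k. impl (c k) k p T" using assms(1) unfolding cmpn_def by metis
  define \<mu> where "\<mu> x = (LEAST y. p (prod_encode (x, y)) = 0)" for x
  let ?C = "\<lambda>k. Seq (mov (k+3) k) (Seq (mov (k+3+1) (k+1)) (Seq (pairing (k+3) (k+3+1)) (c (k+3))))"
  let ?TC = "\<lambda>x y. 4 + (3 + 3 * (x + y) + T (prod_encode (x, y)))"
  let ?prog = "\<lambda>k. Seq (Const (k+1) 0) (Seq (Const (k+2) 1) (Seq (?C k)
     (Seq (While (k+3) (Seq (Add (k+1) (k+1) (k+2)) (?C k))) (mov k (k+1)))))"
  let ?T = "\<lambda>x. 2 + ?TC x 0 + Suc (\<Sum>i<\<mu> x. Suc (1 + ?TC x (Suc i))) + 2"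
  have C: "wp (?C k) Q (r, m)"
    if "\<And>r'. r' (k+3) = p (prod_encode (r k, r (k+1))) \<Longrightarrow> (\<And>j. j < k+3 \<Longrightarrow> r' j = r j) \<Longrightarrow>
      Q (?TC (r k) (r (k+1))) (r', m)" for k r m Q
    apply (simp only: wp_Seq[of "mov _ _"])
    apply (subst wp_mov, simp)+
    apply (rule wp_impl2[OF c[of "k+3"]])
    subgoal for r'
      using that[of r'] by (auto simp: eval_nat_numeral algebra_simps)
    done
  have "cmpn \<mu>"
  proof (rule cmpnI[of ?prog _ ?T], rule implI)
    fix k :: nat and r and m :: "nat \<Rightarrow> nat \<Rightarrow> nat"
    let ?n = "\<mu> (r k)"
    have n: "p (prod_encode (r k, ?n)) = 0" "\<And>i. i < ?n \<Longrightarrow> p (prod_encode (r k, i)) \<noteq> 0"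
      using LeastI_ex[OF ex] not_less_Least unfolding \<mu>_def by fast+
    let ?I = "\<lambda>i s. snd s = m \<and> fst s k = r k \<and> fst s (k+1) = i \<and> fst s (k+2) = 1 \<and>
      fst s (k+3) = p (prod_encode (r k, i)) \<and> (\<forall>j<k. fst s j = r j)"
    have loop: "wp (While (k+3) (Seq (Add (k+1) (k+1) (k+2)) (?C k)))
       (\<lambda>t s. t = Suc (\<Sum>i<?n. Suc (1 + ?TC (r k) (Suc i))) \<and> ?I ?n s) s" if "?I 0 s" for s
    proof (rule wp_While_count[where I = ?I])
      fix i and s :: store
      assume "i < ?n" and I: "?I i s"
      obtain r' m' where s: "s = (r', m')" by force
      show "fst s (k+3) \<noteq> 0 \<and> wp (Seq (Add (k+1) (k+1) (k+2)) (?C k))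
        (\<lambda>t s'. t = 1 + ?TC (r k) (Suc i) \<and> ?I (Suc i) s') s"
        unfolding s wp_Seq[of "Add _ _ _"] wp_Add
        by (rule conjI, use I s n(2)[OF \<open>i < ?n\<close>] in simp, rule C)
          (use I s in \<open>simp add: less_Suc_eq\<close>)
    qed (use that n in auto)
    show "wp (?prog k) (\<lambda>t s. t = ?T (r k) \<and> snd s = m \<and> fst s k = ?n \<and>
      (\<forall>j<k. fst s j = r j)) (r, m)"
      unfolding wp_Seq[of "Const _ _"] wp_Const wp_Seq[of "?C k"]
      apply (rule C)
      unfolding wp_Seq[of "While _ _"]
      apply (rule wp_mono)
       apply (rule loop)
       apply simp
      subgoal for r' t s by (cases s) (simp del: One_nat_def)
      done
  qed
  then show ?thesis unfolding \<mu>_def .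
qed

section \<open>Programs with a clock\<close>

fun regs :: "com \<Rightarrow> nat set" where
  "regs (Const x n) = {x}"
| "regs (Add x y z) = {x, y, z}"
| "regs (Sub x y z) = {x, y, z}"
| "regs (Load x b y) = {x, y}"
| "regs (Store b x y) = {x, y}"
| "regs (Seq c d) = regs c \<union> regs d"
| "regs (If x c d) = insert x (regs c \<union> regs d)"
| "regs (While x c) = insert x (regs c)"

lemma finite_regs: "finite (regs c)"
  by (induction c) auto

text \<open>Register \<open>z\<close> counts the steps of the original program and register \<open>Suc z\<close> holds the constant 1.\<close>

fun clock :: "nat \<Rightarrow> com \<Rightarrow> com" where
  "clock z (Seq c d) = Seq (clock z c) (clock z d)"
| "clock z (If x c d) = If x (Seq (Add z z (Suc z)) (clock z c)) (Seq (Add z z (Suc z)) (clock z d))"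
| "clock z (While x c) = Seq (While x (Seq (Add z z (Suc z)) (clock z c))) (Add z z (Suc z))"
| "clock z c = Seq c (Add z z (Suc z))"

lemma wp_exact: "wp c (\<lambda>t s'. t = T \<and> s' = S) s \<longleftrightarrow> exec c s T S"
  unfolding wp_def by blast

definition with_clock :: "nat \<Rightarrow> nat \<Rightarrow> store \<Rightarrow> store" where
  "with_clock z a s = ((fst s)(z := a, Suc z := 1), snd s)"

lemma fst_with_clock: "x \<noteq> z \<Longrightarrow> x \<noteq> Suc z \<Longrightarrow> fst (with_clock z a s) x = fst s x"
  by (simp add: with_clock_def)

lemma exec_tick: "exec (Add z z (Suc z)) (with_clock z a s) 1 (with_clock z (Suc a) s)"
  unfolding wp_exact[symmetric] with_clock_def by (simp add: fun_upd_twist)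

lemma exec_atom_clock:
  assumes "\<And>z. clock z c = Seq c (Add z z (Suc z))"
    and "exec c (with_clock z a s) 1 (with_clock z a s')"
  shows "exec (clock z c) (with_clock z a s) (2 * 1) (with_clock z (a + 1) s')"
  using exec.intros(6)[OF assms(2) exec_tick] assms(1) by (simp add: numeral_2_eq_2)

lemma exec_clock:
  assumes "exec c s t s'" "z \<notin> regs c" "Suc z \<notin> regs c"
  shows "exec (clock z c) (with_clock z a s) (2 * t) (with_clock z (a + t) s')"
  using assms
proof (induction c s t s' arbitrary: a rule: exec.induct)
  case (6 c s t s' d t' s'')
  then have z: "z \<notin> regs c" "Suc z \<notin> regs c" "z \<notin> regs d" "Suc z \<notin> regs d"
    by auto
  from exec.intros(6)[OF "6.IH"(1)[OF z(1,2)] "6.IH"(2)[OF z(3,4)]] show ?case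
    by (simp add: algebra_simps)
next
  case (7 s x c t s' d)
  then have z: "z \<notin> regs c" "Suc z \<notin> regs c" "fst (with_clock z a s) x \<noteq> 0"
    by (auto simp: fst_with_clock)
  from exec.intros(7)[OF z(3) exec.intros(6)[OF exec_tick "7.IH"[OF z(1,2)]]] show ?case
    by simp
next
  case (8 s x d t s' c)
  then have z: "z \<notin> regs d" "Suc z \<notin> regs d" "fst (with_clock z a s) x = 0"
    by (auto simp: fst_with_clock)
  from exec.intros(8)[OF z(3) exec.intros(6)[OF exec_tick "8.IH"[OF z(1,2)]]] show ?case
    by simp
next
  case (9 s x c)
  then have "fst (with_clock z a s) x = 0"
    by (auto simp: fst_with_clock)
  from exec.intros(6)[OF exec.intros(9)[OF this] exec_tick] show ?case
    by (simp add: numeral_2_eq_2)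
next
  case (10 s x c t s' t' s'')
  then have z: "z \<notin> regs c" "Suc z \<notin> regs c" "fst (with_clock z a s) x \<noteq> 0"
    by (auto simp: fst_with_clock)
  have "exec (clock z (While x c)) (with_clock z (Suc a + t) s') (2 * t')
    (with_clock z (Suc a + t + t') s'')"
    by (rule "10.IH"(2)) (use "10.prems" in auto)
  \<comment> \<open>A clocked loop ticks for its failing test only after the loop. The induction
    hypothesis is therefore split into the loop and this tick before the rule for one more iteration
    can be applied to the loop.\<close>
  then obtain u v s1 where u: "exec (While x (Seq (Add z z (Suc z)) (clock z c)))
      (with_clock z (Suc a + t) s') u s1" "exec (Add z z (Suc z)) s1 v (with_clock z (Suc a + t + t') s'')"
    "2 * t' = u + v"
    by (auto elim!: exec_SeqE)
  from exec.intros(10)[OF z(3) exec.intros(6)[OF exec_tick "10.IH"(1)[OF z(1,2)]] u(1)]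
  have "exec (While x (Seq (Add z z (Suc z)) (clock z c))) (with_clock z a s)
    (Suc (1 + 2 * t + u)) s1" .
  from exec.intros(6)[OF this u(2)] show ?case
    using u(3) by (simp add: add.assoc)
qed (rule exec_atom_clock; simp add: wp_exact[symmetric] with_clock_def fun_upd_twist)+

text \<open>The clocked program outputs the number of steps of the original one. The clock registers
  lie above all registers in use, so the original computation is undisturbed. Every running time
  thereby becomes a function that other programs can evaluate.\<close>

lemma cmpn_time:
  assumes "\<And>k. impl (c k) k f T"
  shows "cmpn T"
proof -
  define z where "z k = Suc (Max (insert k (regs (c k))))" for k
  have z: "z k \<notin> regs (c k)" "Suc (z k) \<notin> regs (c k)" "k < z k" for k
  proof -
    have "i < z k" if "i \<in> insert k (regs (c k))" for i
      using Max_ge[OF _ that] finite_regs[of "c k"] by (auto simp: z_def less_Suc_eq_le)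
    then show "z k \<notin> regs (c k)" "Suc (z k) \<notin> regs (c k)" "k < z k"
      by (auto dest: Suc_lessD)
  qed
  show ?thesis
  proof (rule cmpnI[of "\<lambda>k. Seq (Const (z k) 0) (Seq (Const (Suc (z k)) 1)
        (Seq (clock (z k) (c k)) (mov k (z k))))" _ "\<lambda>x. 2 * T x + 4"], rule implI)
    fix k r m
    obtain s' where s': "exec (c k) (r, m) (T (r k)) s'" "snd s' = m" "\<forall>j<k. fst s' j = r j"
      using assms[of k] unfolding impl_def wp_def by blast
    have "exec (clock (z k) (c k)) (r(z k := 0, Suc (z k) := 1), m) (2 * T (r k))
      ((fst s')(z k := T (r k), Suc (z k) := 1), m)"
      using exec_clock[OF s'(1) z(1,2), of 0] s'(2) by (simp add: with_clock_def)
    then have "wp (clock (z k) (c k)) (\<lambda>t s. t = 2 * T (r k) \<and>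
        s = ((fst s')(z k := T (r k), Suc (z k) := 1), m)) (r(z k := 0, Suc (z k) := 1), m)"
      unfolding wp_def by blast
    then show "wp (Seq (Const (z k) 0) (Seq (Const (Suc (z k)) 1)
        (Seq (clock (z k) (c k)) (mov k (z k))))) (\<lambda>t s. t = 2 * T (r k) + 4 \<and> snd s = m \<and>
        fst s k = T (r k) \<and> (\<forall>j<k. fst s j = r j)) (r, m)"
      using z(3)[of k] s'(3) by (auto elim!: wp_mono)
  qed
qed

section \<open>Computable functions on coded data\<close>

text \<open>A bijection instead of an injection: every number decodes to some datum, so there are no
  invalid codes to treat, and a search over all numbers is a search over all data.\<close>

class enc =
  fixes enc :: "'a \<Rightarrow> nat"
  assumes bij_enc: "bij enc"

instantiation nat :: enc
begin
definition enc_nat_inst: "enc (n::nat) = n"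
instance by standard (simp add: enc_nat_inst bij_def inj_def surj_def)
end

instantiation prod :: (enc, enc) enc
begin
definition enc_prod: "enc p = prod_encode (map_prod enc enc p)"
instance
proof
  have "enc = prod_encode \<circ> (map_prod enc enc :: 'a \<times> 'b \<Rightarrow> _)"
    by (auto simp: enc_prod)
  moreover have "bij (map_prod enc enc :: 'a \<times> 'b \<Rightarrow> _)"
    using bij_betw_map_prod[OF bij_enc bij_enc] by simp
  ultimately show "bij (enc :: 'a \<times> 'b \<Rightarrow> nat)"
    using bij_prod_encode bij_comp by metis
qed
end

instantiation list :: (enc) enc
begin
definition enc_list_inst: "enc xs = list_encode (map enc xs)"
instance
proof
  have "enc = list_encode \<circ> (map enc :: 'a list \<Rightarrow> _)"
    by (auto simp: enc_list_inst)
  moreover have "bij (map enc :: 'a list \<Rightarrow> _)"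
  proof (rule o_bij[of "map (inv enc)"])
    show "map (inv enc) \<circ> map enc = (id :: 'a list \<Rightarrow> _)"
      by (simp add: inv_o_cancel[OF bij_is_inj[OF bij_enc]])
    show "map enc \<circ> map (inv (enc :: 'a \<Rightarrow> _)) = id"
      by (simp add: surj_iff[THEN iffD1, OF bij_is_surj[OF bij_enc]])
  qed
  ultimately show "bij (enc :: 'a list \<Rightarrow> nat)"
    using bij_list_encode bij_comp by metis
qed
end

definition dec :: "nat \<Rightarrow> 'a::enc" where
  "dec = inv enc"

lemma enc_dec [simp]: "enc (dec n) = n"
  unfolding dec_def by (rule surj_f_inv_f[OF bij_is_surj[OF bij_enc]])

lemma dec_enc [simp]: "dec (enc x) = x"
  unfolding dec_def by (rule inv_f_f[OF bij_is_inj[OF bij_enc]])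

lemma enc_inject [simp]: "enc x = enc y \<longleftrightarrow> x = y"
  by (metis dec_enc)

lemma enc_Pair [simp]: "enc (a, b) = prod_encode (enc a, enc b)"
  by (simp add: enc_prod)

lemma enc_nat_id [simp]: "enc (n::nat) = n"
  by (simp add: enc_nat_inst)

lemma dec_nat_id [simp]: "dec n = (n::nat)"
  by (metis dec_enc enc_nat_id)

lemma enc_Nil [simp]: "enc [] = 0"
  by (simp add: enc_list_inst)

lemma enc_Cons [simp]: "enc (x # xs) = Suc (prod_encode (enc x, enc xs))"
  by (simp add: enc_list_inst)

definition cmp :: "('a::enc \<Rightarrow> 'b::enc) \<Rightarrow> bool" where
  "cmp f \<longleftrightarrow> cmpn (\<lambda>n. enc (f (dec n)))"

definition cmpb :: "('a::enc \<Rightarrow> bool) \<Rightarrow> bool" where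
  "cmpb P \<longleftrightarrow> cmp (\<lambda>x. if P x then 1 else 0 :: nat)"

named_theorems cmp

lemma cmpI:
  assumes "cmpn g" "\<And>x. g (enc x) = enc (f x)"
  shows "cmp f"
proof -
  have "g = (\<lambda>n. enc (f (dec n)))"
    using assms(2)[of "dec _"] by (auto simp: fun_eq_iff)
  then show ?thesis using assms(1) by (simp add: cmp_def)
qed

lemma cmpD:
  assumes "cmp f"
  shows "cmpn (\<lambda>n. enc (f (dec n)))"
  using assms unfolding cmp_def by simp

lemma cmp_id [cmp]: "cmp (\<lambda>x. x)"
  by (rule cmpI[OF cmpn_id]) simp

lemma cmp_const [cmp]: "cmp (\<lambda>_. c)"
  by (rule cmpI[OF cmpn_const[of "enc c"]]) simp

lemma cmp_comp: "cmp f \<Longrightarrow> cmp g \<Longrightarrow> cmp (\<lambda>x. f (g x))"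
  by (rule cmpI[OF cmpn_comp[OF cmpD cmpD, of f g]]) auto

lemma cmp_Pair [cmp]: "cmp f \<Longrightarrow> cmp g \<Longrightarrow> cmp (\<lambda>x. (f x, g x))"
  by (rule cmpI[OF cmpn_pair[OF cmpD cmpD, of f g]]) auto

lemma cmp_fst [cmp]: "cmp f \<Longrightarrow> cmp (\<lambda>x. fst (f x))"
  by (rule cmpI[OF cmpn_comp[OF cmpn_fst cmpD, of f]]) (auto simp: enc_prod)

lemma cmp_snd [cmp]: "cmp f \<Longrightarrow> cmp (\<lambda>x. snd (f x))"
  by (rule cmpI[OF cmpn_comp[OF cmpn_snd cmpD, of f]]) (auto simp: enc_prod)

lemma cmp_enc [cmp]: "cmp f \<Longrightarrow> cmp (\<lambda>x. enc (f x))"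
  by (rule cmpI[OF cmpD, of f]) auto

lemma cmp_dec [cmp]: "cmp f \<Longrightarrow> cmp (\<lambda>x. dec (f x))"
  by (rule cmpI[OF cmpD, of f]) auto

lemma cmp_add [cmp]: "cmp f \<Longrightarrow> cmp g \<Longrightarrow> cmp (\<lambda>x. f x + g x :: nat)"
  by (rule cmpI[OF cmpn_add[OF cmpD cmpD, of f g]]) auto

lemma cmp_sub [cmp]: "cmp f \<Longrightarrow> cmp g \<Longrightarrow> cmp (\<lambda>x. f x - g x :: nat)"
  by (rule cmpI[OF cmpn_sub[OF cmpD cmpD, of f g]]) auto

lemma cmp_Suc [cmp]: "cmp f \<Longrightarrow> cmp (\<lambda>x. Suc (f x))"
  using cmp_add[of f "\<lambda>_. 1"] by (simp add: cmp_const)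

lemma cmp_if [cmp]:
  assumes "cmpb P" "cmp f" "cmp g"
  shows "cmp (\<lambda>x. if P x then f x else g x)"
  by (rule cmpI[OF cmpn_if[OF cmpD[OF assms(1)[unfolded cmpb_def]] cmpD[OF assms(2)] cmpD[OF assms(3)]]])
    auto

text \<open>Computability is defined for unary functions only. These rules substitute into a
  function of several arguments once it is computable on tuples; this is how bodies under binders
  are handled.\<close>

lemma cmp2:
  assumes "cmp (\<lambda>p. f (fst p) (snd p))" "cmp a" "cmp b"
  shows "cmp (\<lambda>x. f (a x) (b x))"
  using cmp_comp[OF assms(1) cmp_Pair[OF assms(2,3)]] by simp

lemma cmp3:
  assumes "cmp (\<lambda>p. f (fst p) (fst (snd p)) (snd (snd p)))" "cmp a" "cmp b" "cmp c"
  shows "cmp (\<lambda>x. f (a x) (b x) (c x))"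
  using cmp_comp[OF assms(1) cmp_Pair[OF assms(2) cmp_Pair[OF assms(3,4)]]] by simp

lemma cmp4:
  assumes "cmp (\<lambda>p. f (fst p) (fst (snd p)) (fst (snd (snd p))) (snd (snd (snd p))))"
    "cmp a" "cmp b" "cmp c" "cmp d"
  shows "cmp (\<lambda>x. f (a x) (b x) (c x) (d x))"
  using cmp_comp[OF assms(1) cmp_Pair[OF assms(2) cmp_Pair[OF assms(3) cmp_Pair[OF assms(4,5)]]]]
  by simp

text \<open>The iterated function depends on \<open>x\<close>, so \<open>x\<close> is carried along
  as the first component of the iterated value and dropped at the end.\<close>

lemma cmp_funpow [cmp]:
  fixes g :: "'a::enc \<Rightarrow> 'b::enc \<Rightarrow> 'b"
  assumes "cmp (\<lambda>p. g (fst p) (snd p))" "cmp n" "cmp a"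
  shows "cmp (\<lambda>x. (g x ^^ n x) (a x))"
proof -
  let ?globals = "\<lambda>p. (fst p, g (fst p) (snd p))"
  have globals: "cmp ?globals" by (intro cmp assms)
  have pw: "(?globals ^^ k) (x, v) = (x, (g x ^^ k) v)" for k x v
    by (induction k) auto
  have en: "((\<lambda>c. enc (?globals (dec c))) ^^ k) (enc p) = enc ((?globals ^^ k) p)" for k p
    by (induction k) auto
  from cmpn_iter[OF cmpD[OF assms(2)] cmpD[OF cmp_Pair[OF cmp_id assms(3)]] cmpD[OF globals]]
  have "cmp (\<lambda>x. (?globals ^^ n x) (x, a x))"
    by (rule cmpI) (simp only: en dec_enc enc_nat_id)
  then have "cmp (\<lambda>x. snd ((?globals ^^ n x) (x, a x)))"
    by (rule cmp_snd)
  then show ?thesis by (simp add: pw)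
qed

lemma cmp_case_list [cmp]:
  fixes l :: "'a::enc \<Rightarrow> 'b::enc list"
  assumes "cmp l" "cmp a" "cmp (\<lambda>p. b (fst p) (fst (snd p)) (snd (snd p)))"
  shows "cmp (\<lambda>x. case l x of [] \<Rightarrow> a x | y # ys \<Rightarrow> b x y ys)"
proof -
  have "cmpn (\<lambda>c. if enc (l (dec c)) \<noteq> 0
     then enc ((\<lambda>p. b (fst p) (fst (snd p)) (snd (snd p)))
       (dec (prod_encode (c, enc (l (dec c)) - 1)))) else enc (a (dec c)))"
    by (intro cmpn_if cmpD assms(1,2) cmpn_comp[OF cmpD[OF assms(3)]] cmpn_pair cmpn_id cmpn_sub cmpn_const)
  then show ?thesis
  proof (rule cmpI, goal_cases)
    case (1 x)
    have "dec (prod_encode (enc x, prod_encode (enc y, enc ys))) = (x, y, ys)"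
      for y :: 'b and ys :: "'b list"
      by (metis dec_enc enc_Pair)
    then show ?case by (cases "l x") simp_all
  qed
qed

lemma length_le_enc: "length l \<le> enc (l :: 'a::enc list)"
proof (induction l)
  case (Cons a l)
  then show ?case using le_prod_encode_2[of "enc l" "enc a"] by simp
qed simp

text \<open>The code of a list is at least its length and serves as fuel. The surplus iterations do
  no harm because the step is the identity once the list is used up.\<close>

lemma cmp_foldl [cmp]:
  assumes "cmp (\<lambda>p. f (fst p) (fst (snd p)) (snd (snd p)))" "cmp a" "cmp l"
  shows "cmp (\<lambda>x. foldl (f x) (a x) (l x))"
proof -
  define st where "st x s = (case snd s of [] \<Rightarrow> s | y # ys \<Rightarrow> (f x (fst s) y, ys))" for x s
  have st: "cmp (\<lambda>p. st (fst p) (snd p))"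
    unfolding st_def
    by (intro cmp cmp3[of f, OF assms(1)])
  have pw: "(st x ^^ k) (v, ys) = (foldl (f x) v (take k ys), drop k ys)" for x k v ys
  proof (induction k arbitrary: v ys)
    case (Suc k)
    then show ?case
      by (cases ys) (simp_all add: funpow_Suc_right st_def del: funpow.simps)
  qed simp
  have "cmp (\<lambda>x. fst ((st x ^^ enc (l x)) (a x, l x)))"
    by (intro cmp st assms)
  then show ?thesis by (simp add: pw length_le_enc)
qed

lemma cmp_Cons [cmp]: "cmp f \<Longrightarrow> cmp g \<Longrightarrow> cmp (\<lambda>x. f x # g x)"
  by (rule cmpI[OF cmpn_add[OF cmpn_pair[OF cmpD cmpD, of f g] cmpn_const[of 1]]]) auto

lemma cmp_rev [cmp]:
  assumes "cmp l"
  shows "cmp (\<lambda>x. rev (l x))"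
proof -
  have "foldl (\<lambda>xs x. x # xs) a l = rev l @ a" for a and l :: "'b list"
    by (induction l arbitrary: a) auto
  moreover have "cmp (\<lambda>x. foldl (\<lambda>xs x. x # xs) [] (l x))"
    by (intro cmp assms)
  ultimately show ?thesis by simp
qed

lemma cmp_foldr [cmp]:
  assumes "cmp (\<lambda>p. f (fst p) (fst (snd p)) (snd (snd p)))" "cmp l" "cmp a"
  shows "cmp (\<lambda>x. foldr (f x) (l x) (a x))"
proof -
  have "cmp (\<lambda>x. foldl (\<lambda>v y. f x y v) (a x) (rev (l x)))"
    by (intro cmp assms cmp3[of f, OF assms(1)])
  then show ?thesis by (simp add: foldl_conv_foldr)
qed

lemma cmp_map [cmp]:
  assumes "cmp (\<lambda>p. f (fst p) (snd p))" "cmp l"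
  shows "cmp (\<lambda>x. map (f x) (l x))"
proof -
  have "cmp (\<lambda>x. foldr (\<lambda>y ys. f x y # ys) (l x) [])"
    by (intro cmp assms cmp2[of f, OF assms(1)])
  moreover have "foldr (\<lambda>y ys. f x y # ys) l [] = map (f x) l" for x l
    by (induction l) auto
  ultimately show ?thesis by simp
qed

lemma cmp_append [cmp]:
  assumes "cmp a" "cmp b"
  shows "cmp (\<lambda>x. a x @ b x)"
proof -
  have "cmp (\<lambda>x. foldr (\<lambda>y ys. y # ys) (a x) (b x))"
    by (intro cmp assms)
  moreover have "foldr (\<lambda>y ys. y # ys) l m = l @ m" for l m :: "'b list"
    by (induction l) auto
  ultimately show ?thesis by simp
qed

lemma cmp_concat [cmp]:
  assumes "cmp l"
  shows "cmp (\<lambda>x. concat (l x))"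
proof -
  have "cmp (\<lambda>x. foldr (\<lambda>y ys. y @ ys) (l x) [])"
    by (intro cmp assms)
  moreover have "foldr (\<lambda>y ys. y @ ys) l [] = concat l" for l :: "'b list list"
    by (induction l) auto
  ultimately show ?thesis by simp
qed

lemma cmp_filter [cmp]:
  assumes "cmpb (\<lambda>p. P (fst p) (snd p))" "cmp l"
  shows "cmp (\<lambda>x. filter (P x) (l x))"
proof -
  have "cmp (\<lambda>x. concat (map (\<lambda>y. if P x y then [y] else []) (l x)))"
    by (intro cmp assms)
  moreover have "concat (map (\<lambda>y. if P x y then [y] else []) l) = filter (P x) l" for x l
    by (induction l) auto
  ultimately show ?thesis by simp
qed

lemma cmp_length [cmp]:
  assumes "cmp l"
  shows "cmp (\<lambda>x. length (l x))"
proof -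
  have "cmp (\<lambda>x. foldl (\<lambda>n _. Suc n) 0 (l x))"
    by (intro cmp assms)
  moreover have "foldl (\<lambda>n _. Suc n) k l = k + length l" for k and l :: "'b list"
    by (induction l arbitrary: k) auto
  ultimately show ?thesis by simp
qed

lemma cmp_sum_list [cmp]:
  assumes "cmp l"
  shows "cmp (\<lambda>x. sum_list (l x) :: nat)"
proof -
  have "cmp (\<lambda>x. foldr (+) (l x) 0)"
    by (intro cmp assms)
  then show ?thesis by (simp add: sum_list.eq_foldr)
qed

lemma cmp_hd [cmp]: "cmp l \<Longrightarrow> cmp (\<lambda>x. hd (l x))"
  unfolding hd_def by (intro cmp)

lemma cmp_tl [cmp]: "cmp l \<Longrightarrow> cmp (\<lambda>x. tl (l x))"
  unfolding tl_def by (intro cmp)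

lemma cmp_drop [cmp]:
  assumes "cmp n" "cmp l"
  shows "cmp (\<lambda>x. drop (n x) (l x))"
proof -
  have "cmp (\<lambda>x. (tl ^^ n x) (l x))"
    by (intro cmp assms)
  moreover have "(tl ^^ k) l = drop k l" for k and l :: "'b list"
    by (induction k) (auto simp: drop_Suc tl_drop)
  ultimately show ?thesis by simp
qed

lemma cmp_upt [cmp]:
  assumes "cmp n"
  shows "cmp (\<lambda>x. [0..<n x])"
proof -
  have "cmp (\<lambda>x. ((\<lambda>l. l @ [length l]) ^^ n x) [])"
    by (intro cmp assms)
  moreover have "((\<lambda>l. l @ [length l]) ^^ k) [] = [0..<k]" for k
    by (induction k) auto
  ultimately show ?thesis by simp
qed

lemma cmp_n_lists [cmp]:
  assumes "cmp n" "cmp l"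
  shows "cmp (\<lambda>x. List.n_lists (n x) (l x))"
proof -
  have "cmp (\<lambda>x. ((\<lambda>L. concat (map (\<lambda>ys. map (\<lambda>y. y # ys) (l x)) L)) ^^ n x) [[]])"
    by (intro cmp assms cmp_comp[OF assms(2)])
  moreover have "((\<lambda>L. concat (map (\<lambda>ys. map (\<lambda>y. y # ys) l) L)) ^^ k) [[]] = List.n_lists k l"
    for k and l :: "'b list"
    by (induction k) auto
  ultimately show ?thesis by simp
qed

lemma cmp_product_lists [cmp]:
  assumes "cmp l"
  shows "cmp (\<lambda>x. product_lists (l x))"
proof -
  have "cmp (\<lambda>x. foldr (\<lambda>xs L. concat (map (\<lambda>x. map (\<lambda>ys. x # ys) L) xs)) (l x) [[]])"
    by (intro cmp assms)
  moreover have "foldr (\<lambda>xs L. concat (map (\<lambda>x. map (\<lambda>ys. x # ys) L) xs)) l [[]] = product_lists l"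
    for l :: "'b list list"
    by (induction l) auto
  ultimately show ?thesis by simp
qed

lemma cmp_cong: "cmp f \<Longrightarrow> (\<And>x. f x = g x) \<Longrightarrow> cmp g"
  by (subgoal_tac "f = g") auto

lemma cmpbI: "cmp (\<lambda>x. if P x then 1 else 0 :: nat) \<Longrightarrow> cmpb P"
  by (simp add: cmpb_def)

lemma cmpb_not [cmp]:
  assumes "cmpb P"
  shows "cmpb (\<lambda>x. \<not> P x)"
proof -
  have "cmp (\<lambda>x. if P x then 0 else 1 :: nat)" by (intro cmp assms)
  then show ?thesis unfolding cmpb_def by (rule cmp_cong) auto
qed

lemma cmpb_conj [cmp]:
  assumes "cmpb P" "cmpb Q"
  shows "cmpb (\<lambda>x. P x \<and> Q x)"
proof -
  have "cmp (\<lambda>x. if P x then (if Q x then 1 else 0) else 0 :: nat)" by (intro cmp assms)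
  then show ?thesis unfolding cmpb_def by (rule cmp_cong) auto
qed

lemma cmpb_disj [cmp]:
  assumes "cmpb P" "cmpb Q"
  shows "cmpb (\<lambda>x. P x \<or> Q x)"
  using cmpb_not[OF cmpb_conj[OF cmpb_not cmpb_not, OF assms]] by simp

lemma cmpb_imp [cmp]:
  assumes "cmpb P" "cmpb Q"
  shows "cmpb (\<lambda>x. P x \<longrightarrow> Q x)"
  using cmpb_disj[OF cmpb_not[OF assms(1)] assms(2)] by simp

lemma cmpb_zero:
  assumes "cmp f"
  shows "cmpb (\<lambda>x. f x = (0::nat))"
proof (rule cmpbI)
  have "cmpn (\<lambda>c. if enc (f (dec c)) \<noteq> 0 then 0 else 1)"
    by (intro cmpn_if cmpD assms cmpn_const)
  then show "cmp (\<lambda>x. if f x = 0 then 1 else 0 :: nat)"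
    by (rule cmpI) auto
qed

lemma cmpb_eq [cmp]:
  assumes "cmp f" "cmp g"
  shows "cmpb (\<lambda>x. f x = g x)"
proof -
  have "cmpb (\<lambda>x. (enc (f x) - enc (g x)) + (enc (g x) - enc (f x)) = 0)"
    by (intro cmpb_zero cmp assms)
  moreover have "m - n + (n - m) = 0 \<longleftrightarrow> m = n" for m n :: nat
    by arith
  ultimately show ?thesis by simp
qed

lemma cmpb_le [cmp]:
  assumes "cmp f" "cmp g"
  shows "cmpb (\<lambda>x. f x \<le> (g x :: nat))"
proof -
  have "cmpb (\<lambda>x. f x - g x = 0)"
    by (intro cmpb_zero cmp assms)
  then show ?thesis by simp
qed

lemma cmpb_less [cmp]: "cmp f \<Longrightarrow> cmp g \<Longrightarrow> cmpb (\<lambda>x. f x < (g x :: nat))"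
  unfolding Suc_le_eq[symmetric] by (intro cmp)

lemma cmpb_bex [cmp]:
  assumes "cmpb (\<lambda>p. P (fst p) (snd p))" "cmp l"
  shows "cmpb (\<lambda>x. \<exists>y\<in>set (l x). P x y)"
proof -
  have "cmpb (\<lambda>x. filter (P x) (l x) \<noteq> [])"
    by (intro cmp assms)
  then show ?thesis by (simp add: filter_empty_conv)
qed

lemma cmpb_ball [cmp]:
  assumes "cmpb (\<lambda>p. P (fst p) (snd p))" "cmp l"
  shows "cmpb (\<lambda>x. \<forall>y\<in>set (l x). P x y)"
  using cmpb_not[OF cmpb_bex[OF cmpb_not[OF assms(1)] assms(2)]] by simp

lemma cmpb_member [cmp]:
  assumes "cmp a" "cmp l"
  shows "cmpb (\<lambda>x. a x \<in> set (l x))"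
proof -
  have "cmpb (\<lambda>x. \<exists>y\<in>set (l x). a x = y)"
    by (intro cmp assms cmp_comp[OF assms(1)])
  then show ?thesis by simp
qed

lemma cmpb_comp: "cmpb P \<Longrightarrow> cmp f \<Longrightarrow> cmpb (\<lambda>x. P (f x))"
  unfolding cmpb_def by (rule cmp_comp)

lemma cmpb2:
  assumes "cmpb (\<lambda>p. P (fst p) (snd p))" "cmp a" "cmp b"
  shows "cmpb (\<lambda>x. P (a x) (b x))"
  using cmpb_comp[OF assms(1) cmp_Pair[OF assms(2,3)]] by simp

lemma cmpb3:
  assumes "cmpb (\<lambda>p. f (fst p) (fst (snd p)) (snd (snd p)))" "cmp a" "cmp b" "cmp c"
  shows "cmpb (\<lambda>x. f (a x) (b x) (c x))"
  using cmpb_comp[OF assms(1) cmp_Pair[OF assms(2) cmp_Pair[OF assms(3,4)]]] by simp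

lemma cmp_Least:
  fixes P :: "'a::enc \<Rightarrow> nat \<Rightarrow> bool"
  assumes "cmpb (\<lambda>p. P (fst p) (snd p))" and ex: "\<And>x. \<exists>n. P x n"
  shows "cmp (\<lambda>x. LEAST n::nat. P x n)"
proof -
  have "cmp (\<lambda>p. if P (fst p) (snd p) then 0 else 1 :: nat)"
    by (intro cmp assms)
  from cmpD[OF this] have 1: "cmpn (\<lambda>c. if P (fst (dec c :: 'a \<times> nat)) (snd (dec c :: 'a \<times> nat)) then 0 else 1)"
    by (simp add: if_distrib cong: if_cong)
  have 2: "dec (prod_encode (c, y)) = (dec c :: 'a, y)" for c y
    by (metis dec_enc enc_Pair enc_dec enc_nat_id)
  have "cmpn (\<lambda>c. LEAST y. (if P (fst (dec (prod_encode (c, y)) :: 'a \<times> nat)) (snd (dec (prod_encode (c, y)) :: 'a \<times> nat))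
      then 0 else 1) = (0::nat))"
    by (rule cmpn_least[OF 1]) (use ex in \<open>simp add: 2\<close>)
  then show ?thesis
    by (rule cmpI) (simp add: 2)
qed

section \<open>States of a formula on a word\<close>

text \<open>A layer is represented by the code lists of \<open>\<ell>\<close>, \<open>r\<close>, \<open>T\<close>, \<open>I\<close>, \<open>F\<close>, in this order, and the list of its
  two flags. A symbol is the list of its components, each a list with at most one layer, where \<open>[]\<close> is the
  padding symbol. An instruction consists of a tag, as in the encoding of formulas, a variable or relation
  index, and a list of variables.\<close>

type_synonym lrep = "nat list list list \<times> nat list"
type_synonym symrep = "lrep list list"
type_synonym instr = "nat \<times> nat \<times> nat list"
type_synonym par = "nat list \<times> nat \<times> nat list \<times> instr list"

text \<open>Access with a default value, so that variables outside an environment and layers outside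
  a symbol have a specified meaning; \<open>hd\<close> and \<open>drop\<close> already have
  computability rules.\<close>

definition nthd :: "'a \<Rightarrow> 'a list \<Rightarrow> nat \<Rightarrow> 'a" where
  "nthd d xs n = (if n < length xs then hd (drop n xs) else d)"

lemma nthd_nth [simp]: "n < length xs \<Longrightarrow> nthd d xs n = xs ! n"
  by (simp add: nthd_def hd_drop_conv_nth)

lemma nthd_ge: "\<not> n < length xs \<Longrightarrow> nthd d xs n = d"
  by (simp add: nthd_def)

lemma cmp_nthd [cmp]: "cmp d \<Longrightarrow> cmp xs \<Longrightarrow> cmp n \<Longrightarrow> cmp (\<lambda>x. nthd (d x) (xs x) (n x))"
  unfolding nthd_def by (intro cmp)

definition upd :: "'a list \<Rightarrow> nat \<Rightarrow> 'a \<Rightarrow> 'a list" where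
  "upd xs n y = map (\<lambda>i. if i = n then y else nthd y xs i) [0..<length xs]"

lemma cmp_upd [cmp]:
  "cmp xs \<Longrightarrow> cmp n \<Longrightarrow> cmp y \<Longrightarrow> cmp (\<lambda>x. upd (xs x) (n x) (y x))"
  by (rule cmp3[of upd]; (unfold upd_def)?; (intro cmp)?)

lemma upd_list_update: "upd xs n y = xs[n := y]"
  by (rule nth_equalityI) (auto simp: upd_def nth_list_update)

lemma cmp_zip [cmp]:
  assumes "cmp a" "cmp b"
  shows "cmp (\<lambda>x. zip (a x) (b x))"
proof -
  have *: "cmp (\<lambda>p. map (\<lambda>i. (hd (drop i (fst p)), hd (drop i (snd p))))
      [0..<length (fst p) - (length (fst p) - length (snd p))])"
    by (intro cmp)
  have "zip xs ys = map (\<lambda>i. (hd (drop i xs), hd (drop i ys))) [0..<length xs - (length xs - length ys)]"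
    for xs :: "'b list" and ys :: "'c list"
    by (rule nth_equalityI) (auto simp: hd_drop_conv_nth)
  then show ?thesis
    using cmp2[OF *, OF assms] by simp
qed

definition b2n :: "bool \<Rightarrow> nat" where
  "b2n P = (if P then 1 else 0)"

lemma b2n_eq [simp]: "b2n P = b2n Q \<longleftrightarrow> P = Q" "b2n P \<noteq> 0 \<longleftrightarrow> P" "b2n P = 0 \<longleftrightarrow> \<not> P" "0 < b2n P \<longleftrightarrow> P"
  by (auto simp: b2n_def)

lemma cmp_b2n [cmp]: "cmpb P \<Longrightarrow> cmp (\<lambda>x. b2n (P x))"
  unfolding b2n_def by (intro cmp)

definition pad_token :: "nat list \<Rightarrow> nat \<Rightarrow> nat list" where
  "pad_token s j = (if j < length s then [1, nthd 0 s j] else [0])"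

text \<open>If every component is padding, the position lies beyond the longest string, where the
  padded tensor product is itself padding. Otherwise the result is the code of a present tuple. This
  agrees with the tokens inside coded transitions, so the two can be compared as lists.\<close>

definition tuple_token :: "nat list list \<Rightarrow> nat list" where
  "tuple_token ts = (if \<exists>t\<in>set ts. t \<noteq> [0] then 1 # length ts # concat ts else [0])"

lemma cmp_pad_token [cmp]: "cmp s \<Longrightarrow> cmp j \<Longrightarrow> cmp (\<lambda>x. pad_token (s x) (j x))"
  by (rule cmp2[of pad_token]; (unfold pad_token_def)?; (intro cmp)?)

lemma cmp_tuple_token [cmp]: "cmp s \<Longrightarrow> cmp (\<lambda>x. tuple_token (s x))"
  by (rule cmp_comp[of tuple_token]; (unfold tuple_token_def)?; (intro cmp)?)

definition layer_set :: "lrep \<Rightarrow> nat \<Rightarrow> nat list list" where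
  "layer_set B i = nthd [] (fst B) i"

definition layer_at :: "symrep \<Rightarrow> nat \<Rightarrow> lrep" where
  "layer_at x i = (case nthd [] x i of [] \<Rightarrow> ([], []) | B # _ \<Rightarrow> B)"

lemma cmp_layer_set [cmp]: "cmp B \<Longrightarrow> cmp i \<Longrightarrow> cmp (\<lambda>x. layer_set (B x) (i x))"
  unfolding layer_set_def by (intro cmp)

lemma cmp_layer_at [cmp]: "cmp B \<Longrightarrow> cmp i \<Longrightarrow> cmp (\<lambda>x. layer_at (B x) (i x))"
  by (rule cmp2[of layer_at]; (unfold layer_at_def)?; (intro cmp)?)

text \<open>The initial states of the layer are added at every step, because only the first layer of
  a diagram has any; a run can then start from the empty set. Filtering \<open>[0..<w]\<close>
  yields a canonical list, so equality of lists is equality of state sets.\<close>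

definition run_step :: "nat \<Rightarrow> nat list \<Rightarrow> lrep \<Rightarrow> nat list \<Rightarrow> nat list" where
  "run_step w R B tok = filter (\<lambda>q. \<exists>p\<in>set (R @ concat (layer_set B 3)). p # tok @ [q] \<in> set (layer_set B 2)) [0..<w]"

lemma cmp_run_step [cmp]: "cmp w \<Longrightarrow> cmp R \<Longrightarrow> cmp B \<Longrightarrow> cmp t \<Longrightarrow>
  cmp (\<lambda>x. run_step (w x) (R x) (B x) (t x))"
  by (rule cmp4[of run_step]; (unfold run_step_def)?; (intro cmp)?)

definition reachable :: "nat \<Rightarrow> nat \<Rightarrow> symrep list \<Rightarrow> nat list list \<Rightarrow> nat list" where
  "reachable w i u ts = foldl (\<lambda>R p. run_step w R (layer_at (fst p) i) (snd p)) [] (zip u ts)"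

lemma cmp_reachable [cmp]: "cmp w \<Longrightarrow> cmp R \<Longrightarrow> cmp B \<Longrightarrow> cmp t \<Longrightarrow>
  cmp (\<lambda>x. reachable (w x) (R x) (B x) (t x))"
  by (rule cmp4[of reachable]; (unfold reachable_def)?; (intro cmp)?)

definition run_accepts :: "nat \<Rightarrow> symrep list \<Rightarrow> nat list \<Rightarrow> bool" where
  "run_accepts i u R \<longleftrightarrow> u \<noteq> [] \<and> (\<exists>q\<in>set R. [q] \<in> set (layer_set (layer_at (nthd [] u (length u - 1)) i) 4))"

lemma cmpb_run_accepts [cmp]: "cmp i \<Longrightarrow> cmp u \<Longrightarrow> cmp R \<Longrightarrow> cmpb (\<lambda>x. run_accepts (i x) (u x) (R x))"
  by (rule cmpb3[of run_accepts]; (unfold run_accepts_def)?; (intro cmp)?)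

definition pad_tokens :: "nat list \<Rightarrow> nat \<Rightarrow> nat list list" where
  "pad_tokens s k = map (pad_token s) [0..<k]"

definition tuple_tokens :: "nat list list \<Rightarrow> nat \<Rightarrow> nat list list" where
  "tuple_tokens ss k = map (\<lambda>j. tuple_token (map (\<lambda>s. pad_token s j) ss)) [0..<k]"

lemma cmp_pad_tokens [cmp]: "cmp s \<Longrightarrow> cmp j \<Longrightarrow> cmp (\<lambda>x. pad_tokens (s x) (j x))"
  by (rule cmp2[of pad_tokens]; (unfold pad_tokens_def)?; (intro cmp)?)

lemma cmp_tuple_tokens [cmp]: "cmp s \<Longrightarrow> cmp j \<Longrightarrow> cmp (\<lambda>x. tuple_tokens (s x) (j x))"
  by (rule cmp2[of tuple_tokens]; (unfold tuple_tokens_def)?; (intro cmp)?)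

definition dom_accepts :: "nat \<Rightarrow> symrep list \<Rightarrow> nat list \<Rightarrow> bool" where
  "dom_accepts w u s \<longleftrightarrow> s \<noteq> [] \<and> run_accepts 0 u (reachable w 0 u (pad_tokens s (length u)))"

lemma cmpb_dom_accepts [cmp]: "cmp w \<Longrightarrow> cmp u \<Longrightarrow> cmp s \<Longrightarrow> cmpb (\<lambda>x. dom_accepts (w x) (u x) (s x))"
  by (rule cmpb3[of dom_accepts]; (unfold dom_accepts_def)?; (intro cmp)?)

text \<open>Besides the reachable states this records what decides how a string may continue: only a
  string as long as the word can receive a further letter, and the empty string is never
  accepted.\<close>

definition dom_state :: "nat \<Rightarrow> symrep list \<Rightarrow> nat list \<Rightarrow> nat list \<times> nat \<times> nat \<times> nat" where
  "dom_state w u s = (reachable w 0 u (pad_tokens s (length u)), b2n (length s = length u), b2n (s = []), b2n (dom_accepts w u s))"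

lemma cmp_dom_state [cmp]: "cmp w \<Longrightarrow> cmp u \<Longrightarrow> cmp s \<Longrightarrow> cmp (\<lambda>x. dom_state (w x) (u x) (s x))"
  by (rule cmp3[of dom_state]; (unfold dom_state_def)?; (intro cmp)?)

definition strings :: "nat list \<Rightarrow> nat \<Rightarrow> nat list list" where
  "strings \<Sigma> k = concat (map (\<lambda>n. List.n_lists n \<Sigma>) [0..<Suc k])"

lemma cmp_strings [cmp]: "cmp s \<Longrightarrow> cmp j \<Longrightarrow> cmp (\<lambda>x. strings (s x) (j x))"
  by (rule cmp2[of strings]; (unfold strings_def)?; (intro cmp)?)

lemma set_strings: "set (strings \<Sigma> k) = {s. set s \<subseteq> set \<Sigma> \<and> length s \<le> k}"
  by (auto simp: strings_def set_n_lists less_Suc_eq_le simp del: upt_Suc)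

text \<open>A canonical list for a finite set of numbers. No element exceeds the sum, so the scan
  finds them all, in increasing order.\<close>

definition canon :: "nat list \<Rightarrow> nat list" where
  "canon L = filter (\<lambda>c. c \<in> set L) [0..<Suc (sum_list L)]"

lemma cmp_canon [cmp]: "cmp s \<Longrightarrow> cmp (\<lambda>x. canon (s x))"
  by (rule cmp_comp[of canon]; (unfold canon_def)?; (intro cmp)?)

lemma canon_eq: "canon L = sorted_list_of_set (set L)"
proof -
  have "set (canon L) = set L"
    using member_le_sum_list[of _ L] by (auto simp: canon_def less_Suc_eq_le simp del: upt_Suc)
  moreover have "sorted (canon L)" "distinct (canon L)"
    unfolding canon_def by (auto intro: sorted_wrt_filter simp del: upt_Suc)
  ultimately show ?thesis
    by (metis sorted_list_of_set.idem_if_sorted_distinct)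
qed

text \<open>In all values below, the first component carries the information needed to continue when
  the word grows, and the second is the truth value in case the word ends here.\<close>

definition val_rel :: "nat \<Rightarrow> symrep list \<Rightarrow> nat list list \<Rightarrow> nat \<Rightarrow> nat list \<Rightarrow> nat \<times> nat" where
  "val_rel w u E i xs = (let R = reachable w (Suc i) u (tuple_tokens (map (nthd [] E) xs) (length u))
     in (enc R, b2n (run_accepts (Suc i) u R)))"

definition val_eq :: "nat list list \<Rightarrow> nat \<Rightarrow> nat \<Rightarrow> nat \<times> nat" where
  "val_eq E x y = (b2n (nthd [] E x = nthd [] E y), b2n (nthd [] E x = nthd [] E y))"

definition val_bin :: "nat \<Rightarrow> nat \<times> nat \<Rightarrow> nat \<times> nat \<Rightarrow> nat \<times> nat" where
  "val_bin t v v' = (enc (v, v'),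
     b2n (if t = 3 then snd v \<noteq> 0 \<and> snd v' \<noteq> 0 else snd v \<noteq> 0 \<or> snd v' \<noteq> 0))"

definition val_neg :: "nat \<times> nat \<Rightarrow> nat \<times> nat" where
  "val_neg v = (enc v, b2n (snd v = 0))"

text \<open>The argument pairs, for each string, the value of the body with the state of the automaton
  for the domain; tag 5 is the existential quantifier.\<close>

definition val_q :: "nat \<Rightarrow> ((nat \<times> nat) \<times> (nat list \<times> nat \<times> nat \<times> nat)) list \<Rightarrow> nat \<times> nat" where
  "val_q t L = (enc (canon (map enc L)),
     b2n (if t = 5 then \<exists>p\<in>set L. snd (snd (snd (snd p))) \<noteq> 0 \<and> snd (fst p) \<noteq> 0
       else \<forall>p\<in>set L. snd (snd (snd (snd p))) \<noteq> 0 \<longrightarrow> snd (fst p) \<noteq> 0))"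

text \<open>Quantifiers range over all strings no longer than the word, not only over the domain:
  whether a prefix extends to an element of the domain is decided only by later layers. Each string
  is therefore kept together with its \<open>dom_state\<close>.\<close>

fun fo_state :: "nat \<Rightarrow> nat list \<Rightarrow> symrep list \<Rightarrow> fo \<Rightarrow> nat list list \<Rightarrow> nat \<times> nat" where
  "fo_state w \<Sigma> u (Rel i xs) E = val_rel w u E i xs"
| "fo_state w \<Sigma> u (Eq x y) E = val_eq E x y"
| "fo_state w \<Sigma> u (Neg \<phi>) E = val_neg (fo_state w \<Sigma> u \<phi> E)"
| "fo_state w \<Sigma> u (Conj \<phi> \<psi>) E = val_bin 3 (fo_state w \<Sigma> u \<phi> E) (fo_state w \<Sigma> u \<psi> E)"
| "fo_state w \<Sigma> u (Disj \<phi> \<psi>) E = val_bin 4 (fo_state w \<Sigma> u \<phi> E) (fo_state w \<Sigma> u \<psi> E)"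
| "fo_state w \<Sigma> u (Ex x \<phi>) E =
     val_q 5 (map (\<lambda>s. (fo_state w \<Sigma> u \<phi> (upd E x s), dom_state w u s)) (strings \<Sigma> (length u)))"
| "fo_state w \<Sigma> u (All x \<phi>) E =
     val_q 6 (map (\<lambda>s. (fo_state w \<Sigma> u \<phi> (upd E x s), dom_state w u s)) (strings \<Sigma> (length u)))"

lemma cmp_val_rel [cmp]:
  assumes "cmp w" "cmp u" "cmp E" "cmp i" "cmp xs"
  shows "cmp (\<lambda>x. val_rel (w x) (u x) (E x) (i x) (xs x))"
proof -
  let ?f = "\<lambda>w u E p. val_rel w u E (fst p) (snd p)"
  have "cmp (\<lambda>x. ?f (w x) (u x) (E x) (i x, xs x))"
    by (rule cmp4[of ?f]; (unfold val_rel_def Let_def)?; intro cmp assms)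
  then show ?thesis by simp
qed

lemma cmp_val_eq [cmp]: "cmp w \<Longrightarrow> cmp u \<Longrightarrow> cmp s \<Longrightarrow> cmp (\<lambda>x. val_eq (w x) (u x) (s x))"
  unfolding val_eq_def by (intro cmp)

lemma cmp_val_bin [cmp]: "cmp w \<Longrightarrow> cmp u \<Longrightarrow> cmp s \<Longrightarrow> cmp (\<lambda>x. val_bin (w x) (u x) (s x))"
  unfolding val_bin_def if_bool_eq_conj by (intro cmp)

lemma cmp_val_neg [cmp]: "cmp w \<Longrightarrow> cmp (\<lambda>x. val_neg (w x))"
  unfolding val_neg_def by (intro cmp)

lemma cmp_val_q [cmp]: "cmp t \<Longrightarrow> cmp L \<Longrightarrow> cmp (\<lambda>x. val_q (t x) (L x))"
  by (rule cmp2[of val_q]; (unfold val_q_def if_bool_eq_conj)?; (intro cmp)?)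

lemma enc_map_inject: "canon (map enc L) = canon (map enc L') \<longleftrightarrow> set L = set L'"
  unfolding canon_eq
  by (auto dest!: arg_cong[where f = set] simp: inj_image_eq_iff inj_def)

lemma val_q_cong: "set L = set L' \<Longrightarrow> val_q t L = val_q t L'"
  unfolding val_q_def using enc_map_inject[of L L'] by auto

lemma val_q_D: "val_q t L = val_q t L' \<Longrightarrow> set L = set L'"
  unfolding val_q_def using enc_map_inject[of L L'] by auto

section \<open>The state of an extended word\<close>

lemma length_toks [simp]: "length (pad_tokens s k) = k" "length (tuple_tokens ss k) = k"
  by (simp_all add: pad_tokens_def tuple_tokens_def)

lemma reachable_snoc:
  "length ts = length u \<Longrightarrow> reachable w i (u @ [x]) (ts @ [t]) = run_step w (reachable w i u ts) (layer_at x i) t"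
  by (simp add: reachable_def)

lemma pad_token_take: "j < k \<Longrightarrow> pad_token (take k s) j = pad_token s j"
  by (auto simp: pad_token_def)

lemma pad_tokens_Suc: "pad_tokens s (Suc k) = pad_tokens (take k s) k @ [pad_token s k]"
  by (simp add: pad_tokens_def pad_token_take)

lemma tuple_tokens_Suc:
  "tuple_tokens ss (Suc k) = tuple_tokens (map (take k) ss) k @ [tuple_token (map (\<lambda>s. pad_token s k) ss)]"
  by (simp add: tuple_tokens_def pad_token_take cong: map_cong)

lemma run_accepts_snoc: "run_accepts i (u @ [x]) R \<longleftrightarrow> (\<exists>q\<in>set R. [q] \<in> set (layer_set (layer_at x i) 4))"
  by (simp add: run_accepts_def)

lemma pad_token_eq_Nil: "length s \<le> Suc k \<Longrightarrow> length s = Suc k \<longleftrightarrow> pad_token s k \<noteq> [0]"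
  by (auto simp: pad_token_def)

lemma eq_Nil_take_pad_token: "length s \<le> Suc k \<Longrightarrow> s = [] \<longleftrightarrow> take k s = [] \<and> pad_token s k = [0]"
  by (cases s; cases k) (auto simp: pad_token_def)

lemma eq_take_pad_token:
  assumes "length s \<le> Suc k" "length s' \<le> Suc k"
  shows "s = s' \<longleftrightarrow> take k s = take k s' \<and> pad_token s k = pad_token s' k"
proof
  assume *: "take k s = take k s' \<and> pad_token s k = pad_token s' k"
  show "s = s'"
  proof (cases "length s = Suc k")
    case True
    then have "length s' = Suc k" using * pad_token_eq_Nil assms by metis
    then have "s = take k s @ [s ! k]" "s' = take k s' @ [s' ! k]"
      using True take_Suc_conv_app_nth[of k s] take_Suc_conv_app_nth[of k s'] by auto
    moreover have "s ! k = s' ! k"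
      using * True \<open>length s' = Suc k\<close> by (simp add: pad_token_def)
    ultimately show ?thesis using * by metis
  next
    case False
    then have "length s' \<noteq> Suc k" using * pad_token_eq_Nil assms by metis
    then show ?thesis using * False assms by (metis le_SucE take_all)
  qed
qed auto

lemma dom_state_cong:
  assumes "dom_state w u1 (take (length u1) s1) = dom_state w u2 (take (length u2) s2)"
    and "pad_token s1 (length u1) = pad_token s2 (length u2)"
    and "length s1 \<le> Suc (length u1)" "length s2 \<le> Suc (length u2)"
  shows "dom_state w (u1 @ [x]) s1 = dom_state w (u2 @ [x]) s2"
proof -
  have 1: "reachable w 0 (u1 @ [x]) (pad_tokens s1 (Suc (length u1))) = reachable w 0 (u2 @ [x]) (pad_tokens s2 (Suc (length u2)))"
    using assms(1,2) by (simp add: pad_tokens_Suc reachable_snoc dom_state_def)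
  have "take (length u1) s1 = [] \<longleftrightarrow> take (length u2) s2 = []"
    using assms(1) unfolding dom_state_def prod.inject b2n_eq by blast
  then have 2: "s1 = [] \<longleftrightarrow> s2 = []"
    using assms(2) eq_Nil_take_pad_token[OF assms(3)] eq_Nil_take_pad_token[OF assms(4)] by metis
  have 3: "length s1 = Suc (length u1) \<longleftrightarrow> length s2 = Suc (length u2)"
    using assms(2) pad_token_eq_Nil[OF assms(3)] pad_token_eq_Nil[OF assms(4)] by metis
  show ?thesis
    using 1 2 3 by (simp add: dom_state_def dom_accepts_def run_accepts_snoc)
qed

lemma map_take_upd: "map (take k) (upd E x s) = upd (map (take k) E) x (take k s)"
  by (simp add: upd_list_update map_update)

lemma nthd_map_take: "nthd [] (map (take k) E) x = take k (nthd [] E x)"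
  by (cases "x < length E") (auto simp: nthd_ge)

text \<open>The strings of the two environments may be unrelated up to now, but in the new column
  every variable shows the same padded letter. The lengths allow for this one additional
  column.\<close>

definition env_step where
  "env_step u1 E1 u2 E2 \<longleftrightarrow> length E1 = length E2 \<and>
     (\<forall>s\<in>set E1. length s \<le> Suc (length u1)) \<and> (\<forall>s\<in>set E2. length s \<le> Suc (length u2)) \<and>
     (\<forall>x. pad_token (nthd [] E1 x) (length u1) = pad_token (nthd [] E2 x) (length u2))"

lemma env_step_upd:
  assumes "env_step u1 E1 u2 E2" "length s1 \<le> Suc (length u1)" "length s2 \<le> Suc (length u2)"
    "pad_token s1 (length u1) = pad_token s2 (length u2)"
  shows "env_step u1 (upd E1 x s1) u2 (upd E2 x s2)"
proof -
  have "nthd [] (upd E x s) y = (if y = x \<and> x < length E then s else nthd [] E y)"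
    for E y and s :: "nat list"
    by (auto simp: upd_list_update nthd_ge nthd_def hd_drop_conv_nth)
  then show ?thesis
    using assms unfolding env_step_def
    by (auto simp: upd_list_update dest!: subsetD[OF set_update_subset_insert])
qed

lemma pad_token_Nil [simp]: "pad_token [] k = [0]"
  by (simp add: pad_token_def)

text \<open>If \<open>s1\<close> has a letter in the new column, its old part fills the first word;
  equal domain states then say that \<open>t\<close> fills the second word, so the same letter can
  be appended to \<open>t\<close>. Otherwise \<open>t\<close> itself is the answer.\<close>

lemma extend_string:
  assumes "dom_state w u1 (take (length u1) s1) = dom_state w u2 t" "s1 \<in> set (strings \<Sigma> (Suc (length u1)))"
    "t \<in> set (strings \<Sigma> (length u2))"
  obtains s2 where "s2 \<in> set (strings \<Sigma> (Suc (length u2)))" "take (length u2) s2 = t"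
    "pad_token s1 (length u1) = pad_token s2 (length u2)"
proof (cases "length s1 = Suc (length u1)")
  case True
  then have "length t = length u2"
    using assms(1) by (simp add: dom_state_def)
  moreover have "s1 ! length u1 \<in> set \<Sigma>"
    using assms(2) nth_mem[of "length u1" s1] True by (auto simp: set_strings)
  ultimately show ?thesis
    using that[of "t @ [s1 ! length u1]"] assms(2,3) True
    by (auto simp: set_strings pad_token_def nth_append)
next
  case False
  then show ?thesis
    using that[of t] assms(2,3) by (auto simp: set_strings pad_token_def)
qed

text \<open>One direction of a back-and-forth argument: a string for the quantified variable is cut
  back, matched on the other side by equality of the old states, and extended there by the same
  letter. The assumption \<open>IH\<close> is the claim for the body of the quantifier.\<close>

lemma fo_state_quantifier_subset:
  assumes IH: "\<And>E1 E2. fo_state w \<Sigma> u1 \<phi> (map (take (length u1)) E1) = fo_state w \<Sigma> u2 \<phi> (map (take (length u2)) E2) \<Longrightarrow>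
      env_step u1 E1 u2 E2 \<Longrightarrow> fo_state w \<Sigma> (u1 @ [x]) \<phi> E1 = fo_state w \<Sigma> (u2 @ [x]) \<phi> E2"
    and sub: "(\<lambda>s. (fo_state w \<Sigma> u1 \<phi> (upd (map (take (length u1)) E1) v s), dom_state w u1 s)) ` set (strings \<Sigma> (length u1)) \<subseteq>
      (\<lambda>s. (fo_state w \<Sigma> u2 \<phi> (upd (map (take (length u2)) E2) v s), dom_state w u2 s)) ` set (strings \<Sigma> (length u2))"
    and env: "env_step u1 E1 u2 E2"
  shows "(\<lambda>s. (fo_state w \<Sigma> (u1 @ [x]) \<phi> (upd E1 v s), dom_state w (u1 @ [x]) s)) ` set (strings \<Sigma> (Suc (length u1))) \<subseteq>
      (\<lambda>s. (fo_state w \<Sigma> (u2 @ [x]) \<phi> (upd E2 v s), dom_state w (u2 @ [x]) s)) ` set (strings \<Sigma> (Suc (length u2)))"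
proof
  fix p assume "p \<in> (\<lambda>s. (fo_state w \<Sigma> (u1 @ [x]) \<phi> (upd E1 v s), dom_state w (u1 @ [x]) s)) ` set (strings \<Sigma> (Suc (length u1)))"
  then obtain s1 where s1: "s1 \<in> set (strings \<Sigma> (Suc (length u1)))"
    and p: "p = (fo_state w \<Sigma> (u1 @ [x]) \<phi> (upd E1 v s1), dom_state w (u1 @ [x]) s1)" by auto
  have "take (length u1) s1 \<in> set (strings \<Sigma> (length u1))"
    using s1 by (auto simp: set_strings dest: in_set_takeD)
  then obtain t where t: "t \<in> set (strings \<Sigma> (length u2))"
    "fo_state w \<Sigma> u1 \<phi> (upd (map (take (length u1)) E1) v (take (length u1) s1)) =
      fo_state w \<Sigma> u2 \<phi> (upd (map (take (length u2)) E2) v t)"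
    "dom_state w u1 (take (length u1) s1) = dom_state w u2 t"
    using sub by (smt (verit, best) image_subset_iff image_iff prod.inject)
  obtain s2 where s2: "s2 \<in> set (strings \<Sigma> (Suc (length u2)))" "take (length u2) s2 = t"
    "pad_token s1 (length u1) = pad_token s2 (length u2)"
    using extend_string[OF t(3) s1 t(1)] by blast
  have len: "length s1 \<le> Suc (length u1)" "length s2 \<le> Suc (length u2)"
    using s1 s2(1) by (auto simp: set_strings)
  have "fo_state w \<Sigma> (u1 @ [x]) \<phi> (upd E1 v s1) = fo_state w \<Sigma> (u2 @ [x]) \<phi> (upd E2 v s2)"
    by (rule IH) (use t(2) s2 len env in \<open>auto simp: map_take_upd intro: env_step_upd\<close>)
  moreover have "dom_state w (u1 @ [x]) s1 = dom_state w (u2 @ [x]) s2"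
    by (rule dom_state_cong) (use t(3) s2 len in auto)
  ultimately show "p \<in> (\<lambda>s. (fo_state w \<Sigma> (u2 @ [x]) \<phi> (upd E2 v s), dom_state w (u2 @ [x]) s)) ` set (strings \<Sigma> (Suc (length u2)))"
    using p s2(1) by auto
qed

lemma env_step_sym: "env_step u1 E1 u2 E2 \<Longrightarrow> env_step u2 E2 u1 E1"
  unfolding env_step_def by auto

lemma env_step_length:
  assumes "env_step u1 E1 u2 E2"
  shows "length (nthd [] E1 x) \<le> Suc (length u1)" "length (nthd [] E2 x) \<le> Suc (length u2)"
  using assms unfolding env_step_def
  by (cases "x < length E1"; auto simp: nthd_ge)+

text \<open>The new state is determined by the old state, with all strings cut back to the old
  length, and by the new column. Words and environments are arbitrary in the induction because
  quantifiers update the environments on both sides by different strings.\<close>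

theorem fo_state_cong:
  assumes "fo_state w \<Sigma> u1 \<phi> (map (take (length u1)) E1) = fo_state w \<Sigma> u2 \<phi> (map (take (length u2)) E2)"
    and "env_step u1 E1 u2 E2"
  shows "fo_state w \<Sigma> (u1 @ [x]) \<phi> E1 = fo_state w \<Sigma> (u2 @ [x]) \<phi> E2"
  using assms
proof (induction \<phi> arbitrary: u1 E1 u2 E2)
  case (Rel i xs)
  let ?T = "\<lambda>u E. tuple_tokens (map (\<lambda>x. take (length u) (nthd [] E x)) xs) (length u)"
  have e: "nthd [] (map (take k) E) = (\<lambda>x. take k (nthd [] E x))" for k and E :: "nat list list"
    by (rule ext) (rule nthd_map_take)
  have 1: "reachable w (Suc i) u1 (?T u1 E1) = reachable w (Suc i) u2 (?T u2 E2)"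
    using Rel(1) by (simp add: val_rel_def Let_def e)
  have 2: "tuple_token (map (\<lambda>v. pad_token (nthd [] E1 v) (length u1)) xs) =
      tuple_token (map (\<lambda>v. pad_token (nthd [] E2 v) (length u2)) xs)"
    using Rel(2) by (simp add: env_step_def)
  show ?case
    using 1 2
    by (simp add: val_rel_def Let_def tuple_tokens_Suc reachable_snoc run_accepts_snoc comp_def nthd_map_take)
next
  case (Eq a b)
  have "nthd [] E1 a = nthd [] E1 b \<longleftrightarrow> nthd [] E2 a = nthd [] E2 b"
    using Eq(1) Eq(2)[unfolded env_step_def] env_step_length[OF Eq(2), of a]
      env_step_length[OF Eq(2), of b]
      eq_take_pad_token[of "nthd [] E1 a" "length u1" "nthd [] E1 b"]
      eq_take_pad_token[of "nthd [] E2 a" "length u2" "nthd [] E2 b"]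
    by (simp add: val_eq_def nthd_map_take)
  then show ?case by (simp add: val_eq_def)
next
  case (Neg \<phi>)
  then have "fo_state w \<Sigma> (u1 @ [x]) \<phi> E1 = fo_state w \<Sigma> (u2 @ [x]) \<phi> E2"
    by (intro Neg.IH) (auto simp: val_neg_def simp del: enc_Pair)
  then show ?case by simp
next
  case (Conj \<phi> \<psi>)
  then have "fo_state w \<Sigma> (u1 @ [x]) \<phi> E1 = fo_state w \<Sigma> (u2 @ [x]) \<phi> E2"
    "fo_state w \<Sigma> (u1 @ [x]) \<psi> E1 = fo_state w \<Sigma> (u2 @ [x]) \<psi> E2"
    by (auto simp: val_bin_def simp del: enc_Pair)
  then show ?case by simp
next
  case (Disj \<phi> \<psi>)
  then have "fo_state w \<Sigma> (u1 @ [x]) \<phi> E1 = fo_state w \<Sigma> (u2 @ [x]) \<phi> E2"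
    "fo_state w \<Sigma> (u1 @ [x]) \<psi> E1 = fo_state w \<Sigma> (u2 @ [x]) \<psi> E2"
    by (auto simp: val_bin_def simp del: enc_Pair)
  then show ?case by simp
next
  case (Ex v \<phi>)
  note D = val_q_D[OF Ex.prems(1)[unfolded fo_state.simps], unfolded set_map]
  show ?case
    unfolding fo_state.simps
    by (rule val_q_cong, unfold set_map length_append list.size add_0_right add_Suc_right,
        rule equalityI; rule fo_state_quantifier_subset)
      (use D Ex.IH Ex.prems(2) env_step_sym in auto)
next
  case (All v \<phi>)
  note D = val_q_D[OF All.prems(1)[unfolded fo_state.simps], unfolded set_map]
  show ?case
    unfolding fo_state.simps
    by (rule val_q_cong, unfold set_map length_append list.size add_0_right add_Suc_right,
        rule equalityI; rule fo_state_quantifier_subset)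
      (use D All.IH All.prems(2) env_step_sym in auto)
qed

section \<open>Finiteness of the set of states\<close>

lemma finite_range_reachable: "finite (range (\<lambda>(u, ts). reachable w i u ts))"
proof (rule finite_subset)
  have "set (reachable w i u ts) \<subseteq> {..<w} \<and> length (reachable w i u ts) \<le> w" for u ts
  proof (cases "zip u ts" rule: rev_cases)
    case Nil
    then show ?thesis by (cases u; cases ts) (auto simp: reachable_def)
  next
    case (snoc ys y)
    then show ?thesis
      using length_filter_le[of _ "[0..<w]"] by (auto simp: reachable_def run_step_def)
  qed
  then show "range (\<lambda>(u, ts). reachable w i u ts) \<subseteq> {xs. set xs \<subseteq> {..<w} \<and> length xs \<le> w}"
    by auto
qed (rule finite_lists_length_le, simp)

lemma finite_range_b2n: "finite (range b2n)"
  by simp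

lemma finite_range_dom_state: "finite (range (\<lambda>(u, s). dom_state w u s))"
  by (rule finite_subset[of _ "range (\<lambda>(u, ts). reachable w 0 u ts) \<times> range b2n \<times> range b2n \<times> range b2n"])
    (auto simp: dom_state_def finite_range_reachable intro: range_eqI[of _ _ "(_, _)"])

text \<open>There are infinitely many lists over a finite set, but the value depends only on the set
  of entries; one list is chosen for each subset.\<close>

lemma finite_range_val_q:
  assumes "finite X"
  shows "finite (val_q t ` {L. set L \<subseteq> X})"
proof -
  have "val_q t ` {L. set L \<subseteq> X} \<subseteq> (\<lambda>Y. val_q t (SOME L. set L = Y)) ` Pow X"
  proof
    fix v assume "v \<in> val_q t ` {L. set L \<subseteq> X}"
    then obtain L where L: "v = val_q t L" "set L \<subseteq> X" by auto
    then have "v = val_q t (SOME L'. set L' = set L)"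
      using val_q_cong[of L "SOME L'. set L' = set L" t] someI[of "\<lambda>L'. set L' = set L" L] by simp
    then show "v \<in> (\<lambda>Y. val_q t (SOME L. set L = Y)) ` Pow X" using L by blast
  qed
  then show ?thesis using assms by (meson finite_Pow_iff finite_imageI finite_subset)
qed

lemma finite_range_lift2:
  assumes "finite (range (\<lambda>(u, E). f u E))" "finite (range (\<lambda>(u, E). g u E))"
  shows "finite (range (\<lambda>(u, E). h (f u E) (g u E)))"
proof (rule finite_subset)
  show "range (\<lambda>(u, E). h (f u E) (g u E)) \<subseteq>
    (\<lambda>p. h (fst p) (snd p)) ` (range (\<lambda>(u, E). f u E) \<times> range (\<lambda>(u, E). g u E))"
  proof
    fix v assume "v \<in> range (\<lambda>(u, E). h (f u E) (g u E))"
    then obtain u E where "v = h (f u E) (g u E)" by auto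
    moreover have "f u E \<in> range (\<lambda>(u, E). f u E)" "g u E \<in> range (\<lambda>(u, E). g u E)"
      by (auto intro: range_eqI[of _ _ "(u, E)"])
    ultimately show "v \<in> (\<lambda>p. h (fst p) (snd p)) ` (range (\<lambda>(u, E). f u E) \<times> range (\<lambda>(u, E). g u E))"
      by (intro image_eqI[of _ _ "(f u E, g u E)"]) auto
  qed
qed (use assms in auto)

lemma finite_range_quantifier:
  assumes "finite (range (\<lambda>(u, E). fo_state w \<Sigma> u \<phi> E))"
  shows "finite (range (\<lambda>(u, E).
    val_q t (map (\<lambda>s. (fo_state w \<Sigma> u \<phi> (upd E x s), dom_state w u s)) (strings \<Sigma> (length u)))))"
proof -
  let ?X = "range (\<lambda>(u, E). fo_state w \<Sigma> u \<phi> E) \<times> range (\<lambda>(u, s). dom_state w u s)"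
  have "finite (val_q t ` {L. set L \<subseteq> ?X})"
    by (intro finite_range_val_q finite_cartesian_product assms finite_range_dom_state)
  then show ?thesis
  proof (rule rev_finite_subset, intro subsetI)
    fix v assume "v \<in> range (\<lambda>(u, E).
      val_q t (map (\<lambda>s. (fo_state w \<Sigma> u \<phi> (upd E x s), dom_state w u s)) (strings \<Sigma> (length u))))"
    then obtain u E where v: "v = val_q t (map (\<lambda>s. (fo_state w \<Sigma> u \<phi> (upd E x s), dom_state w u s)) (strings \<Sigma> (length u)))"
      by auto
    have "(fo_state w \<Sigma> u \<phi> (upd E x s), dom_state w u s) \<in> ?X" for s
      by (intro SigmaI range_eqI[of _ _ "(u, upd E x s)"] range_eqI[of _ _ "(u, s)"]) auto
    then show "v \<in> val_q t ` {L. set L \<subseteq> ?X}"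
      unfolding v by (intro imageI CollectI) (simp only: set_map image_subset_iff ball_simps, blast)
  qed
qed

text \<open>The range is taken over all words and all environments at once, since the quantifier
  case applies the induction hypothesis to environments with arbitrary new strings.\<close>

theorem finite_range_fo_state: "finite (range (\<lambda>(u, E). fo_state w \<Sigma> u \<phi> E))"
proof (induction \<phi>)
  case (Rel i xs)
  show ?case
    by (rule finite_subset[of _ "enc ` range (\<lambda>(u, ts). reachable w (Suc i) u ts) \<times> range b2n"])
      (auto simp: val_rel_def Let_def finite_range_reachable intro: range_eqI[of _ _ "(_, _)"])
next
  case (Eq x y)
  show ?case
    by (rule finite_subset[of _ "range b2n \<times> range b2n"]) (auto simp: val_eq_def)
next
  case (Neg \<phi>)
  have "range (\<lambda>(u, E). fo_state w \<Sigma> u (Neg \<phi>) E) = val_neg ` range (\<lambda>(u, E). fo_state w \<Sigma> u \<phi> E)"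
    by (auto simp: image_image split_def)
  then show ?case using Neg by simp
next
  case (Conj \<phi> \<psi>)
  then show ?case
    using finite_range_lift2[of "\<lambda>u E. fo_state w \<Sigma> u \<phi> E" "\<lambda>u E. fo_state w \<Sigma> u \<psi> E" "val_bin 3"] by simp
next
  case (Disj \<phi> \<psi>)
  then show ?case
    using finite_range_lift2[of "\<lambda>u E. fo_state w \<Sigma> u \<phi> E" "\<lambda>u E. fo_state w \<Sigma> u \<psi> E" "val_bin 4"] by simp
next
  case (Ex x \<phi>)
  then show ?case
    using finite_range_quantifier by simp
next
  case (All x \<phi>)
  then show ?case
    using finite_range_quantifier by simp
qed

section \<open>Formulas in postfix notation\<close>

text \<open>The computability rules cover folds over lists but not recursion over formulas. In
  postfix notation a formula is a list of instructions, and evaluation is a fold over it with a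
  stack. The operations are parameters, so that formulas, their tokens and their tables of states
  arise from the same fold and are related by \<open>foldl_pstep_hom\<close>.\<close>

definition pstep ::
    "(nat \<Rightarrow> nat \<Rightarrow> nat list \<Rightarrow> 'v) \<Rightarrow> (nat \<Rightarrow> nat \<Rightarrow> 'v \<Rightarrow> 'v) \<Rightarrow> (nat \<Rightarrow> 'v \<Rightarrow> 'v \<Rightarrow> 'v) \<Rightarrow>
     'v list \<Rightarrow> instr \<Rightarrow> 'v list" where
  "pstep lf un bn stk ins =
     (if fst ins < 2 then lf (fst ins) (fst (snd ins)) (snd (snd ins)) # stk
      else if fst ins = 3 \<or> fst ins = 4 then
        (case stk of [] \<Rightarrow> [] | v # vs \<Rightarrow> (case vs of [] \<Rightarrow> [] | v' # vs' \<Rightarrow> bn (fst ins) v' v # vs'))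
      else (case stk of [] \<Rightarrow> [] | v # vs \<Rightarrow> un (fst ins) (fst (snd ins)) v # vs))"

lemma foldl_pstep_hom:
  assumes "\<And>t a xs. h (lf t a xs) = lf' t a xs" "\<And>t a v. h (un t a v) = un' t a (h v)"
    "\<And>t v v'. h (bn t v v') = bn' t (h v) (h v')"
  shows "map h (foldl (pstep lf un bn) stk p) = foldl (pstep lf' un' bn') (map h stk) p"
proof (induction p arbitrary: stk)
  case (Cons i p)
  have "map h (pstep lf un bn stk i) = pstep lf' un' bn' (map h stk) i"
    using assms by (auto simp: pstep_def split: list.splits)
  then show ?case using Cons by simp
qed simp

definition fo_leaf :: "nat \<Rightarrow> nat \<Rightarrow> nat list \<Rightarrow> fo" where
  "fo_leaf t a xs = (if t = 0 then Rel a xs else Eq a (nthd 0 xs 0))"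

definition fo_un :: "nat \<Rightarrow> nat \<Rightarrow> fo \<Rightarrow> fo" where
  "fo_un t a \<phi> = (if t = 2 then Neg \<phi> else if t = 5 then Ex a \<phi> else All a \<phi>)"

definition fo_bin :: "nat \<Rightarrow> fo \<Rightarrow> fo \<Rightarrow> fo" where
  "fo_bin t \<phi> \<psi> = (if t = 3 then Conj \<phi> \<psi> else Disj \<phi> \<psi>)"

definition formula_run :: "instr list \<Rightarrow> fo list" where
  "formula_run p = foldl (pstep fo_leaf fo_un fo_bin) [] p"

fun postfix :: "fo \<Rightarrow> instr list" where
  "postfix (Rel i xs) = [(0, i, xs)]"
| "postfix (Eq x y) = [(1, x, [y])]"
| "postfix (Neg \<phi>) = postfix \<phi> @ [(2, 0, [])]"
| "postfix (Conj \<phi> \<psi>) = postfix \<phi> @ postfix \<psi> @ [(3, 0, [])]"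
| "postfix (Disj \<phi> \<psi>) = postfix \<phi> @ postfix \<psi> @ [(4, 0, [])]"
| "postfix (Ex x \<phi>) = postfix \<phi> @ [(5, x, [])]"
| "postfix (All x \<phi>) = postfix \<phi> @ [(6, x, [])]"

lemma formula_run_postfix: "formula_run (postfix \<phi>) = [\<phi>]"
proof -
  have "foldl (pstep fo_leaf fo_un fo_bin) stk (postfix \<phi>) = \<phi> # stk" for stk
    by (induction \<phi> arbitrary: stk) (auto simp: pstep_def fo_leaf_def fo_un_def fo_bin_def nthd_def)
  then show ?thesis by (simp add: formula_run_def)
qed

definition token_run :: "instr list \<Rightarrow> nat list list" where
  "token_run p = foldl (pstep
     (\<lambda>t a xs. if t = 0 then 0 # a # length xs # xs else [1, a, nthd 0 xs 0])
     (\<lambda>t a v. if t = 2 then 2 # v else if t = 5 then 5 # a # v else 6 # a # v)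
     (\<lambda>t v v'. if t = 3 then 3 # v @ v' else 4 # v @ v')) [] p"

lemma concat_map_single: "concat (map enc_nat xs) = xs"
  by (induction xs) (auto simp: enc_nat_def)

lemma token_run_formula_run: "token_run p = map enc_fo (formula_run p)"
  unfolding token_run_def formula_run_def
  by (subst foldl_pstep_hom)
    (auto simp: fo_leaf_def fo_un_def fo_bin_def enc_list_def concat_map_single)

lemma cmp_token_run [cmp]: "cmp p \<Longrightarrow> cmp (\<lambda>x. token_run (p x))"
  by (rule cmp_comp[of token_run]; (unfold token_run_def pstep_def)?; (intro cmp)?)

text \<open>A crude strict bound on all variable indices: the sum exceeds no bound that a single
  index could violate, and it has a computability rule.\<close>

definition num_vars :: "instr list \<Rightarrow> nat" where
  "num_vars p = Suc (sum_list (map (\<lambda>i. fst (snd i) + sum_list (snd (snd i))) p))"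

lemma cmp_num_vars [cmp]: "cmp p \<Longrightarrow> cmp (\<lambda>x. num_vars (p x))"
  by (rule cmp_comp[of num_vars]; (unfold num_vars_def)?; (intro cmp)?)

fun fo_vars :: "fo \<Rightarrow> nat set" where
  "fo_vars (Rel i xs) = set xs"
| "fo_vars (Eq x y) = {x, y}"
| "fo_vars (Neg \<phi>) = fo_vars \<phi>"
| "fo_vars (Conj \<phi> \<psi>) = fo_vars \<phi> \<union> fo_vars \<psi>"
| "fo_vars (Disj \<phi> \<psi>) = fo_vars \<phi> \<union> fo_vars \<psi>"
| "fo_vars (Ex x \<phi>) = insert x (fo_vars \<phi>)"
| "fo_vars (All x \<phi>) = insert x (fo_vars \<phi>)"

lemma pstep_fo_vars:
  assumes "\<forall>\<phi>\<in>set stk. \<forall>x\<in>fo_vars \<phi>. x < N" "fst (snd i) < N" "nthd 0 (snd (snd i)) 0 < N"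
    "\<And>y. y \<in> set (snd (snd i)) \<Longrightarrow> y < N"
  shows "\<forall>\<phi>\<in>set (pstep fo_leaf fo_un fo_bin stk i). \<forall>x\<in>fo_vars \<phi>. x < N"
proof (cases stk)
  case Nil
  then show ?thesis using assms by (auto simp: pstep_def fo_leaf_def)
next
  case (Cons \<phi> stk')
  then show ?thesis
    using assms
    by (cases stk') (auto simp: pstep_def fo_leaf_def fo_un_def fo_bin_def)
qed

lemma fo_vars_less_num_vars:
  assumes "\<phi> \<in> set (formula_run p)" "x \<in> fo_vars \<phi>"
  shows "x < num_vars p"
proof -
  have "\<forall>\<phi>\<in>set (formula_run p). \<forall>x\<in>fo_vars \<phi>. x < num_vars p"
  proof (induction p rule: rev_induct)
    case (snoc i p)
    have le: "num_vars p \<le> num_vars (p @ [i])" "fst (snd i) < num_vars (p @ [i])"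
      "\<And>y. y \<in> set (snd (snd i)) \<Longrightarrow> y < num_vars (p @ [i])" "0 < num_vars (p @ [i])"
      using member_le_sum_list[of _ "snd (snd i)"] by (fastforce simp: num_vars_def)+
    have "nthd 0 (snd (snd i)) 0 < num_vars (p @ [i])"
      using le(3)[of "nthd 0 (snd (snd i)) 0"] le(4) by (cases "snd (snd i)") (auto simp: nthd_def)
    moreover have "\<forall>\<phi>\<in>set (formula_run p). \<forall>x\<in>fo_vars \<phi>. x < num_vars (p @ [i])"
      using snoc le(1) by fastforce
    ultimately show ?case
      using le(2,3) pstep_fo_vars[of "formula_run p" "num_vars (p @ [i])" i] by (simp add: formula_run_def)
  qed (simp add: formula_run_def)
  then show ?thesis using assms by blast
qed

section \<open>Evaluation of formulas by tables over all environments\<close>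

type_synonym ctx = "nat \<times> nat list \<times> nat \<times> symrep list"
type_synonym tab = "(nat list list \<times> nat \<times> nat) list"

definition envs :: "ctx \<Rightarrow> nat list list list" where
  "envs c = List.n_lists (fst (snd (snd c))) (strings (fst (snd c)) (length (snd (snd (snd c)))))"

definition lookup :: "tab \<Rightarrow> nat list list \<Rightarrow> nat \<times> nat" where
  "lookup tab E = snd (hd (filter (\<lambda>p. fst p = E) tab))"

lemma lookup_map: "E \<in> set Es \<Longrightarrow> lookup (map (\<lambda>E. (E, f E)) Es) E = f E"
  unfolding lookup_def by (induction Es) auto

lemma cmp_lookup [cmp]: "cmp t \<Longrightarrow> cmp E \<Longrightarrow> cmp (\<lambda>x. lookup (t x) (E x))"
  by (rule cmp2[of lookup]; (unfold lookup_def)?; (intro cmp)?)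

lemma cmp_envs [cmp]: "cmp c \<Longrightarrow> cmp (\<lambda>x. envs (c x))"
  unfolding envs_def by (intro cmp)

text \<open>The fold cannot re-evaluate a subformula in a changed environment, as a quantifier
  demands. The value of a subformula is therefore its complete table; the environments in
  \<open>envs\<close> are closed under updates, so every lookup succeeds.\<close>

definition tab_leaf :: "ctx \<Rightarrow> nat \<Rightarrow> nat \<Rightarrow> nat list \<Rightarrow> tab" where
  "tab_leaf c t a xs = map (\<lambda>E. (E, if t = 0 then val_rel (fst c) (snd (snd (snd c))) E a xs
     else val_eq E a (nthd 0 xs 0))) (envs c)"

definition tab_un :: "ctx \<Rightarrow> nat \<Rightarrow> nat \<Rightarrow> tab \<Rightarrow> tab" where
  "tab_un c t a v = map (\<lambda>E. (E, if t = 2 then val_neg (lookup v E)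
     else val_q (if t = 5 then 5 else 6) (map (\<lambda>s. (lookup v (upd E a s), dom_state (fst c) (snd (snd (snd c))) s))
       (strings (fst (snd c)) (length (snd (snd (snd c)))))))) (envs c)"

definition tab_bin :: "ctx \<Rightarrow> nat \<Rightarrow> tab \<Rightarrow> tab \<Rightarrow> tab" where
  "tab_bin c t v v' = map (\<lambda>E. (E, val_bin (if t = 3 then 3 else 4) (lookup v E) (lookup v' E))) (envs c)"

definition table_run :: "ctx \<Rightarrow> instr list \<Rightarrow> tab list" where
  "table_run c p = foldl (pstep (tab_leaf c) (tab_un c) (tab_bin c)) [] p"

lemma cmp_tab_leaf [cmp]: "cmp c \<Longrightarrow> cmp t \<Longrightarrow> cmp a \<Longrightarrow> cmp xs \<Longrightarrow>
  cmp (\<lambda>x. tab_leaf (c x) (t x) (a x) (xs x))"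
  by (rule cmp4[of tab_leaf]; (unfold tab_leaf_def)?; (intro cmp)?)

lemma cmp_tab_un [cmp]: "cmp c \<Longrightarrow> cmp t \<Longrightarrow> cmp a \<Longrightarrow> cmp xs \<Longrightarrow>
  cmp (\<lambda>x. tab_un (c x) (t x) (a x) (xs x))"
  by (rule cmp4[of tab_un]; (unfold tab_un_def)?; (intro cmp)?)

lemma cmp_tab_bin [cmp]: "cmp c \<Longrightarrow> cmp t \<Longrightarrow> cmp a \<Longrightarrow> cmp xs \<Longrightarrow>
  cmp (\<lambda>x. tab_bin (c x) (t x) (a x) (xs x))"
  by (rule cmp4[of tab_bin]; (unfold tab_bin_def)?; (intro cmp)?)

lemma cmp_table_run [cmp]: "cmp c \<Longrightarrow> cmp p \<Longrightarrow> cmp (\<lambda>x. table_run (c x) (p x))"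
  by (rule cmp2[of table_run]; (unfold table_run_def pstep_def)?; (intro cmp)?)

lemma upd_in_envs: "E \<in> set (envs c) \<Longrightarrow> s \<in> set (strings (fst (snd c)) (length (snd (snd (snd c))))) \<Longrightarrow>
  upd E a s \<in> set (envs c)"
  by (auto simp: envs_def set_n_lists upd_list_update dest!: subsetD[OF set_update_subset_insert])

text \<open>This holds for every instruction list, ill-formed ones included. Functions on codes have
  to be total, so the finiteness of types must be available for arbitrary data, not only for codes
  of formulas.\<close>

lemma table_run_formula_run:
  "table_run (w, \<Sigma>, n, u) p = map (\<lambda>\<phi>. map (\<lambda>E. (E, fo_state w \<Sigma> u \<phi> E)) (envs (w, \<Sigma>, n, u))) (formula_run p)"
proof -
  let ?c = "(w, \<Sigma>, n, u)"
  let ?h = "\<lambda>\<phi>. map (\<lambda>E. (E, fo_state w \<Sigma> u \<phi> E)) (envs ?c)"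
  have "map ?h (foldl (pstep fo_leaf fo_un fo_bin) [] p) =
    foldl (pstep (tab_leaf ?c) (tab_un ?c) (tab_bin ?c)) (map ?h []) p"
  proof (rule foldl_pstep_hom)
    show "?h (fo_leaf t a xs) = tab_leaf ?c t a xs" for t a xs
      by (auto simp: fo_leaf_def tab_leaf_def)
    show "?h (fo_un t a \<phi>) = tab_un ?c t a (?h \<phi>)" for t a \<phi>
      unfolding tab_un_def fo_un_def
      by (intro map_cong refl) (auto simp: lookup_map upd_in_envs cong: map_cong)
    show "?h (fo_bin t \<phi> \<psi>) = tab_bin ?c t (?h \<phi>) (?h \<psi>)" for t \<phi> \<psi>
      unfolding tab_bin_def fo_bin_def
      by (intro map_cong refl) (auto simp: lookup_map)
  qed
  then show ?thesis by (simp add: table_run_def formula_run_def)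
qed

definition empty_env :: "nat \<Rightarrow> nat list list" where
  "empty_env n = map (\<lambda>_. []) [0..<n]"

lemma empty_env_in: "empty_env n \<in> set (envs (w, \<Sigma>, n, u))"
  by (auto simp: empty_env_def envs_def set_n_lists set_strings)

lemma cmp_empty_env [cmp]: "cmp c \<Longrightarrow> cmp (\<lambda>x. empty_env (c x))"
  unfolding empty_env_def by (intro cmp)

definition good :: "symrep \<Rightarrow> bool" where
  "good x \<longleftrightarrow> (\<forall>c\<in>set x. c \<noteq> [])"

lemma cmpb_good [cmp]: "cmp x \<Longrightarrow> cmpb (\<lambda>y. good (x y))"
  unfolding good_def by (intro cmp)

definition word_state :: "par \<Rightarrow> symrep list \<Rightarrow> nat \<times> nat" where
  "word_state P u = (let n = num_vars (snd (snd (snd P))) in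
     case table_run (fst (snd P), fst P, n, u) (snd (snd (snd P))) of [] \<Rightarrow> (0, 0)
     | tab # _ \<Rightarrow> lookup tab (empty_env n))"

lemma word_state_eq:
  "word_state (\<Sigma>, w, \<tau>, p) u = (case formula_run p of [] \<Rightarrow> (0, 0) | \<phi> # _ \<Rightarrow> fo_state w \<Sigma> u \<phi> (empty_env (num_vars p)))"
  by (auto simp: word_state_def table_run_formula_run Let_def lookup_map empty_env_in split: list.split)

text \<open>All words with a padded layer are collapsed to one rejecting value; once padding has
  occurred it persists under extension. The first flag separates the empty word, which represents no
  diagram.\<close>

definition word_type :: "par \<Rightarrow> symrep list \<Rightarrow> nat \<times> nat \<times> nat \<times> nat" where
  "word_type P u = (b2n (u = []), if \<forall>x\<in>set u. good x then (1, word_state P u) else (0, 0, 0))"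

lemma cmp_word_type [cmp]: "cmp P \<Longrightarrow> cmp u \<Longrightarrow> cmp (\<lambda>x. word_type (P x) (u x))"
  by (rule cmp2[of word_type]; (unfold word_type_def word_state_def Let_def)?; (intro cmp)?)

lemma map_take_empty_env: "map (take k) (empty_env n) = empty_env n"
  by (simp add: empty_env_def)

lemma nthd_empty_env: "nthd [] (empty_env n) x = []"
  by (simp add: empty_env_def nthd_def hd_drop_conv_nth)

text \<open>Equality of word types is a right congruence. Together with the finite range shown next
  it has finite index, as in the Myhill-Nerode theorem.\<close>

lemma word_type_cong:
  assumes "word_type P u1 = word_type P u2"
  shows "word_type P (u1 @ [x]) = word_type P (u2 @ [x])"
proof -
  obtain \<Sigma> w \<tau> p where P: "P = (\<Sigma>, w, \<tau>, p)" by (cases P)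
  have "word_state P (u1 @ [x]) = word_state P (u2 @ [x])"
    if "word_state P u1 = word_state P u2"
    using that unfolding P word_state_eq
    by (auto split: list.splits intro!: fo_state_cong
        simp: map_take_empty_env env_step_def nthd_empty_env) (auto simp: empty_env_def)
  then show ?thesis using assms by (auto simp: word_type_def split: if_splits)
qed

lemma finite_range_word_type: "finite (range (word_type P))"
proof -
  obtain \<Sigma> w \<tau> p where P: "P = (\<Sigma>, w, \<tau>, p)" by (cases P)
  have "finite (range (word_state P))"
  proof (cases "formula_run p")
    case (Cons \<phi> \<phi>s)
    have "fo_state w \<Sigma> u \<phi> (empty_env (num_vars p)) \<in> range (\<lambda>(u, E). fo_state w \<Sigma> u \<phi> E)" for u
      by (rule range_eqI[of _ _ "(u, empty_env (num_vars p))"]) simp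
    then have "range (word_state P) \<subseteq> range (\<lambda>(u, E). fo_state w \<Sigma> u \<phi> E)"
      unfolding P word_state_eq Cons by auto
    then show ?thesis using finite_range_fo_state finite_subset by blast
  qed (simp add: P word_state_eq)
  moreover have "range (word_type P) \<subseteq> range b2n \<times> {0, 1} \<times> insert (0, 0) (range (word_state P))"
    by (rule image_subsetI) (simp add: word_type_def)
  ultimately show ?thesis
    by (meson finite_SigmaI finite.intros finite_range_b2n finite_subset)
qed

section \<open>Types of words\<close>

text \<open>A type is a number, read as the code of a word; the type of the empty word is 0.\<close>

definition type_step :: "par \<Rightarrow> nat \<Rightarrow> symrep \<Rightarrow> nat" where
  "type_step P t s = (LEAST n. word_type P (dec n) = word_type P (dec t @ [s]))"

lemma word_type_type_step: "word_type P (dec (type_step P t s)) = word_type P (dec t @ [s])"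
  unfolding type_step_def by (rule LeastI[of _ "enc (dec t @ [s])"]) simp

lemma cmp_type_step [cmp]: "cmp P \<Longrightarrow> cmp t \<Longrightarrow> cmp s \<Longrightarrow> cmp (\<lambda>x. type_step (P x) (t x) (s x))"
proof (rule cmp3[of type_step], unfold type_step_def)
  show "cmp (\<lambda>p. LEAST n. word_type (fst p) (dec n) = word_type (fst p) (dec (fst (snd p)) @ [snd (snd p)]))"
  proof (rule cmp_Least)
    show "\<exists>n. word_type (fst p) (dec n) = word_type (fst p) (dec (fst (snd p)) @ [snd (snd p)])"
      for p :: "par \<times> nat \<times> symrep"
      by (rule exI[of _ "enc (dec (fst (snd p)) @ [snd (snd p)])"]) simp
  qed (intro cmp)
qed

text \<open>A value of \<open>type_step\<close> is the least code of a word of some type, and there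
  are finitely many types. The bound is uniform in \<open>t\<close>, even if \<open>t\<close> itself
  is not a least code.\<close>

lemma type_step_bounded: "\<exists>M. \<forall>t s. type_step P t s < M"
proof -
  have "finite ((\<lambda>v. LEAST n. word_type P (dec n) = v) ` range (word_type P))"
    using finite_range_word_type by blast
  moreover have "type_step P t s \<in> (\<lambda>v. LEAST n. word_type P (dec n) = v) ` range (word_type P)" for t s
    unfolding type_step_def by blast
  ultimately show ?thesis
    by (meson finite_nat_set_iff_bounded)
qed

section \<open>A finite list of symbols that covers the alphabet\<close>

definition padded_letters :: "nat list \<Rightarrow> nat list list" where
  "padded_letters \<Sigma> = [0] # map (\<lambda>a. [1, a]) \<Sigma>"

definition padded_tuples :: "nat list \<Rightarrow> nat \<Rightarrow> nat list list" where
  "padded_tuples \<Sigma> a = [0] # map (\<lambda>ts. 1 # a # concat ts) (List.n_lists a (padded_letters \<Sigma>))"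

definition singles :: "nat \<Rightarrow> nat list list" where
  "singles w = map (\<lambda>x. [x]) [0..<w]"

definition triples :: "nat \<Rightarrow> nat list list \<Rightarrow> nat list list" where
  "triples w ts = concat (map (\<lambda>p. concat (map (\<lambda>t. map (\<lambda>q. p # t @ [q]) [0..<w]) ts)) [0..<w])"

text \<open>A subset of the entries of \<open>U\<close>, listed without repetition, is no longer
  than \<open>U\<close>. Lists with repetitions are included as well; this is simpler to enumerate
  and remains finite.\<close>

definition bounded_lists :: "nat list list \<Rightarrow> nat list list list" where
  "bounded_lists U = concat (map (\<lambda>n. List.n_lists n U) [0..<Suc (length U)])"

definition layer_reps :: "nat \<Rightarrow> nat list list \<Rightarrow> lrep list" where
  "layer_reps w ts = concat (map (\<lambda>ss. map (\<lambda>fl. (ss, fl)) (List.n_lists 2 [0, 1]))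
     (product_lists [bounded_lists (singles w), bounded_lists (singles w), bounded_lists (triples w ts),
        bounded_lists (singles w), bounded_lists (singles w)]))"

definition opt_layer_reps :: "nat \<Rightarrow> nat list list \<Rightarrow> lrep list list" where
  "opt_layer_reps w ts = [] # map (\<lambda>B. [B]) (layer_reps w ts)"

text \<open>An overapproximation of the alphabet: the conditions that make a tuple a layer are not
  checked. It suffices that all representations of real symbols occur and that the tokens stay
  prefix-free.\<close>

definition symbols :: "par \<Rightarrow> symrep list" where
  "symbols P = product_lists (opt_layer_reps (fst (snd P)) (padded_letters (fst P)) #
     map (\<lambda>a. opt_layer_reps (fst (snd P)) (padded_tuples (fst P) a)) (fst (snd (snd P))))"

lemma cmp_padded_letters [cmp]: "cmp s \<Longrightarrow> cmp (\<lambda>x. padded_letters (s x))"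
  unfolding padded_letters_def by (intro cmp)

lemma cmp_padded_tuples [cmp]: "cmp s \<Longrightarrow> cmp a \<Longrightarrow> cmp (\<lambda>x. padded_tuples (s x) (a x))"
  by (rule cmp2[of padded_tuples]; (unfold padded_tuples_def)?; (intro cmp)?)

lemma cmp_singles [cmp]: "cmp s \<Longrightarrow> cmp (\<lambda>x. singles (s x))"
  unfolding singles_def by (intro cmp)

lemma cmp_triples [cmp]: "cmp s \<Longrightarrow> cmp a \<Longrightarrow> cmp (\<lambda>x. triples (s x) (a x))"
  by (rule cmp2[of triples]; (unfold triples_def)?; (intro cmp)?)

lemma cmp_bounded_lists [cmp]: "cmp s \<Longrightarrow> cmp (\<lambda>x. bounded_lists (s x))"
  by (rule cmp_comp[of bounded_lists]; (unfold bounded_lists_def)?; (intro cmp)?)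

lemma cmp_opt_layer_reps [cmp]: "cmp s \<Longrightarrow> cmp a \<Longrightarrow> cmp (\<lambda>x. opt_layer_reps (s x) (a x))"
  by (rule cmp2[of opt_layer_reps]; (unfold opt_layer_reps_def layer_reps_def)?; (intro cmp)?)

lemma cmp_symbols [cmp]: "cmp s \<Longrightarrow> cmp (\<lambda>x. symbols (s x))"
  by (rule cmp_comp[of symbols]; (unfold symbols_def)?; (intro cmp)?)

definition layer_tokens :: "lrep \<Rightarrow> nat list" where
  "layer_tokens B = concat (map (\<lambda>s. length s # concat s) (fst B)) @ snd B"

definition option_tokens :: "lrep list \<Rightarrow> nat list" where
  "option_tokens b = (case b of [] \<Rightarrow> [0] | B # _ \<Rightarrow> 1 # layer_tokens B)"

definition symbol_tokens :: "symrep \<Rightarrow> nat list" where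
  "symbol_tokens x = (case x of [] \<Rightarrow> [] | b # bs \<Rightarrow> option_tokens b @ length bs # concat (map option_tokens bs))"

lemma cmp_layer_tokens [cmp]: "cmp s \<Longrightarrow> cmp (\<lambda>x. layer_tokens (s x))"
  unfolding layer_tokens_def by (intro cmp)

lemma cmp_option_tokens [cmp]: "cmp s \<Longrightarrow> cmp (\<lambda>x. option_tokens (s x))"
  unfolding option_tokens_def by (intro cmp)

lemma cmp_symbol_tokens [cmp]: "cmp s \<Longrightarrow> cmp (\<lambda>x. symbol_tokens (s x))"
  unfolding symbol_tokens_def by (intro cmp)

text \<open>Parsing by comparison with all symbols. The accumulator is reversed because a token is
  added at the front of a list when it is read.\<close>

definition parse_symbol :: "par \<Rightarrow> nat list \<Rightarrow> symrep list" where
  "parse_symbol P acc = filter (\<lambda>s. symbol_tokens s = rev acc) (symbols P)"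

lemma cmp_parse_symbol [cmp]: "cmp s \<Longrightarrow> cmp a \<Longrightarrow> cmp (\<lambda>x. parse_symbol (s x) (a x))"
  by (rule cmp2[of parse_symbol]; (unfold parse_symbol_def)?; (intro cmp)?)

text \<open>The types reachable from 0 lie below any such \<open>M\<close>, and the least one is
  found by testing closure. It exists because all steps stay below one common bound.\<close>

definition num_types :: "par \<Rightarrow> nat" where
  "num_types P = (LEAST M. 0 < M \<and> (\<forall>t\<in>set [0..<M]. \<forall>s\<in>set (symbols P). type_step P t s < M))"

lemma num_types_ex: "\<exists>M. 0 < M \<and> (\<forall>t\<in>set [0..<M]. \<forall>s\<in>set (symbols P). type_step P t s < M)"
proof -
  obtain M where "\<And>t s. type_step P t s < M" using type_step_bounded by blast
  then show ?thesis by (intro exI[of _ M]) (auto dest: meta_spec intro: le_less_trans[OF le0])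
qed

lemma num_types_pos: "0 < num_types P"
  and type_step_less_num_types: "t < num_types P \<Longrightarrow> s \<in> set (symbols P) \<Longrightarrow> type_step P t s < num_types P"
  using LeastI_ex[OF num_types_ex[of P]] unfolding num_types_def by auto

lemma cmp_num_types [cmp]:
  assumes "cmp P"
  shows "cmp (\<lambda>x. num_types (P x))"
proof -
  have "cmp num_types"
    unfolding num_types_def by (rule cmp_Least) (intro cmp, rule num_types_ex)
  then show ?thesis using assms by (rule cmp_comp)
qed

definition type_accepts :: "par \<Rightarrow> nat \<Rightarrow> bool" where
  "type_accepts P t \<longleftrightarrow> fst (word_type P (dec t)) = 0 \<and> fst (snd (word_type P (dec t))) = 1 \<and> snd (snd (snd (word_type P (dec t)))) \<noteq> 0"

lemma cmpb_type_accepts [cmp]: "cmp s \<Longrightarrow> cmp a \<Longrightarrow> cmpb (\<lambda>x. type_accepts (s x) (a x))"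
  by (rule cmpb2[of type_accepts]; (unfold type_accepts_def)?; (intro cmp)?)

definition par_tokens :: "par \<Rightarrow> nat list" where
  "par_tokens P = length (fst P) # fst P @ fst (snd P) # length (fst (snd (snd P))) # fst (snd (snd P)) @
     concat (token_run (snd (snd (snd P))))"

lemma cmp_par_tokens [cmp]: "cmp s \<Longrightarrow> cmp (\<lambda>x. par_tokens (s x))"
  unfolding par_tokens_def by (intro cmp)

lemma word_type_foldl_type_step: "word_type P (dec (foldl (type_step P) t u)) = word_type P (dec t @ u)"
proof (induction u rule: rev_induct)
  case (snoc x u)
  then show ?case using word_type_cong[OF snoc, of x] by (simp add: word_type_type_step)
qed simp

lemma type_accepts_foldl_type_step:
  "type_accepts P (foldl (type_step P) 0 u) \<longleftrightarrow> u \<noteq> [] \<and> (\<forall>x\<in>set u. good x) \<and> snd (word_state P u) \<noteq> 0"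
proof -
  have "dec 0 = ([] :: symrep list)" by (metis dec_enc enc_Nil)
  then show ?thesis
    unfolding type_accepts_def word_type_foldl_type_step by (auto simp: word_type_def)
qed

text \<open>Polish notation: the tag fixes the number and order of the subformulas, and variable
  lists carry their length. This marks the end of the parameters, which the automaton follows in the
  input.\<close>

lemma enc_fo_prefix_free: "enc_fo \<phi> @ a = enc_fo \<psi> @ b \<Longrightarrow> \<phi> = \<psi> \<and> a = b"
proof (induction \<phi> arbitrary: \<psi> a b)
  case (Rel i xs)
  then show ?case by (cases \<psi>) (auto simp: enc_list_def concat_map_single)
next
  case (Eq x y)
  then show ?case by (cases \<psi>) auto
next
  case (Neg \<phi>)
  then show ?case by (cases \<psi>) auto
next
  case (Conj \<phi>1 \<phi>2)
  show ?case
  proof (cases \<psi>)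
    case (Conj \<psi>1 \<psi>2)
    then have "enc_fo \<phi>1 @ enc_fo \<phi>2 @ a = enc_fo \<psi>1 @ enc_fo \<psi>2 @ b"
      using Conj.prems by simp
    then show ?thesis
      using Conj.IH(1)[of "enc_fo \<phi>2 @ a" \<psi>1 "enc_fo \<psi>2 @ b"] Conj.IH(2)[of a \<psi>2 b]
        \<open>\<psi> = Conj \<psi>1 \<psi>2\<close> by blast
  qed (use Conj.prems in auto)
next
  case (Disj \<phi>1 \<phi>2)
  show ?case
  proof (cases \<psi>)
    case (Disj \<psi>1 \<psi>2)
    then have "enc_fo \<phi>1 @ enc_fo \<phi>2 @ a = enc_fo \<psi>1 @ enc_fo \<psi>2 @ b"
      using Disj.prems by simp
    then show ?thesis
      using Disj.IH(1)[of "enc_fo \<phi>2 @ a" \<psi>1 "enc_fo \<psi>2 @ b"] Disj.IH(2)[of a \<psi>2 b]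
        \<open>\<psi> = Disj \<psi>1 \<psi>2\<close> by blast
  qed (use Disj.prems in auto)
next
  case (Ex x \<phi>)
  then show ?case by (cases \<psi>) auto
next
  case (All x \<phi>)
  then show ?case by (cases \<psi>) auto
qed

definition code_list :: "('a \<Rightarrow> nat list) \<Rightarrow> 'a set \<Rightarrow> nat list list" where
  "code_list e X = sorted_list_of_set (e ` X)"

lemma set_code_list: "finite X \<Longrightarrow> set (code_list e X) = e ` X"
  by (simp add: code_list_def)

lemma enc_set_code_list: "enc_set e X = length (code_list e X) # concat (code_list e X)"
  by (simp add: enc_set_def code_list_def enc_list_def)

lemma length_concat_code_list: "length (concat (code_list enc_nat X)) = length (code_list enc_nat X)"
proof -
  have "\<forall>x\<in>set (code_list enc_nat X). length x = 1"
    by (cases "finite X") (auto simp: code_list_def enc_nat_def finite_image_iff inj_on_def)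
  moreover have "length (concat L) = length L" if "\<forall>x\<in>set L. length x = 1" for L :: "nat list list"
    using that by (induction L) auto
  ultimately show ?thesis by blast
qed

definition par_rep :: "nat set \<Rightarrow> nat \<Rightarrow> nat list \<Rightarrow> fo \<Rightarrow> par" where
  "par_rep \<Sigma> w \<tau> \<phi> = (concat (code_list enc_nat \<Sigma>), w, \<tau>, postfix \<phi>)"

lemma par_tokens_par_rep: "par_tokens (par_rep \<Sigma> w \<tau> \<phi>) = enc_parameters \<Sigma> w \<tau> \<phi>"
  by (simp add: par_tokens_def par_rep_def enc_parameters_def enc_set_code_list length_concat_code_list token_run_formula_run
      formula_run_postfix enc_list_def concat_map_single enc_nat_def)

text \<open>The search need not find \<open>par_rep\<close>: different instruction lists, for
  instance with different entries in fields that an instruction ignores, describe the same formula.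
  Only what the list evaluates to is fixed.\<close>

definition is_par :: "nat set \<Rightarrow> nat \<Rightarrow> nat list \<Rightarrow> fo \<Rightarrow> par \<Rightarrow> bool" where
  "is_par \<Sigma> w \<tau> \<phi> P \<longleftrightarrow> (\<exists>\<Sigma>s p. P = (\<Sigma>s, w, \<tau>, p) \<and> set \<Sigma>s = \<Sigma> \<and> formula_run p = [\<phi>])"

lemma set_concat_code_list: "finite X \<Longrightarrow> set (concat (code_list enc_nat X)) = X"
  by (simp add: set_code_list enc_nat_def)

text \<open>The length headers and prefix-freeness of formula tokens imply that a valid candidate
  cannot agree with the input on a proper part of the parameters, nor run beyond their end. The
  arbitrary remainders \<open>a\<close> and \<open>b\<close> express this for either side being
  longer.\<close>

lemma par_tokens_prefix:
  assumes "finite \<Sigma>" "par_tokens P @ a = enc_parameters \<Sigma> w \<tau> \<phi> @ b" "length (token_run (snd (snd (snd P)))) = 1"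
  shows "is_par \<Sigma> w \<tau> \<phi> P" "par_tokens P = enc_parameters \<Sigma> w \<tau> \<phi>"
proof -
  obtain \<Sigma>s w' \<tau>' p where P: "P = (\<Sigma>s, w', \<tau>', p)" by (cases P)
  obtain \<psi> where \<psi>: "formula_run p = [\<psi>]"
    using assms(3) by (auto simp: P token_run_formula_run length_Suc_conv)
  have eq: "length \<Sigma>s # \<Sigma>s @ w' # length \<tau>' # \<tau>' @ enc_fo \<psi> @ a =
    length (concat (code_list enc_nat \<Sigma>)) # concat (code_list enc_nat \<Sigma>) @ w # length \<tau> # \<tau> @ enc_fo \<phi> @ b"
    using assms(2) unfolding par_tokens_par_rep[symmetric]
    by (simp add: par_tokens_def P token_run_formula_run \<psi> par_rep_def formula_run_postfix)
  have "\<Sigma>s = concat (code_list enc_nat \<Sigma>)" using eq by auto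
  moreover have "w' = w" using eq by auto
  moreover have "\<tau>' = \<tau>" using eq by auto
  moreover have "enc_fo \<psi> @ a = enc_fo \<phi> @ b" using eq by auto
  then have "\<psi> = \<phi>" using enc_fo_prefix_free by blast
  ultimately show "is_par \<Sigma> w \<tau> \<phi> P" "par_tokens P = enc_parameters \<Sigma> w \<tau> \<phi>"
    unfolding par_tokens_par_rep[symmetric]
    using set_concat_code_list[OF assms(1)] \<psi>
    by (auto simp: is_par_def P par_tokens_def par_rep_def token_run_formula_run formula_run_postfix simp del: set_concat)
qed

section \<open>Representation of layers and symbols by nested lists\<close>

abbreviation enc_tup :: "nat option list \<Rightarrow> nat list" where
  "enc_tup \<equiv> enc_list (enc_option enc_nat)"

definition rep_layer :: "('a \<Rightarrow> nat list) \<Rightarrow> 'a layer \<Rightarrow> lrep" where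
  "rep_layer e B = ([code_list enc_nat (lay_left B), code_list enc_nat (lay_right B),
     code_list (enc_triple enc_nat (enc_option e) enc_nat) (lay_trans B),
     code_list enc_nat (lay_init B), code_list enc_nat (lay_final B)], [b2n (lay_isfirst B), b2n (lay_islast B)])"

definition rep_opt :: "('a \<Rightarrow> nat list) \<Rightarrow> 'a layer option \<Rightarrow> lrep list" where
  "rep_opt e b = (case b of None \<Rightarrow> [] | Some B \<Rightarrow> [rep_layer e B])"

definition rep_sym :: "nat odd_symbol \<Rightarrow> symrep" where
  "rep_sym x = rep_opt enc_nat (fst x) # map (rep_opt enc_tup) (snd x)"

lemma layer_tokens_rep_layer: "layer_tokens (rep_layer e B) = enc_layer e B"
  by (simp add: layer_tokens_def rep_layer_def enc_layer_def enc_set_code_list enc_bool_def b2n_def)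

lemma option_tokens_rep_opt: "option_tokens (rep_opt e b) = enc_option (enc_layer e) b"
  by (cases b) (simp_all add: option_tokens_def rep_opt_def layer_tokens_rep_layer)

lemma symbol_tokens_rep_sym: "symbol_tokens (rep_sym x) = enc_symbol x"
  by (cases x) (simp add: symbol_tokens_def rep_sym_def option_tokens_rep_opt enc_symbol_def enc_list_def comp_def)

lemma rep_opt_eq_Nil [simp]: "rep_opt e b = [] \<longleftrightarrow> b = None"
  by (simp add: rep_opt_def split: option.split)

lemma good_rep_sym: "good (rep_sym x) \<longleftrightarrow> fst x \<noteq> None \<and> None \<notin> set (snd x)"
  by (auto simp: good_def rep_sym_def) (metis option.exhaust)

lemma set_bounded_lists: "set (bounded_lists U) = {l. set l \<subseteq> set U \<and> length l \<le> length U}"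
  by (auto simp: bounded_lists_def set_n_lists less_Suc_eq_le simp del: upt_Suc)

lemma code_list_in_bounded_lists:
  assumes "e ` X \<subseteq> set U"
  shows "code_list e X \<in> set (bounded_lists U)"
proof -
  have fin: "finite (e ` X)" using assms finite_subset by blast
  then have "set (code_list e X) \<subseteq> set U" "distinct (code_list e X)"
    using assms by (auto simp: code_list_def)
  then show ?thesis
    unfolding set_bounded_lists using card_mono[of "set U" "set (code_list e X)"] card_length[of U]
    by (simp add: distinct_card)
qed

lemma set_singles: "set (singles w) = {[x] | x. x < w}"
  by (auto simp: singles_def)

lemma set_triples: "set (triples w ts) = {p # t @ [q] | p t q. p < w \<and> t \<in> set ts \<and> q < w}"
proof -
  have "x \<in> set (triples w ts) \<longleftrightarrow> (\<exists>p\<in>{0..<w}. \<exists>t\<in>set ts. \<exists>q\<in>{0..<w}. x = p # t @ [q])" for x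
    unfolding triples_def set_concat set_map set_upt image_image
    by (simp add: image_iff)
  then show ?thesis by auto
qed

lemma in_layer_reps: "B \<in> set (layer_reps w ts) \<longleftrightarrow>
    list_all2 (\<lambda>x Y. x \<in> set Y) (fst B) [bounded_lists (singles w), bounded_lists (singles w),
      bounded_lists (triples w ts), bounded_lists (singles w), bounded_lists (singles w)] \<and>
    length (snd B) = 2 \<and> set (snd B) \<subseteq> {0, 1}"
  unfolding layer_reps_def set_concat set_map product_lists_set
  by (cases B) (auto simp: set_n_lists simp del: list_all2_Cons)

lemma rep_layer_in_layer_reps:
  assumes "B \<in> layers \<Gamma> w" "enc_option e ` padded \<Gamma> \<subseteq> set ts"
  shows "rep_layer e B \<in> set (layer_reps w ts)"
proof -
  have B: "lay_left B \<subseteq> {..<w}" "lay_right B \<subseteq> {..<w}" "lay_init B \<subseteq> {..<w}" "lay_final B \<subseteq> {..<w}"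
    "lay_trans B \<subseteq> {..<w} \<times> padded \<Gamma> \<times> {..<w}"
    using assms(1) by (auto simp: layers_def)
  have nat: "code_list enc_nat X \<in> set (bounded_lists (singles w))" if "X \<subseteq> {..<w}" for X
    using that by (intro code_list_in_bounded_lists) (auto simp: set_singles enc_nat_def)
  have "enc_triple enc_nat (enc_option e) enc_nat ` lay_trans B \<subseteq> set (triples w ts)"
    unfolding set_triples enc_triple_def enc_nat_def using B(5) assms(2) by fastforce
  then show ?thesis
    unfolding in_layer_reps rep_layer_def using B nat by (simp add: code_list_in_bounded_lists b2n_def)
qed

lemma rep_opt_in_opt_layer_reps:
  assumes "b \<in> padded (layers \<Gamma> w)" "enc_option e ` padded \<Gamma> \<subseteq> set ts"
  shows "rep_opt e b \<in> set (opt_layer_reps w ts)"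
  using assms rep_layer_in_layer_reps[of _ \<Gamma> w e ts] by (auto simp: opt_layer_reps_def rep_opt_def padded_def)

lemma enc_option_padded_letters: "enc_option enc_nat ` padded (set \<Sigma>) = set (padded_letters \<Sigma>)"
  by (auto simp: padded_def padded_letters_def enc_nat_def image_image)

lemma enc_option_padded_tuples: "enc_option enc_tup ` padded (tensor_power (set \<Sigma>) a) \<subseteq> set (padded_tuples \<Sigma> a)"
proof -
  have "1 # enc_tup t \<in> set (padded_tuples \<Sigma> a)" if "length t = a" "set t \<subseteq> padded (set \<Sigma>)" for t
  proof -
    have "map (enc_option enc_nat) t \<in> set (List.n_lists a (padded_letters \<Sigma>))"
      using that enc_option_padded_letters[of \<Sigma>] by (auto simp: set_n_lists)
    then show ?thesis using that by (auto simp: padded_tuples_def enc_list_def)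
  qed
  then show ?thesis by (auto simp: padded_def tensor_power_def padded_tuples_def)
qed

lemma rep_sym_in_symbols:
  assumes "x \<in> odd_alphabet (set \<Sigma>) w \<tau>"
  shows "rep_sym x \<in> set (symbols (\<Sigma>, w, \<tau>, p))"
proof -
  obtain b bs where x: "x = (b, bs)" by (cases x)
  have "rep_opt enc_nat b \<in> set (opt_layer_reps w (padded_letters \<Sigma>))"
    using assms x enc_option_padded_letters[of \<Sigma>]
    by (intro rep_opt_in_opt_layer_reps[where \<Gamma> = "set \<Sigma>"]) (auto simp: odd_alphabet_def)
  moreover have "list_all2 (\<lambda>x Y. x \<in> set Y) (map (rep_opt enc_tup) bs)
      (map (\<lambda>a. opt_layer_reps w (padded_tuples \<Sigma> a)) \<tau>)"
    unfolding list_all2_conv_all_nth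
  proof (intro conjI allI impI)
    fix i assume "i < length (map (rep_opt enc_tup) bs)"
    then show "map (rep_opt enc_tup) bs ! i \<in> set (map (\<lambda>a. opt_layer_reps w (padded_tuples \<Sigma> a)) \<tau> ! i)"
      using assms x rep_opt_in_opt_layer_reps[OF _ enc_option_padded_tuples, of "bs ! i" \<Sigma> "\<tau> ! i" w]
      by (auto simp: odd_alphabet_def)
  qed (use assms x in \<open>simp add: odd_alphabet_def\<close>)
  ultimately show ?thesis
    unfolding symbols_def product_lists_set rep_sym_def by (simp add: x)
qed

section \<open>The token encoding is prefix-free\<close>

definition prefix_free :: "('a \<Rightarrow> nat list) \<Rightarrow> 'a set \<Rightarrow> bool" where
  "prefix_free e X \<longleftrightarrow> (\<forall>x\<in>X. \<forall>y\<in>X. \<forall>a b. e x @ a = e y @ b \<longrightarrow> x = y \<and> a = b)"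

lemma prefix_freeD: "prefix_free e X \<Longrightarrow> x \<in> X \<Longrightarrow> y \<in> X \<Longrightarrow> e x @ a = e y @ b \<Longrightarrow> x = y \<and> a = b"
  unfolding prefix_free_def by blast

text \<open>The list \<open>Ys\<close> fixes the number of blocks in advance, so the concatenation
  of prefix-free blocks can be decoded without a length header.\<close>

lemma prefix_free_product:
  assumes "list_all2 (\<lambda>x Y. x \<in> Y) xs Ys" "list_all2 (\<lambda>x Y. x \<in> Y) ys Ys" "\<And>Y. Y \<in> set Ys \<Longrightarrow> prefix_free e Y"
    "concat (map e xs) @ a = concat (map e ys) @ b"
  shows "xs = ys \<and> a = b"
  using assms
proof (induction xs Ys arbitrary: ys rule: list_all2_induct)
  case (Cons x xs Y Ys)
  then obtain y ys' where ys: "ys = y # ys'" "y \<in> Y" "list_all2 (\<lambda>x Y. x \<in> Y) ys' Ys"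
    by (auto simp: list_all2_Cons2)
  have "prefix_free e Y" using Cons.prems(2) by simp
  moreover have "e x @ concat (map e xs) @ a = e y @ concat (map e ys') @ b"
    using Cons.prems(3) ys(1) by simp
  ultimately have "x = y \<and> concat (map e xs) @ a = concat (map e ys') @ b"
    by (rule prefix_freeD[OF _ Cons.hyps(1) ys(2)])
  moreover from this have "xs = ys' \<and> a = b"
    by (intro Cons.IH) (use ys(3) Cons.prems(2) in simp_all)
  ultimately show ?case using ys(1) by simp
qed simp

lemma prefix_free_lists:
  assumes "prefix_free e X"
  shows "prefix_free (\<lambda>l. length l # concat (map e l)) {l. set l \<subseteq> X}"
  unfolding prefix_free_def
proof (intro ballI allI impI)
  fix x y a b
  assume *: "x \<in> {l. set l \<subseteq> X}" "y \<in> {l. set l \<subseteq> X}"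
    "(length x # concat (map e x)) @ a = (length y # concat (map e y)) @ b"
  have "list_all2 (\<lambda>x Y. x \<in> Y) l (replicate (length l) X)" if "set l \<subseteq> X" for l
    using that by (auto simp: list_all2_conv_all_nth)
  from prefix_free_product[of x "replicate (length x) X" y e a b] this[of x] this[of y] show "x = y \<and> a = b"
    using * assms by auto
qed

lemma prefix_free_subset: "prefix_free e X \<Longrightarrow> Y \<subseteq> X \<Longrightarrow> prefix_free e Y"
  unfolding prefix_free_def by blast

lemma prefix_free_padded_letters: "prefix_free (\<lambda>t. t) (set (padded_letters \<Sigma>))"
  unfolding prefix_free_def
proof (intro ballI allI impI)
  fix x y a b assume *: "x \<in> set (padded_letters \<Sigma>)" "y \<in> set (padded_letters \<Sigma>)" "x @ a = y @ b"
  have o: "z = [0] \<or> (\<exists>c. z = [1, c])" if "z \<in> set (padded_letters \<Sigma>)" for z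
    using that by (auto simp: padded_letters_def)
  show "x = y \<and> a = b" using o[OF *(1)] o[OF *(2)] *(3) by auto
qed

lemma prefix_free_padded_tuples: "prefix_free (\<lambda>t. t) (set (padded_tuples \<Sigma> a))"
  unfolding prefix_free_def
proof (intro ballI allI impI)
  fix x y c d assume x: "x \<in> set (padded_tuples \<Sigma> a)" and y: "y \<in> set (padded_tuples \<Sigma> a)" and eq: "x @ c = y @ d"
  have *: "z = [0] \<or> (\<exists>ts. z = 1 # a # concat ts \<and> length ts = a \<and> set ts \<subseteq> set (padded_letters \<Sigma>))"
    if "z \<in> set (padded_tuples \<Sigma> a)" for z
    using that by (auto simp: padded_tuples_def set_n_lists)
  show "x = y \<and> c = d"
  proof (cases "x = [0] \<or> y = [0]")
    case True
    then show ?thesis using *[OF x] *[OF y] eq by auto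
  next
    case False
    then obtain ts ts' where ts: "x = 1 # a # concat ts" "length ts = a" "set ts \<subseteq> set (padded_letters \<Sigma>)"
      "y = 1 # a # concat ts'" "length ts' = a" "set ts' \<subseteq> set (padded_letters \<Sigma>)"
      using *[OF x] *[OF y] by blast
    have "ts = ts' \<and> c = d"
      by (rule prefix_freeD[OF prefix_free_lists[OF prefix_free_padded_letters[of \<Sigma>]]]) (use ts eq in simp_all)
    then show ?thesis using ts by simp
  qed
qed

lemma prefix_free_singles: "prefix_free (\<lambda>t. t) (set (singles w))"
  by (auto simp: prefix_free_def set_singles)

lemma prefix_free_triples:
  assumes "prefix_free (\<lambda>t. t) (set ts)"
  shows "prefix_free (\<lambda>t. t) (set (triples w ts))"
  unfolding prefix_free_def
proof (intro ballI allI impI)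
  fix x y a b assume *: "x \<in> set (triples w ts)" "y \<in> set (triples w ts)" "x @ a = y @ b"
  obtain p t q where x: "x = p # t @ [q]" "t \<in> set ts" using *(1) unfolding set_triples by blast
  obtain p' t' q' where y: "y = p' # t' @ [q']" "t' \<in> set ts" using *(2) unfolding set_triples by blast
  have "t = t' \<and> q # a = q' # b"
    by (rule prefix_freeD[OF assms]) (use * x y in simp_all)
  then show "x = y \<and> a = b" using x y * by simp
qed

lemma prefix_free_bounded_lists:
  assumes "prefix_free (\<lambda>t. t) (set U)"
  shows "prefix_free (\<lambda>s. length s # concat s) (set (bounded_lists U))"
  using prefix_free_lists[OF assms] by (auto simp: set_bounded_lists intro: prefix_free_subset)

lemma prefix_free_layer_reps:
  assumes "prefix_free (\<lambda>t. t) (set ts)"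
  shows "prefix_free layer_tokens (set (layer_reps w ts))"
  unfolding prefix_free_def
proof (intro ballI allI impI)
  fix x y a b
  assume x: "x \<in> set (layer_reps w ts)" and y: "y \<in> set (layer_reps w ts)" and eq: "layer_tokens x @ a = layer_tokens y @ b"
  let ?Ys = "map set [bounded_lists (singles w), bounded_lists (singles w), bounded_lists (triples w ts),
        bounded_lists (singles w), bounded_lists (singles w)]"
  have l: "list_all2 (\<lambda>x Y. x \<in> Y) (fst x) ?Ys" "list_all2 (\<lambda>x Y. x \<in> Y) (fst y) ?Ys"
    using x y unfolding in_layer_reps list_all2_map2 by blast+
  have "prefix_free (\<lambda>s. length s # concat s) Y" if "Y \<in> set ?Ys" for Y
    using that prefix_free_bounded_lists[OF prefix_free_singles] prefix_free_bounded_lists[OF prefix_free_triples[OF assms]] by auto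
  from prefix_free_product[OF l this, of "snd x @ a" "snd y @ b"] eq
  have "fst x = fst y \<and> snd x @ a = snd y @ b"
    by (simp add: layer_tokens_def)
  moreover have "length (snd x) = length (snd y)"
    using x y by (simp add: in_layer_reps)
  ultimately show "x = y \<and> a = b" by (simp add: prod_eq_iff)
qed

lemma prefix_free_opt_layer_reps:
  assumes "prefix_free (\<lambda>t. t) (set ts)"
  shows "prefix_free option_tokens (set (opt_layer_reps w ts))"
  unfolding prefix_free_def
proof (intro ballI allI impI)
  fix x y a b assume *: "x \<in> set (opt_layer_reps w ts)" "y \<in> set (opt_layer_reps w ts)" "option_tokens x @ a = option_tokens y @ b"
  have o: "z = [] \<or> (\<exists>B\<in>set (layer_reps w ts). z = [B])" if "z \<in> set (opt_layer_reps w ts)" for z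
    using that by (auto simp: opt_layer_reps_def)
  show "x = y \<and> a = b"
  proof (cases "x = [] \<or> y = []")
    case True
    then show ?thesis using o[OF *(1)] o[OF *(2)] *(3) by (auto simp: option_tokens_def)
  next
    case False
    then obtain B B' where B: "x = [B]" "B \<in> set (layer_reps w ts)" "y = [B']" "B' \<in> set (layer_reps w ts)"
      using o[OF *(1)] o[OF *(2)] by blast
    have "B = B' \<and> a = b"
      by (rule prefix_freeD[OF prefix_free_layer_reps[OF assms] B(2,4)]) (use * B in \<open>simp add: option_tokens_def\<close>)
    then show ?thesis using B by simp
  qed
qed

lemma prefix_free_symbols: "prefix_free symbol_tokens (set (symbols (\<Sigma>, w, \<tau>, p)))"
  unfolding prefix_free_def
proof (intro ballI allI impI)
  fix x y a b
  assume x: "x \<in> set (symbols (\<Sigma>, w, \<tau>, p))" and y: "y \<in> set (symbols (\<Sigma>, w, \<tau>, p))" and eq: "symbol_tokens x @ a = symbol_tokens y @ b"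
  let ?Ys = "map (\<lambda>a. set (opt_layer_reps w (padded_tuples \<Sigma> a))) \<tau>"
  obtain b1 bs1 where 1: "x = b1 # bs1" "b1 \<in> set (opt_layer_reps w (padded_letters \<Sigma>))" "list_all2 (\<lambda>x Y. x \<in> Y) bs1 ?Ys"
    using x by (auto simp: symbols_def product_lists_set list_all2_Cons2 list_all2_map2)
  obtain b2 bs2 where 2: "y = b2 # bs2" "b2 \<in> set (opt_layer_reps w (padded_letters \<Sigma>))" "list_all2 (\<lambda>x Y. x \<in> Y) bs2 ?Ys"
    using y by (auto simp: symbols_def product_lists_set list_all2_Cons2 list_all2_map2)
  have "b1 = b2 \<and> length bs1 # concat (map option_tokens bs1) @ a = length bs2 # concat (map option_tokens bs2) @ b"
    by (rule prefix_freeD[OF prefix_free_opt_layer_reps[OF prefix_free_padded_letters[of \<Sigma>], of w]])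
      (use 1 2 eq in \<open>auto simp: symbol_tokens_def\<close>)
  moreover from this have "bs1 = bs2 \<and> a = b"
    by (intro prefix_free_product[OF 1(3) 2(3)]) (auto intro: prefix_free_opt_layer_reps prefix_free_padded_tuples)
  ultimately show "x = y \<and> a = b" using 1 2 by simp
qed

text \<open>A proper prefix of the tokens of a symbol matches no symbol at all, and the complete
  tokens match exactly one. The machine can thus detect the end of a symbol by asking after each
  token whether some symbol matches.\<close>

lemma parse_symbol_prefix:
  assumes "x \<in> odd_alphabet (set \<Sigma>) w \<tau>" "ts @ zs = enc_symbol x"
  shows "parse_symbol (\<Sigma>, w, \<tau>, p) (rev ts) = [] \<longleftrightarrow> zs \<noteq> []"
    and "zs = [] \<Longrightarrow> hd (parse_symbol (\<Sigma>, w, \<tau>, p) (rev ts)) = rep_sym x"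
proof -
  let ?P = "(\<Sigma>, w, \<tau>, p)"
  have x: "rep_sym x \<in> set (symbols ?P)" using rep_sym_in_symbols[OF assms(1)] .
  have *: "s = rep_sym x \<and> zs = []" if "s \<in> set (parse_symbol ?P (rev ts))" for s
    using that prefix_freeD[OF prefix_free_symbols, of s \<Sigma> w \<tau> p "rep_sym x" zs "[]"] x assms(2)
    by (auto simp: parse_symbol_def symbol_tokens_rep_sym)
  have "rep_sym x \<in> set (parse_symbol ?P (rev ts))" if "zs = []"
    using that x assms(2) by (simp add: parse_symbol_def symbol_tokens_rep_sym)
  then show 1: "parse_symbol ?P (rev ts) = [] \<longleftrightarrow> zs \<noteq> []"
    using * by (cases "parse_symbol ?P (rev ts)") auto
  show "hd (parse_symbol ?P (rev ts)) = rep_sym x" if "zs = []"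
    using * that 1 hd_in_set by blast
qed

lemma length_upd [simp]: "length (upd E x s) = length E"
  by (simp add: upd_def)

section \<open>Represented layers and runs of a diagram\<close>

lemma inj_enc_option: "inj e \<Longrightarrow> inj (enc_option e)"
  unfolding inj_def
proof (intro allI impI)
  fix x y assume "\<forall>x y. e x = e y \<longrightarrow> x = y" "enc_option e x = enc_option e y"
  then show "x = y" by (cases x; cases y) auto
qed

lemma inj_enc_nat: "inj enc_nat"
  by (simp add: inj_def enc_nat_def)

lemma inj_enc_tup: "inj enc_tup"
  unfolding inj_def
proof (intro allI impI)
  fix x y assume eq: "enc_tup x = enc_tup y"
  have pf: "prefix_free (enc_option enc_nat) UNIV"
    unfolding prefix_free_def
  proof (intro ballI allI impI)
    fix x y a b assume "enc_option enc_nat x @ a = enc_option enc_nat y @ b"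
    then show "x = y \<and> a = b" by (cases x; cases y) (auto simp: enc_nat_def)
  qed
  have "x = y \<and> ([]::nat list) = []"
    by (rule prefix_freeD[OF prefix_free_lists[OF pf]]) (use eq in \<open>auto simp: enc_list_def\<close>)
  then show "x = y" by simp
qed

lemma finite_padded: "finite \<Gamma> \<Longrightarrow> finite (padded \<Gamma>)"
  by (simp add: padded_def)

lemma finite_tensor_power: "finite \<Gamma> \<Longrightarrow> finite (tensor_power \<Gamma> a)"
  using finite_lists_length_eq[OF finite_padded, of \<Gamma> a]
  by (simp add: tensor_power_def conj_commute)

lemma layers_finite:
  assumes "B \<in> layers \<Gamma> w" "finite \<Gamma>"
  shows "finite (lay_trans B)" "finite (lay_init B)" "finite (lay_final B)"
proof -
  have "lay_trans B \<subseteq> {..<w} \<times> padded \<Gamma> \<times> {..<w}" "lay_init B \<subseteq> {..<w}" "lay_final B \<subseteq> {..<w}"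
    using assms(1) by (auto simp: layers_def)
  then show "finite (lay_trans B)" "finite (lay_init B)" "finite (lay_final B)"
    using finite_padded[OF assms(2)] by (meson finite_SigmaI finite_lessThan finite_subset)+
qed

lemma rep_layer_trans:
  assumes "B \<in> layers \<Gamma> w" "finite \<Gamma>" "inj e"
  shows "p # enc_option e \<sigma> @ [q] \<in> set (layer_set (rep_layer e B) 2) \<longleftrightarrow> (p, \<sigma>, q) \<in> lay_trans B"
proof -
  have "set (layer_set (rep_layer e B) 2) = enc_triple enc_nat (enc_option e) enc_nat ` lay_trans B"
    using layers_finite[OF assms(1,2)] by (simp add: layer_set_def rep_layer_def set_code_list)
  moreover have "p # enc_option e \<sigma> @ [q] = enc_triple enc_nat (enc_option e) enc_nat x \<longleftrightarrow> x = (p, \<sigma>, q)" for x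
    using inj_enc_option[OF assms(3)] by (cases x) (auto simp: enc_triple_def enc_nat_def inj_eq)
  ultimately show ?thesis by (auto simp: image_iff)
qed

lemma rep_layer_init:
  assumes "B \<in> layers \<Gamma> w" "finite \<Gamma>"
  shows "set (concat (layer_set (rep_layer e B) 3)) = lay_init B"
  using layers_finite[OF assms] set_concat_code_list by (simp add: layer_set_def rep_layer_def del: set_concat)

lemma rep_layer_final:
  assumes "B \<in> layers \<Gamma> w" "finite \<Gamma>"
  shows "[q] \<in> set (layer_set (rep_layer e B) 4) \<longleftrightarrow> q \<in> lay_final B"
  using layers_finite[OF assms] by (auto simp: layer_set_def rep_layer_def set_code_list enc_nat_def)

definition run_to :: "'a layer list \<Rightarrow> (nat \<Rightarrow> 'a option) \<Rightarrow> nat \<Rightarrow> nat \<Rightarrow> bool" where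
  "run_to D \<sigma> j q \<longleftrightarrow> (\<exists>P Q. (\<forall>i\<le>j. (P i, \<sigma> i, Q i) \<in> lay_trans (D ! i)) \<and>
     (\<forall>i<j. P (Suc i) = Q i) \<and> P 0 \<in> lay_init (D ! 0) \<and> Q j = q)"

lemma run_to_0: "run_to D \<sigma> 0 q \<longleftrightarrow> (\<exists>p\<in>lay_init (D ! 0). (p, \<sigma> 0, q) \<in> lay_trans (D ! 0))"
  unfolding run_to_def by (auto intro: exI[of _ "\<lambda>_. _"])

lemma run_to_Suc:
  "run_to D \<sigma> (Suc j) q \<longleftrightarrow> (\<exists>p. run_to D \<sigma> j p \<and> (p, \<sigma> (Suc j), q) \<in> lay_trans (D ! Suc j))"
proof
  assume "run_to D \<sigma> (Suc j) q"
  then obtain P Q where *: "\<forall>i\<le>Suc j. (P i, \<sigma> i, Q i) \<in> lay_trans (D ! i)"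
    "\<forall>i<Suc j. P (Suc i) = Q i" "P 0 \<in> lay_init (D ! 0)" "Q (Suc j) = q"
    unfolding run_to_def by blast
  have "run_to D \<sigma> j (Q j)"
    unfolding run_to_def using * by (intro exI[of _ P] exI[of _ Q]) auto
  moreover have "(Q j, \<sigma> (Suc j), q) \<in> lay_trans (D ! Suc j)"
    using *(1)[rule_format, of "Suc j"] *(2,4) by auto
  ultimately show "\<exists>p. run_to D \<sigma> j p \<and> (p, \<sigma> (Suc j), q) \<in> lay_trans (D ! Suc j)" by blast
next
  assume "\<exists>p. run_to D \<sigma> j p \<and> (p, \<sigma> (Suc j), q) \<in> lay_trans (D ! Suc j)"
  then obtain p P Q where *: "\<forall>i\<le>j. (P i, \<sigma> i, Q i) \<in> lay_trans (D ! i)"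
    "\<forall>i<j. P (Suc i) = Q i" "P 0 \<in> lay_init (D ! 0)" "Q j = p"
    "(p, \<sigma> (Suc j), q) \<in> lay_trans (D ! Suc j)"
    unfolding run_to_def by blast
  then show "run_to D \<sigma> (Suc j) q"
    unfolding run_to_def
    by (intro exI[of _ "P(Suc j := p)"] exI[of _ "Q(Suc j := q)"]) (auto simp: le_Suc_eq less_Suc_eq)
qed

lemma reachable_run_to:
  assumes D: "D \<in> odds \<Gamma> w k" and fin: "finite \<Gamma>" "inj e" and len: "length u = k"
    and layer_at: "\<And>j. j < k \<Longrightarrow> layer_at (u ! j) i = rep_layer e (D ! j)" and j: "j < k"
  shows "q \<in> set (reachable w i (take (Suc j) u) (map (\<lambda>j. enc_option e (\<sigma> j)) [0..<Suc j])) \<longleftrightarrow> run_to D \<sigma> j q"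
  using j
proof (induction j arbitrary: q)
  case 0
  have B: "D ! 0 \<in> layers \<Gamma> w" using D 0 by (auto simp: odds_def)
  have "take (Suc 0) u = [] @ [u ! 0]" using 0 len by (cases u) auto
  then have "reachable w i (take (Suc 0) u) (map (\<lambda>j. enc_option e (\<sigma> j)) [0..<Suc 0]) =
      run_step w [] (rep_layer e (D ! 0)) (enc_option e (\<sigma> 0))"
    using layer_at[OF 0] by (simp add: reachable_def)
  moreover have "q < w" if "(p, \<sigma> 0, q) \<in> lay_trans (D ! 0)" for p
    using that B by (auto simp: layers_def)
  ultimately show ?case
    using rep_layer_init[OF B fin(1), of e] rep_layer_trans[OF B fin]
    by (auto simp: run_step_def run_to_0 simp del: set_concat)
next
  case (Suc j)
  have B: "D ! Suc j \<in> layers \<Gamma> w" using D Suc.prems by (auto simp: odds_def)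
  \<comment> \<open>Initial states belong to the first layer only, so those that
    \<open>run_step\<close> adds do not start a new run here.\<close>
  have "lay_init (D ! Suc j) = {}"
    using D Suc.prems B by (auto simp: odds_def layers_def)
  then have init: "set (concat (layer_set (rep_layer e (D ! Suc j)) 3)) = {}"
    using rep_layer_init[OF B fin(1), of e] by simp
  have "take (Suc (Suc j)) u = take (Suc j) u @ [u ! Suc j]"
    using Suc.prems len by (simp add: take_Suc_conv_app_nth)
  then have "reachable w i (take (Suc (Suc j)) u) (map (\<lambda>j. enc_option e (\<sigma> j)) [0..<Suc (Suc j)]) =
      run_step w (reachable w i (take (Suc j) u) (map (\<lambda>j. enc_option e (\<sigma> j)) [0..<Suc j]))
        (rep_layer e (D ! Suc j)) (enc_option e (\<sigma> (Suc j)))"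
    using reachable_snoc[of "map (\<lambda>j. enc_option e (\<sigma> j)) [0..<Suc j]" "take (Suc j) u" w i "u ! Suc j"]
      Suc.prems len layer_at[OF Suc.prems] by simp
  moreover have "q < w" if "(p, \<sigma> (Suc j), q) \<in> lay_trans (D ! Suc j)" for p
    using that B by (auto simp: layers_def)
  ultimately show ?case
    using Suc.IH Suc.prems init rep_layer_trans[OF B fin]
    by (auto simp: run_step_def run_to_Suc simp del: set_concat upt_Suc)
qed

lemma run_accepts_reachable:
  assumes D: "D \<in> odds \<Gamma> w k" and fin: "finite \<Gamma>" "inj e" and len: "length u = k" "1 \<le> k"
    and layer_at: "\<And>j. j < k \<Longrightarrow> layer_at (u ! j) i = rep_layer e (D ! j)"
  shows "run_accepts i u (reachable w i u (map (\<lambda>j. enc_option e (\<sigma> j)) [0..<k])) \<longleftrightarrow>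
    (\<exists>P Q. (\<forall>i<k. (P i, \<sigma> i, Q i) \<in> lay_trans (D ! i)) \<and> (\<forall>i. Suc i < k \<longrightarrow> P (Suc i) = Q i) \<and>
      P 0 \<in> lay_init (D ! 0) \<and> Q (k - 1) \<in> lay_final (D ! (k - 1)))"
proof -
  obtain l where k: "k = Suc l" using len(2) by (cases k) auto
  have B: "D ! l \<in> layers \<Gamma> w" using D k by (auto simp: odds_def)
  have "run_accepts i u (reachable w i u (map (\<lambda>j. enc_option e (\<sigma> j)) [0..<k])) \<longleftrightarrow>
      (\<exists>q. run_to D \<sigma> l q \<and> q \<in> lay_final (D ! l))"
    using reachable_run_to[OF D fin len(1) layer_at, of l] k len(1) layer_at[of l] rep_layer_final[OF B fin(1), of _ e]
    by (auto simp: run_accepts_def simp del: upt_Suc)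
  also have "\<dots> \<longleftrightarrow> (\<exists>P Q. (\<forall>i<k. (P i, \<sigma> i, Q i) \<in> lay_trans (D ! i)) \<and>
      (\<forall>i. Suc i < k \<longrightarrow> P (Suc i) = Q i) \<and>
      P 0 \<in> lay_init (D ! 0) \<and> Q (k - 1) \<in> lay_final (D ! (k - 1)))"
    unfolding run_to_def k Suc_less_eq less_Suc_eq_le diff_Suc_1
  proof ((intro iffI; elim exE conjE), goal_cases)
    case (1 q P Q)
    then show ?case by (intro exI[of _ P] exI[of _ Q]) simp
  next
    case (2 P Q)
    then show ?case by (intro exI[of _ "Q l"] conjI exI[of _ P] exI[of _ Q]) simp_all
  qed
  finally show ?thesis .
qed

lemma pad_token_pad: "pad_token s j = enc_option enc_nat (pad s j)"
  by (simp add: pad_token_def pad_def enc_nat_def)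

lemma tuple_token_pad:
  assumes "ss \<noteq> []"
  shows "tuple_token (map (\<lambda>s. pad_token s j) ss) = enc_option enc_tup (pad (tensor ss) j)"
proof -
  have "j < Max (length ` set ss) \<longleftrightarrow> (\<exists>s\<in>set ss. j < length s)"
    using assms by (subst Max_gr_iff) auto
  moreover have "(\<exists>t\<in>set (map (\<lambda>s. pad_token s j) ss). t \<noteq> [0]) \<longleftrightarrow> (\<exists>s\<in>set ss. j < length s)"
    by (auto simp: pad_token_def)
  moreover have "pad (tensor ss) j =
      (if j < Max (length ` set ss) then Some (map (\<lambda>u. pad u j) ss) else None)"
    unfolding pad_def[of "tensor ss"] by (simp add: tensor_def)
  ultimately show ?thesis
    by (simp add: tuple_token_def enc_list_def comp_def pad_token_pad)
qed

section \<open>Truth in the derived structure\<close>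

locale structural_word =
  fixes \<Sigma>s :: "nat list" and w :: nat and \<tau> :: "nat list" and k :: nat
    and D0 :: "nat layer list" and Ds :: "nat option list layer list list" and u :: "symrep list"
  assumes D0: "D0 \<in> odds (set \<Sigma>s) w k" and k: "1 \<le> k"
    and lenDs: "length Ds = length \<tau>"
    and Ds: "\<And>i. i < length \<tau> \<Longrightarrow> Ds ! i \<in> odds (tensor_power (set \<Sigma>s) (\<tau> ! i)) w k"
    and voc: "vocabulary \<tau>"
    and u: "u = map rep_sym (odd_tensor (D0, Ds))"
begin

lemma length_D: "length D0 = k" "i < length \<tau> \<Longrightarrow> length (Ds ! i) = k"
  using D0 Ds by (auto simp: odds_def)

lemma length_u: "length u = k"
proof -
  have "length D = k" if "D \<in> set Ds" for D
    using that length_D lenDs by (auto simp: in_set_conv_nth)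
  then have eq: "insert (length D0) (length ` set Ds) = {k}"
    using length_D(1) by auto
  have "Max (insert (length D0) (length ` set Ds)) = k"
    by (subst eq) simp
  then show ?thesis by (simp add: u)
qed

lemma u_nth:
  assumes "j < k"
  shows "u ! j = rep_sym (Some (D0 ! j), map (\<lambda>D. Some (D ! j)) Ds)"
proof -
  have "odd_tensor (D0, Ds) ! j = (pad D0 j, map (\<lambda>D. pad D j) Ds)"
    using assms length_u by (simp add: u)
  moreover have "map (\<lambda>D. pad D j) Ds = map (\<lambda>D. Some (D ! j)) Ds"
  proof (rule map_cong[OF refl])
    fix D assume "D \<in> set Ds"
    then show "pad D j = Some (D ! j)"
      using assms length_D lenDs by (auto simp: in_set_conv_nth pad_def)
  qed
  moreover have "pad D0 j = Some (D0 ! j)"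
    using assms length_D by (simp add: pad_def)
  moreover have "j < length (odd_tensor (D0, Ds))"
    using assms length_u unfolding u length_map by argo
  ultimately show ?thesis
    unfolding u by (simp only: nth_map)
qed

lemma layer_at_u:
  assumes "j < k"
  shows "layer_at (u ! j) 0 = rep_layer enc_nat (D0 ! j)"
    "i < length \<tau> \<Longrightarrow> layer_at (u ! j) (Suc i) = rep_layer enc_tup (Ds ! i ! j)"
  using assms lenDs by (simp_all add: u_nth layer_at_def rep_sym_def rep_opt_def)

text \<open>The transitions of a layer carry only letters of its alphabet, and accepted strings are
  no longer than the diagram. Quantifying over \<open>strings\<close> therefore misses no element of
  the domain.\<close>

lemma odd_lang_over:
  assumes "s \<in> odd_lang D0"
  shows "s \<in> set (strings \<Sigma>s k)"
proof -
  obtain P Q where *: "\<forall>i<k. (P i, pad s i, Q i) \<in> lay_trans (D0 ! i)" "length s \<le> k"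
    using assms length_D(1) unfolding odd_lang_def by auto
  have "s ! i \<in> set \<Sigma>s" if "i < length s" for i
  proof -
    have "D0 ! i \<in> layers (set \<Sigma>s) w" using D0 that *(2) by (auto simp: odds_def)
    then have "pad s i \<in> padded (set \<Sigma>s)"
      using *(1)[rule_format, of i] *(2) that by (auto simp: layers_def)
    then show ?thesis using that by (auto simp: pad_def padded_def)
  qed
  then show ?thesis using *(2) by (auto simp: set_strings in_set_conv_nth)
qed

lemma dom_accepts_iff:
  assumes "length s \<le> k"
  shows "dom_accepts w u s \<longleftrightarrow> s \<in> odd_lang D0"
proof -
  have "pad_tokens s k = map (\<lambda>j. enc_option enc_nat (pad s j)) [0..<k]"
    by (simp add: pad_tokens_def pad_token_pad)
  then show ?thesis
    using run_accepts_reachable[OF D0 finite_set inj_enc_nat length_u k layer_at_u(1), of "pad s"] assms length_u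
    by (auto simp: dom_accepts_def odd_lang_def length_D(1))
qed

lemma rel_iff:
  assumes "i < length \<tau>" "length ss = \<tau> ! i" "\<forall>s\<in>set ss. s \<in> odd_lang D0"
  shows "run_accepts (Suc i) u (reachable w (Suc i) u (tuple_tokens ss (length u))) \<longleftrightarrow>
    ss \<in> rel_of (\<tau> ! i) (odd_lang (Ds ! i))"
proof -
  have "1 \<le> \<tau> ! i" using voc nth_mem[OF assms(1)] unfolding vocabulary_def by blast
  then have ne: "ss \<noteq> []" using assms(2) by auto
  have nn: "\<forall>s\<in>set ss. s \<noteq> []" and le: "\<forall>s\<in>set ss. length s \<le> k"
    using assms(3) length_D(1) by (auto simp: odd_lang_def)
  have len: "length (tensor ss) \<le> k" "tensor ss \<noteq> []"
  proof -
    show "length (tensor ss) \<le> k" using ne le by (simp add: tensor_def)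
    have "0 < Max (length ` set ss)"
      using ne nn by (subst Max_gr_iff) (auto simp: neq_Nil_conv)
    then show "tensor ss \<noteq> []" by (simp add: tensor_def)
  qed
  have "tuple_tokens ss (length u) = map (\<lambda>j. enc_option enc_tup (pad (tensor ss) j)) [0..<k]"
    using tuple_token_pad[OF ne] by (simp add: tuple_tokens_def length_u)
  then show ?thesis
    using run_accepts_reachable[OF Ds[OF assms(1)] finite_tensor_power[OF finite_set] inj_enc_tup length_u k
        layer_at_u(2)[OF _ assms(1)], of "pad (tensor ss)"] assms nn len length_D(2)[OF assms(1)]
    by (auto simp: rel_of_def odd_lang_def)
qed

text \<open>Strings outside the domain are considered by quantifiers but discarded by the flag in
  \<open>dom_state\<close>. The environment must lie in the domain only on free variables, so the
  empty strings of the initial environment are admissible; it must be long enough for every bound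
  variable, because an update beyond its end would be lost.\<close>

lemma fo_state_sat:
  assumes "fo_over \<tau> \<phi>" "\<And>x. x \<in> fo_vars \<phi> \<Longrightarrow> x < length E"
    "\<And>x. x \<in> fo_free \<phi> \<Longrightarrow> nthd [] E x \<in> odd_lang D0"
  shows "snd (fo_state w \<Sigma>s u \<phi> E) \<noteq> 0 \<longleftrightarrow> fo_sat (derived \<tau> (D0, Ds)) (nthd [] E) \<phi>"
  using assms
proof (induction \<phi> arbitrary: E)
  case (Rel i xs)
  then show ?case
    using rel_iff[of i "map (nthd [] E) xs"] by (simp add: val_rel_def Let_def)
next
  case (Eq x y)
  then show ?case by (simp add: val_eq_def)
next
  case (Neg \<phi>)
  have "snd (fo_state w \<Sigma>s u \<phi> E) \<noteq> 0 \<longleftrightarrow> fo_sat (derived \<tau> (D0, Ds)) (nthd [] E) \<phi>"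
    by (rule Neg.IH) (use Neg.prems in auto)
  then show ?case by (auto simp: val_neg_def)
next
  case (Conj \<phi> \<psi>)
  have "snd (fo_state w \<Sigma>s u \<phi> E) \<noteq> 0 \<longleftrightarrow> fo_sat (derived \<tau> (D0, Ds)) (nthd [] E) \<phi>"
    by (rule Conj.IH) (use Conj.prems in auto)
  moreover have "snd (fo_state w \<Sigma>s u \<psi> E) \<noteq> 0 \<longleftrightarrow> fo_sat (derived \<tau> (D0, Ds)) (nthd [] E) \<psi>"
    by (rule Conj.IH) (use Conj.prems in auto)
  ultimately show ?case by (auto simp: val_bin_def)
next
  case (Disj \<phi> \<psi>)
  have "snd (fo_state w \<Sigma>s u \<phi> E) \<noteq> 0 \<longleftrightarrow> fo_sat (derived \<tau> (D0, Ds)) (nthd [] E) \<phi>"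
    by (rule Disj.IH) (use Disj.prems in auto)
  moreover have "snd (fo_state w \<Sigma>s u \<psi> E) \<noteq> 0 \<longleftrightarrow> fo_sat (derived \<tau> (D0, Ds)) (nthd [] E) \<psi>"
    by (rule Disj.IH) (use Disj.prems in auto)
  ultimately show ?case by (auto simp: val_bin_def)
next
  case (Ex x \<phi>)
  have upd: "nthd [] (upd E x s) = (nthd [] E)(x := s)" for s
    using Ex.prems(2)[of x] by (auto simp: upd_list_update fun_eq_iff nthd_def hd_drop_conv_nth)
  have "snd (fo_state w \<Sigma>s u \<phi> (upd E x s)) \<noteq> 0 \<longleftrightarrow>
      fo_sat (derived \<tau> (D0, Ds)) (nthd [] (upd E x s)) \<phi>" if "s \<in> odd_lang D0" for s
    by (rule Ex.IH) (use Ex.prems that in \<open>auto simp: upd\<close>)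
  moreover have "snd (snd (snd (dom_state w u s))) \<noteq> 0 \<longleftrightarrow> s \<in> odd_lang D0" if "s \<in> set (strings \<Sigma>s k)" for s
    using that dom_accepts_iff[of s] by (simp add: dom_state_def set_strings)
  ultimately show ?case
    using odd_lang_over by (auto simp: val_q_def length_u upd)
next
  case (All x \<phi>)
  have upd: "nthd [] (upd E x s) = (nthd [] E)(x := s)" for s
    using All.prems(2)[of x] by (auto simp: upd_list_update fun_eq_iff nthd_def hd_drop_conv_nth)
  have "snd (fo_state w \<Sigma>s u \<phi> (upd E x s)) \<noteq> 0 \<longleftrightarrow>
      fo_sat (derived \<tau> (D0, Ds)) (nthd [] (upd E x s)) \<phi>" if "s \<in> odd_lang D0" for s
    by (rule All.IH) (use All.prems that in \<open>auto simp: upd\<close>)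
  moreover have "snd (snd (snd (dom_state w u s))) \<noteq> 0 \<longleftrightarrow> s \<in> odd_lang D0" if "s \<in> set (strings \<Sigma>s k)" for s
    using that dom_accepts_iff[of s] by (simp add: dom_state_def set_strings)
  ultimately show ?case
    using odd_lang_over by (auto simp: val_q_def length_u upd)
qed

lemma finite_odd_lang: "finite (odd_lang D0)"
  using odd_lang_over finite_subset[of "odd_lang D0" "set (strings \<Sigma>s k)"] by blast

end

section \<open>Isomorphic structures and representing automata\<close>

lemma fo_sat_iso:
  assumes bij: "bij_betw h (str_dom S) (str_dom S')"
    and rel: "\<And>i t. i < length \<tau> \<Longrightarrow> length t = \<tau> ! i \<Longrightarrow> set t \<subseteq> str_dom S \<Longrightarrow>
      t \<in> str_rel S ! i \<longleftrightarrow> map h t \<in> str_rel S' ! i"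
    and "fo_over \<tau> \<phi>" "\<And>x. x \<in> fo_free \<phi> \<Longrightarrow> e x \<in> str_dom S \<and> e' x = h (e x)"
  shows "fo_sat S e \<phi> \<longleftrightarrow> fo_sat S' e' \<phi>"
  using assms(3,4)
proof (induction \<phi> arbitrary: e e')
  case (Rel i xs)
  then have "map e xs \<in> str_rel S ! i \<longleftrightarrow> map h (map e xs) \<in> str_rel S' ! i"
    by (intro rel) auto
  moreover have "map h (map e xs) = map e' xs" using Rel by auto
  ultimately show ?case by (simp only: fo_sat.simps)
next
  case (Eq x y)
  then have "e x \<in> str_dom S" "e y \<in> str_dom S" "e' x = h (e x)" "e' y = h (e y)" by auto
  then show ?case using bij by (auto simp: bij_betw_def inj_on_eq_iff)
next
  case (Neg \<phi>)
  have "fo_sat S e \<phi> \<longleftrightarrow> fo_sat S' e' \<phi>" by (rule Neg.IH) (use Neg.prems in auto)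
  then show ?case by simp
next
  case (Conj \<phi> \<psi>)
  have "fo_sat S e \<phi> \<longleftrightarrow> fo_sat S' e' \<phi>" "fo_sat S e \<psi> \<longleftrightarrow> fo_sat S' e' \<psi>"
    by (rule Conj.IH; use Conj.prems in auto)+
  then show ?case by simp
next
  case (Disj \<phi> \<psi>)
  have "fo_sat S e \<phi> \<longleftrightarrow> fo_sat S' e' \<phi>" "fo_sat S e \<psi> \<longleftrightarrow> fo_sat S' e' \<psi>"
    by (rule Disj.IH; use Disj.prems in auto)+
  then show ?case by simp
next
  case (Ex x \<phi>)
  have "fo_sat S (e(x := d)) \<phi> \<longleftrightarrow> fo_sat S' (e'(x := h d)) \<phi>" if "d \<in> str_dom S" for d
    by (rule Ex.IH) (use Ex.prems that in auto)
  moreover have "str_dom S' = h ` str_dom S" using bij by (simp add: bij_betw_def)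
  ultimately show ?case by simp
next
  case (All x \<phi>)
  have "fo_sat S (e(x := d)) \<phi> \<longleftrightarrow> fo_sat S' (e'(x := h d)) \<phi>" if "d \<in> str_dom S" for d
    by (rule All.IH) (use All.prems that in auto)
  moreover have "str_dom S' = h ` str_dom S" using bij by (simp add: bij_betw_def)
  ultimately show ?case by simp
qed

lemma struc_iso_models:
  assumes "struc_iso \<tau> S S'" "fo_sentence \<tau> \<phi>"
  shows "fo_models S \<phi> \<longleftrightarrow> fo_sat S' e \<phi>"
proof -
  obtain h where h: "bij_betw h (str_dom S) (str_dom S')"
    "\<And>i t. i < length \<tau> \<Longrightarrow> length t = \<tau> ! i \<Longrightarrow> set t \<subseteq> str_dom S \<Longrightarrow>
      t \<in> str_rel S ! i \<longleftrightarrow> map h t \<in> str_rel S' ! i"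
    using assms(1) unfolding struc_iso_def by metis
  have "fo_sat S e' \<phi> \<longleftrightarrow> fo_sat S' e \<phi>" for e'
    by (rule fo_sat_iso[OF h]) (use assms(2) in \<open>auto simp: fo_sentence_def\<close>)
  then show ?thesis by (simp add: fo_models_def)
qed

text \<open>Members of the class live in the type \<open>'u\<close>, whereas derived structures
  consist of strings. An infinite type contains a copy of every finite structure, so an accepted
  tuple always contributes a member to the class.\<close>

lemma iso_copy_exists:
  assumes "finite (str_dom S')"
  shows "\<exists>S :: 'u::infinite struc. is_struc \<tau> S \<and> struc_iso \<tau> S S'"
proof -
  obtain B :: "'u set" where B: "finite B" "card B = card (str_dom S')"
    using infinite_arbitrarily_large[OF infinite_UNIV] by blast
  then obtain h where h: "bij_betw h B (str_dom S')"
    using finite_same_card_bij[OF B(1) assms] by blast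
  let ?S = "\<lparr>str_dom = B, str_rel = map (\<lambda>i. {t. length t = \<tau> ! i \<and> set t \<subseteq> B \<and>
    map h t \<in> str_rel S' ! i}) [0..<length \<tau>]\<rparr>"
  have "is_struc \<tau> ?S" by (auto simp: is_struc_def)
  moreover have "struc_iso \<tau> ?S S'" unfolding struc_iso_def using h by auto
  ultimately show ?thesis by blast
qed

lemma type_accepts_structural:
  assumes par: "parameters \<Sigma> w \<tau> \<phi>" "is_par \<Sigma> w \<tau> \<phi> P" and D: "D \<in> structural \<Sigma> w \<tau>"
  shows "type_accepts P (foldl (type_step P) 0 (map rep_sym (odd_tensor D))) \<longleftrightarrow> fo_sat (derived \<tau> D) e \<phi>"
    and "finite (str_dom (derived \<tau> D))"
proof -
  obtain \<Sigma>s p where P: "P = (\<Sigma>s, w, \<tau>, p)" "set \<Sigma>s = \<Sigma>" "formula_run p = [\<phi>]"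
    using par(2) by (auto simp: is_par_def)
  obtain D0 Ds where D_eq: "D = (D0, Ds)" by (cases D)
  from D have *: "length Ds = length \<tau> \<and> (\<exists>k\<ge>1. D0 \<in> odds \<Sigma> w k \<and>
      (\<forall>i<length \<tau>. Ds ! i \<in> odds (tensor_power \<Sigma> (\<tau> ! i)) w k \<and>
      odd_lang (Ds ! i) \<subseteq> lang_power (odd_lang D0) (\<tau> ! i)))"
    unfolding D_eq structural_def mem_Collect_eq case_prod_conv .
  note len = conjunct1[OF *]
  from conjunct2[OF *] obtain k where kk: "1 \<le> k \<and> D0 \<in> odds \<Sigma> w k \<and>
      (\<forall>i<length \<tau>. Ds ! i \<in> odds (tensor_power \<Sigma> (\<tau> ! i)) w k \<and>
      odd_lang (Ds ! i) \<subseteq> lang_power (odd_lang D0) (\<tau> ! i))" ..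
  have k: "1 \<le> k" "D0 \<in> odds \<Sigma> w k"
    "\<And>i. i < length \<tau> \<Longrightarrow> Ds ! i \<in> odds (tensor_power \<Sigma> (\<tau> ! i)) w k"
    using kk by simp_all
  define u where "u = map rep_sym (odd_tensor (D0, Ds))"
  interpret structural_word \<Sigma>s w \<tau> k D0 Ds u
  proof
    show "vocabulary \<tau>" using par(1) by (simp add: parameters_def)
  qed (use len k P(2) u_def in \<open>simp_all del: odd_tensor.simps\<close>)
  have good: "good x" if x: "x \<in> set u" for x
  proof -
    obtain j where "j < k" "x = u ! j"
      using x length_u by (auto simp: in_set_conv_nth)
    then have "x = rep_sym (Some (D0 ! j), map (\<lambda>D. Some (D ! j)) Ds)" using u_nth by simp
    then show ?thesis by (auto simp: good_rep_sym)
  qed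
  have ne: "u \<noteq> []" using length_u k(1) by auto
  have ws: "word_state P u = fo_state w \<Sigma>s u \<phi> (empty_env (num_vars p))"
    unfolding P(1) word_state_eq P(3) by simp
  have sat: "snd (fo_state w \<Sigma>s u \<phi> (empty_env (num_vars p))) \<noteq> 0 \<longleftrightarrow>
      fo_sat (derived \<tau> (D0, Ds)) (nthd [] (empty_env (num_vars p))) \<phi>"
  proof (rule fo_state_sat)
    show "x < length (empty_env (num_vars p))" if "x \<in> fo_vars \<phi>" for x
      using fo_vars_less_num_vars[of \<phi> p x] that P(3) by (simp add: empty_env_def)
  qed (use par(1) in \<open>auto simp: parameters_def fo_sentence_def\<close>)
  \<comment> \<open>The identity is an isomorphism, and a sentence has no free variable on which the
    two assignments would have to correspond.\<close>
  have env: "fo_sat (derived \<tau> (D0, Ds)) e1 \<phi> \<longleftrightarrow> fo_sat (derived \<tau> (D0, Ds)) e2 \<phi>" for e1 e2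
    by (rule fo_sat_iso[where h = "\<lambda>x. x" and \<tau> = \<tau>])
      (use par(1) in \<open>auto simp: parameters_def fo_sentence_def bij_betw_def\<close>)
  have taut: "X \<Longrightarrow> Y \<Longrightarrow> (X \<and> Y \<and> Z \<longleftrightarrow> Z)" for X Y Z by simp
  show "type_accepts P (foldl (type_step P) 0 (map rep_sym (odd_tensor D))) \<longleftrightarrow> fo_sat (derived \<tau> D) e \<phi>"
    unfolding D_eq u_def[symmetric] type_accepts_foldl_type_step ws sat env[of "nthd [] (empty_env (num_vars p))" e]
    by (rule taut[OF ne]) (use good in blast)
  show "finite (str_dom (derived \<tau> D))" using finite_odd_lang D_eq by simp
qed

text \<open>A nonempty word without padding is the tensor product of its columns, all of the length
  of the word. An accepted word of accepting type thus comes from a tuple in the represented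
  relation.\<close>

lemma odd_tensor_surj:
  assumes "us \<noteq> []" "set us \<subseteq> odd_alphabet \<Sigma> w \<tau>" "\<And>x. x \<in> set us \<Longrightarrow> good (rep_sym x)"
    "us \<in> L"
  shows "\<exists>D\<in>odd_rel_of (length \<tau>) L. odd_tensor D = us"
proof -
  let ?D0 = "map (\<lambda>x. the (fst x)) us"
  let ?Ds = "map (\<lambda>i. map (\<lambda>x. the (snd x ! i)) us) [0..<length \<tau>]"
  have len: "insert (length ?D0) (length ` set ?Ds) = {length us}" by auto
  have "Max (insert (length ?D0) (length ` set ?Ds)) = length us"
    by (subst len) simp
  then have l0: "length (odd_tensor (?D0, ?Ds)) = length us" by (simp only: odd_tensor.simps length_map length_upt diff_zero)
  have n0: "odd_tensor (?D0, ?Ds) ! j = us ! j" if j: "j < length us" for j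
  proof -
    obtain b bs where x: "us ! j = (b, bs)" by (cases "us ! j")
    have "us ! j \<in> odd_alphabet \<Sigma> w \<tau>" using assms(2) j nth_mem by blast
    then have l: "length bs = length \<tau>" by (simp add: x odd_alphabet_def)
    have "b \<noteq> None" "None \<notin> set bs"
      using assms(3)[OF nth_mem[OF j]] by (simp_all add: good_rep_sym x)
    moreover have "map (\<lambda>i. Some (the (bs ! i))) [0..<length \<tau>] = bs"
      by (rule nth_equalityI) (use l \<open>None \<notin> set bs\<close> in \<open>auto simp: option.the_def[symmetric] in_set_conv_nth
          intro!: option.collapse[of "bs ! _"] dest: sym\<close>)
    moreover have "odd_tensor (?D0, ?Ds) ! j = (pad ?D0 j, map (\<lambda>D. pad D j) ?Ds)"
      using \<open>Max _ = length us\<close> j by (simp only: odd_tensor.simps nth_map length_upt nth_upt) simp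
    ultimately show ?thesis using j by (simp add: pad_def x comp_def)
  qed
  have eq: "odd_tensor (?D0, ?Ds) = us"
    by (rule nth_equalityI[OF l0]) (rule n0, simp only: l0)
  have "(?D0, ?Ds) \<in> odd_rel_of (length \<tau>) L"
    unfolding odd_rel_of_def using eq assms(1,4) by (simp del: odd_tensor.simps)
  then show ?thesis using eq by blast
qed

lemma nfa_lang_over:
  assumes "is_nfa \<Gamma> A" "us \<in> nfa_lang A"
  shows "set us \<subseteq> \<Gamma>"
proof
  fix x assume "x \<in> set us"
  then obtain i where "i < length us" "x = us ! i" by (auto simp: in_set_conv_nth)
  moreover obtain \<rho> where "\<forall>i<length us. (\<rho> i, us ! i, \<rho> (Suc i)) \<in> nfa_trans A"
    using assms(2) by (auto simp: nfa_lang_def)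
  ultimately show "x \<in> \<Gamma>" using assms(1) by (auto simp: is_nfa_def)
qed

theorem class_satisfiable_iff:
  fixes C :: "'u::infinite struc set"
  assumes par: "parameters \<Sigma> w \<tau> \<phi>" "is_par \<Sigma> w \<tau> \<phi> P" and rep: "represents \<Sigma> w \<tau> A C"
  shows "(\<exists>S\<in>C. fo_models S \<phi>) \<longleftrightarrow> (\<exists>us\<in>nfa_lang A. type_accepts P (foldl (type_step P) 0 (map rep_sym us)))"
proof
  have sen: "fo_sentence \<tau> \<phi>" using par(1) by (simp add: parameters_def)
  have nfa: "is_nfa (odd_alphabet \<Sigma> w \<tau>) A" and sub: "odd_rel_of (length \<tau>) (nfa_lang A) \<subseteq> structural \<Sigma> w \<tau>"
    and C: "C = struc_class \<tau> (odd_rel_of (length \<tau>) (nfa_lang A))"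
    using rep by (auto simp: represents_def)
  {
    assume "\<exists>S\<in>C. fo_models S \<phi>"
    then obtain S where "S \<in> C" and S1: "fo_models S \<phi>" by (elim bexE)
    then obtain D where S2: "D \<in> odd_rel_of (length \<tau>) (nfa_lang A)" "struc_iso \<tau> S (derived \<tau> D)"
      unfolding C struc_class_def mem_Collect_eq by (elim conjE bexE)
    note S = S1 S2
    have "odd_tensor D \<in> nfa_lang A" using S(2) by (auto simp: odd_rel_of_def simp del: odd_tensor.simps)
    moreover have "fo_sat (derived \<tau> D) undefined \<phi>"
      using struc_iso_models[OF S(3) sen] S(1) by blast
    ultimately show "\<exists>us\<in>nfa_lang A. type_accepts P (foldl (type_step P) 0 (map rep_sym us))"
      using type_accepts_structural(1)[OF par, of D] S(2) sub by blast
  }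
  {
    assume "\<exists>us\<in>nfa_lang A. type_accepts P (foldl (type_step P) 0 (map rep_sym us))"
    then obtain us where us: "us \<in> nfa_lang A" "type_accepts P (foldl (type_step P) 0 (map rep_sym us))" by blast
    then have "us \<noteq> []" "\<And>x. x \<in> set us \<Longrightarrow> good (rep_sym x)"
      by (auto simp: type_accepts_foldl_type_step)
    then obtain D where D: "D \<in> odd_rel_of (length \<tau>) (nfa_lang A)" "odd_tensor D = us"
      using odd_tensor_surj[OF _ nfa_lang_over[OF nfa us(1)] _ us(1)] by blast
    then have st: "D \<in> structural \<Sigma> w \<tau>" using sub by blast
    then obtain S :: "'u struc" where S: "is_struc \<tau> S" "struc_iso \<tau> S (derived \<tau> D)"
      using iso_copy_exists[OF type_accepts_structural(2)[OF par st], of \<tau>] by blast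
    have "fo_sat (derived \<tau> D) undefined \<phi>"
      using type_accepts_structural(1)[OF par st] us(2) D(2) by blast
    then have "fo_models S \<phi>" using struc_iso_models[OF S(2) sen] by blast
    then show "\<exists>S\<in>C. fo_models S \<phi>" unfolding C struc_class_def using S D(1) by blast
  }
qed

section \<open>The size of the alphabet and of the automaton\<close>

lemma finite_layers:
  assumes "finite \<Gamma>"
  shows "finite (layers \<Gamma> w)"
proof -
  let ?X = "Pow {..<w} \<times> Pow {..<w} \<times> Pow ({..<w} \<times> padded \<Gamma> \<times> {..<w}) \<times> Pow {..<w} \<times> Pow {..<w} \<times> (UNIV :: bool set) \<times> (UNIV :: bool set)"
  let ?f = "\<lambda>B. (lay_left B, lay_right B, lay_trans B, lay_init B, lay_final B, lay_isfirst B, lay_islast B)"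
  have "finite ?X"
    by (intro finite_cartesian_product finite_Pow_iff[THEN iffD2]) (simp_all add: finite_padded assms)
  moreover have "?f ` layers \<Gamma> w \<subseteq> ?X" by (fastforce simp: layers_def)
  ultimately have "finite (?f ` layers \<Gamma> w)" by (rule rev_finite_subset)
  moreover have "inj_on ?f (layers \<Gamma> w)" by (auto simp: inj_on_def intro: layer.equality)
  ultimately show ?thesis by (rule finite_imageD)
qed

lemma odd_alphabet_card:
  assumes "finite \<Sigma>"
  shows "finite (odd_alphabet \<Sigma> w \<tau>)" "2 \<le> card (odd_alphabet \<Sigma> w \<tau>)"
proof -
  let ?U = "\<Union>i<length \<tau>. padded (layers (tensor_power \<Sigma> (\<tau> ! i)) w)"
  have "finite (padded (layers \<Sigma> w) \<times> {bs. set bs \<subseteq> ?U \<and> length bs = length \<tau>})"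
    by (intro finite_cartesian_product finite_lists_length_eq)
      (auto intro!: finite_padded finite_layers finite_tensor_power assms)
  then show fin: "finite (odd_alphabet \<Sigma> w \<tau>)"
    by (rule rev_finite_subset) (fastforce simp: odd_alphabet_def in_set_conv_nth)
  let ?B = "\<lparr>lay_left = {}, lay_right = {}, lay_trans = {}, lay_init = {}, lay_final = {},
    lay_isfirst = True, lay_islast = True\<rparr>"
  have "{(None, map (\<lambda>_. None) \<tau>), (Some ?B, map (\<lambda>_. None) \<tau>)} \<subseteq> odd_alphabet \<Sigma> w \<tau>"
    by (auto simp: odd_alphabet_def padded_def layers_def)
  from card_mono[OF fin this] show "2 \<le> card (odd_alphabet \<Sigma> w \<tau>)" by simp
qed

text \<open>The alphabet has at least two symbols, so its binary logarithm is at least 1. A bound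
  linear in the number of states and transitions is then linear in the size.\<close>

lemma nfa_size_ge:
  assumes "finite \<Sigma>"
  shows "real (card (nfa_states A) + card (nfa_trans A)) \<le> nfa_size (odd_alphabet \<Sigma> w \<tau>) A"
proof -
  have "1 \<le> log 2 (real (card (odd_alphabet \<Sigma> w \<tau>)))"
    using odd_alphabet_card(2)[OF assms, of w \<tau>] by (simp add: le_log_iff)
  then have "real (card (nfa_trans A)) * 1 \<le> real (card (nfa_trans A)) * log 2 (real (card (odd_alphabet \<Sigma> w \<tau>)))"
    by (rule mult_left_mono) simp
  then show ?thesis by (simp add: nfa_size_def)
qed

lemma cmp_mult [cmp]:
  assumes "cmp f" "cmp g"
  shows "cmp (\<lambda>x. f x * g x :: nat)"
proof -
  have *: "cmp (\<lambda>p :: nat \<times> nat. ((\<lambda>a. a + snd p) ^^ fst p) 0)"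
    by (intro cmp)
  have "((\<lambda>a. a + n) ^^ m) 0 = m * n" for m n :: nat
    by (induction m) auto
  with cmp2[OF *, OF assms] show ?thesis by simp
qed

section \<open>Programs for the search\<close>

text \<open>For the phases that read the automaton an upper bound suffices, since their cost enters
  only the final estimate.\<close>

lemma wp_While_le:
  assumes "I 0 s"
    and step: "\<And>i s. i < n \<Longrightarrow> I i s \<Longrightarrow> fst s x \<noteq> 0 \<and> wp c (\<lambda>t s'. t \<le> K \<and> I (Suc i) s') s"
    and stop: "\<And>s. I n s \<Longrightarrow> fst s x = (0::nat)"
  shows "wp (While x c) (\<lambda>t s'. t \<le> Suc (n * Suc K) \<and> I n s') s"
proof -
  have "wp (While x c) (\<lambda>t s'. t \<le> Suc ((n - i) * Suc K) \<and> I n s') s'" if "i \<le> n" "I i s'" for i s'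
    using that
  proof (induction i arbitrary: s' rule: inc_induct)
    case base
    then show ?case by (auto intro: wp_While_stop stop)
  next
    case (step i)
    have b: "wp c (\<lambda>t s''. t \<le> K \<and> I (Suc i) s'') s'" and nz: "fst s' x \<noteq> 0"
      using assms(2) step.hyps step.prems by auto
    have "n - i = Suc (n - Suc i)" using step.hyps by simp
    then have e: "(n - i) * Suc K = Suc K + (n - Suc i) * Suc K" by simp
    show ?case
    proof (rule wp_While_step[OF nz], rule wp_mono[OF b])
      fix t s'' assume *: "t \<le> K \<and> I (Suc i) s''"
      then have "wp (While x c) (\<lambda>t s'. t \<le> Suc ((n - Suc i) * Suc K) \<and> I n s') s''"
        using step.IH by blast
      then show "wp (While x c) (\<lambda>t' s'. Suc (t + t') \<le> Suc ((n - i) * Suc K) \<and> I n s') s''"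
        by (rule wp_mono) (use * e in linarith)
    qed
  qed
  from this[of 0 s] show ?thesis using assms(1) by simp
qed

text \<open>Amortized accounting: the ghost value \<open>k\<close> is a credit that pays in advance
  for each iteration, including its test. The number of iterations need not be known.\<close>

lemma wp_While_ghost:
  assumes "I k s"
    and step: "\<And>k s. I k s \<Longrightarrow> fst s x \<noteq> 0 \<Longrightarrow> wp c (\<lambda>t s'. \<exists>k'. I k' s' \<and> Suc t + k' \<le> k) s"
  shows "wp (While x c) (\<lambda>t s'. (\<exists>k'. I k' s') \<and> fst s' x = 0 \<and> t \<le> Suc k) s"
  using \<open>I k s\<close>
proof (induction k arbitrary: s rule: less_induct)
  case (less k)
  show ?case
  proof (cases "fst s x = 0")
    case True
    then show ?thesis using less.prems by (auto intro: wp_While_stop)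
  next
    case False
    show ?thesis
    proof (rule wp_While_step[OF False], rule wp_mono[OF step[OF less.prems False]])
      fix t s' assume "\<exists>k'. I k' s' \<and> Suc t + k' \<le> k"
      then obtain k' where *: "I k' s'" "Suc t + k' \<le> k" by blast
      then have "wp (While x c) (\<lambda>t s''. (\<exists>k'. I k' s'') \<and> fst s'' x = 0 \<and> t \<le> Suc k') s'"
        by (intro less.IH) auto
      then show "wp (While x c) (\<lambda>t' s'. (\<exists>k'. I k' s') \<and> fst s' x = 0 \<and> Suc (t + t') \<le> Suc k) s'"
        by (rule wp_mono) (use *(2) in auto)
    qed
  qed
qed

text \<open>The calling convention: registers below 30 belong to the main program and survive a
  call, and several arguments are paired into the single argument of the subprogram.\<close>

definition call1 :: "com \<Rightarrow> nat \<Rightarrow> nat \<Rightarrow> com" where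
  "call1 c d a = Seq (mov 30 a) (Seq c (mov d 30))"

definition call2 :: "com \<Rightarrow> nat \<Rightarrow> nat \<Rightarrow> nat \<Rightarrow> com" where
  "call2 c d a b = Seq (mov 30 a) (Seq (mov 31 b) (Seq (pairing 30 31) (Seq c (mov d 30))))"

definition call3 :: "com \<Rightarrow> nat \<Rightarrow> nat \<Rightarrow> nat \<Rightarrow> nat \<Rightarrow> com" where
  "call3 c d a b e = Seq (mov 30 a) (Seq (mov 31 b) (Seq (mov 32 e)
     (Seq (pairing 31 32) (Seq (pairing 30 31) (Seq c (mov d 30))))))"

definition call1_time :: "(nat \<Rightarrow> nat) \<Rightarrow> nat \<Rightarrow> nat" where
  "call1_time T x = 4 + T x"

definition call2_time :: "(nat \<Rightarrow> nat) \<Rightarrow> nat \<Rightarrow> nat \<Rightarrow> nat" where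
  "call2_time T x y = 9 + 3 * (x + y) + T (prod_encode (x, y))"

definition call3_time :: "(nat \<Rightarrow> nat) \<Rightarrow> nat \<Rightarrow> nat \<Rightarrow> nat \<Rightarrow> nat" where
  "call3_time T x y z = 14 + 3 * (y + z) + 3 * (x + prod_encode (y, z)) + T (prod_encode (x, prod_encode (y, z)))"

lemma wp_call1:
  assumes "impl c 30 f T" "d < 30" "a < 30"
    and "\<And>r'. (\<And>j. j < 30 \<Longrightarrow> r' j = (r(d := f (r a))) j) \<Longrightarrow> Q (call1_time T (r a)) (r', m)"
  shows "wp (call1 c d a) Q (r, m)"
  unfolding call1_def using assms(2,3)
  apply simp
  apply (rule wp_impl[OF assms(1)])
  apply simp
  subgoal for r'
    using assms(4)[of "r'(d := f (r a))"] by (simp add: call1_time_def eval_nat_numeral)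
  done

lemma wp_call2:
  assumes "impl c 30 f T" "d < 30" "a < 30" "b < 30"
    and "\<And>r'. (\<And>j. j < 30 \<Longrightarrow> r' j = (r(d := f (prod_encode (r a, r b)))) j) \<Longrightarrow> Q (call2_time T (r a) (r b)) (r', m)"
  shows "wp (call2 c d a b) Q (r, m)"
  unfolding call2_def using assms(2-4)
  apply simp
  apply (rule wp_pairing)
   apply simp
  apply (rule wp_impl[OF assms(1)])
  apply simp
  subgoal for r1 r'
    using assms(5)[of "r'(d := f (prod_encode (r a, r b)))"] by (simp add: call2_time_def algebra_simps)
  done

lemma wp_call3:
  assumes "impl c 30 f T" "d < 30" "a < 30" "b < 30" "e < 30"
    and "\<And>r'. (\<And>j. j < 30 \<Longrightarrow> r' j = (r(d := f (prod_encode (r a, prod_encode (r b, r e))))) j) \<Longrightarrow>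
      Q (call3_time T (r a) (r b) (r e)) (r', m)"
  shows "wp (call3 c d a b e) Q (r, m)"
  unfolding call3_def using assms(2-5)
  apply simp
  apply (rule wp_pairing)
   apply simp
  apply (rule wp_pairing)
   apply simp
  apply (rule wp_impl[OF assms(1)])
  apply simp
  subgoal for r1 r2 r'
    using assms(6)[of "r'(d := f (prod_encode (r a, prod_encode (r b, r e))))"]
    by (simp add: call3_time_def algebra_simps)
  done

definition dist :: "nat \<Rightarrow> nat \<Rightarrow> nat" where
  "dist a b = (a - b) + (b - a)"

lemma dist_eq_0: "dist a b = 0 \<longleftrightarrow> a = b"
  by (auto simp: dist_def)

text \<open>The search for the parameters runs through all codes \<open>n\<close> until the tokens of the parameters coded by \<open>n\<close>
  agree with the beginning of the input. The programs \<open>cV\<close>, \<open>cL\<close>, \<open>cT\<close> compute whether \<open>n\<close> is not a valid code, the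
  number of its tokens, and its \<open>j\<close>-th token; \<open>cN\<close> computes the number of types. There is no early exit from
  the comparison, hence the running time is a function of \<open>n\<close>.\<close>

locale params_ram =
  fixes cV cL cT cN :: com and fV fL fT fN TV TL TT TN :: "nat \<Rightarrow> nat"
  assumes V: "impl cV 30 fV TV" and L: "impl cL 30 fL TL" and T: "impl cT 30 fT TT"
    and N: "impl cN 30 fN TN"
begin

definition body :: com where
  "body = Seq (call1 cV 3 2) (Seq (call1 cL 5 2) (Seq (Const 4 0) (While 5
     (Seq (call2 cT 6 2 4) (Seq (Load 7 0 4) (Seq (Sub 19 6 7) (Seq (Add 3 3 19) (Seq (Sub 19 7 6)
     (Seq (Add 3 3 19) (Seq (Add 4 4 21) (Sub 5 5 21)))))))))))"

definition search :: com where
  "search = Seq (Const 21 1) (Seq (Const 2 0) (Seq body (While 3 (Seq (Add 2 2 21) body))))"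

text \<open>The sum vanishes exactly when \<open>n\<close> is valid and all its tokens agree with
  the input. Adding both truncated differences avoids branches, whose cost could depend on the
  input.\<close>

definition diff :: "(nat \<Rightarrow> nat) \<Rightarrow> nat \<Rightarrow> nat" where
  "diff M n = fV n + (\<Sum>j<fL n. dist (fT (prod_encode (n, j))) (M j))"

definition body_time :: "nat \<Rightarrow> nat" where
  "body_time n = call1_time TV n + (call1_time TL n + (1 + Suc (\<Sum>j<fL n. Suc (call2_time TT n j + 7))))"

text \<open>The time depends on the final code \<open>n\<close> but not on the contents of the bank,
  and can therefore be included in a constant that is a function of the parameters.\<close>

definition search_time :: "nat \<Rightarrow> nat" where
  "search_time n = 2 + body_time 0 + Suc (\<Sum>i<n. Suc (1 + body_time (Suc i)))"

lemma wp_body: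
  assumes "r 21 = 1"
  shows "wp body (\<lambda>t s. t = body_time (r 2) \<and> snd s = m \<and> fst s 21 = 1 \<and> fst s 2 = r 2 \<and>
    fst s 3 = diff (m 0) (r 2) \<and> fst s 4 = fL (r 2) \<and> fst s 0 = r 0) (r, m)"
proof -
  let ?n = "r 2"
  let ?I = "\<lambda>i s. snd s = m \<and> fst s 21 = 1 \<and> fst s 2 = ?n \<and> fst s 0 = r 0 \<and> fst s 5 = fL ?n - i \<and>
    fst s 4 = i \<and> fst s 3 = fV ?n + (\<Sum>j<i. dist (fT (prod_encode (?n, j))) (m 0 j))"
  let ?B = "Seq (call2 cT 6 2 4) (Seq (Load 7 0 4) (Seq (Sub 19 6 7) (Seq (Add 3 3 19) (Seq (Sub 19 7 6)
     (Seq (Add 3 3 19) (Seq (Add 4 4 21) (Sub 5 5 21)))))))"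
  have loop: "wp (While 5 ?B)
    (\<lambda>t s. t = Suc (\<Sum>j<fL ?n. Suc (call2_time TT ?n j + 7)) \<and> ?I (fL ?n) s) s" if "?I 0 s" for s
  proof (rule wp_While_count[where I = ?I])
    fix i and s :: store
    assume i: "i < fL ?n" and I: "?I i s"
    obtain r1 m1 where s: "s = (r1, m1)" by force
    have "wp ?B (\<lambda>t s'. t = call2_time TT ?n i + 7 \<and> ?I (Suc i) s') s"
      unfolding s wp_Seq
      by (rule wp_call2[OF T]) (use I s i in \<open>simp_all add: dist_def\<close>)
    then show "fst s 5 \<noteq> 0 \<and> wp ?B (\<lambda>t s'. t = call2_time TT ?n i + 7 \<and> ?I (Suc i) s') s"
      using I i by simp
  qed (use that in auto)
  show ?thesis
    unfolding body_def wp_Seq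
    apply (rule wp_call1[OF V]; simp)
    apply (rule wp_call1[OF L]; simp)
    apply (rule wp_mono, rule loop)
    using assms by (auto simp: diff_def body_time_def)
qed

lemma wp_search:
  assumes n: "diff (m 0) n = 0" "\<And>i. i < n \<Longrightarrow> diff (m 0) i \<noteq> 0"
  shows "wp search (\<lambda>t s. t = search_time n \<and> snd s = m \<and> fst s 21 = 1 \<and> fst s 2 = n \<and>
    fst s 4 = fL n \<and> fst s 0 = r 0) (r, m)"
proof -
  let ?I = "\<lambda>i s. snd s = m \<and> fst s 21 = 1 \<and> fst s 2 = i \<and> fst s 3 = diff (m 0) i \<and>
    fst s 4 = fL i \<and> fst s 0 = r 0"
  have loop: "wp (While 3 (Seq (Add 2 2 21) body))
    (\<lambda>t s. t = Suc (\<Sum>i<n. Suc (1 + body_time (Suc i))) \<and> ?I n s) s" if "?I 0 s" for s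
  proof (rule wp_While_count[where I = ?I])
    fix i and s :: store
    assume i: "i < n" and I: "?I i s"
    obtain r1 m1 where s: "s = (r1, m1)" by force
    have "wp (Seq (Add 2 2 21) body) (\<lambda>t s'. t = 1 + body_time (Suc i) \<and> ?I (Suc i) s') s"
      unfolding s wp_Seq wp_Add
      by (rule wp_mono, rule wp_body) (use I s in auto)
    then show "fst s 3 \<noteq> 0 \<and> wp (Seq (Add 2 2 21) body) (\<lambda>t s'. t = 1 + body_time (Suc i) \<and> ?I (Suc i) s') s"
      using I n(2)[OF i] by simp
  qed (use that n in auto)
  show ?thesis
    unfolding search_def wp_Seq wp_Const
    apply (rule wp_mono, rule wp_body)
     apply simp
    apply (rule wp_mono, rule loop)
    by (auto simp: search_time_def)
qed

end

section \<open>Memory layout and linked lists\<close>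

definition stored :: "(nat \<Rightarrow> nat) \<Rightarrow> nat \<Rightarrow> nat list \<Rightarrow> bool" where
  "stored M p xs \<longleftrightarrow> (\<forall>i<length xs. M (p + i) = xs ! i)"

lemma stored_Nil [simp]: "stored M p []"
  by (simp add: stored_def)

lemma stored_Cons [simp]: "stored M p (x # xs) \<longleftrightarrow> M p = x \<and> stored M (Suc p) xs"
  by (auto simp: stored_def nth_Cons split: nat.splits)

lemma stored_append [simp]: "stored M p (xs @ ys) \<longleftrightarrow> stored M p xs \<and> stored M (p + length xs) ys"
  by (induction xs arbitrary: p) auto

lemma stored_nth: "stored M p xs \<Longrightarrow> i < length xs \<Longrightarrow> M (p + i) = xs ! i"
  by (simp add: stored_def)

lemma stored_concat:
  assumes "stored M p (concat (map f xs))" "i < length xs"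
  shows "stored M (p + length (concat (map f (take i xs)))) (f (xs ! i))"
proof -
  have "concat (map f xs) = concat (map f (take i xs)) @ f (xs ! i) @ concat (map f (drop (Suc i) xs))"
    using assms(2) by (subst id_take_nth_drop[of i xs]) simp_all
  then show ?thesis using assms(1) by simp
qed

fun linked :: "(nat \<Rightarrow> nat) \<Rightarrow> nat \<Rightarrow> nat list \<Rightarrow> bool" where
  "linked f h [] \<longleftrightarrow> h = 0"
| "linked f h (j # l) \<longleftrightarrow> h = j \<and> j \<noteq> 0 \<and> linked f (f j) l"

lemma linked_upd: "j \<notin> set l \<Longrightarrow> linked (f(j := v)) h l \<longleftrightarrow> linked f h l"
  by (induction l arbitrary: h) auto

type_synonym edge = "nat \<times> nat list \<times> nat"

definition edge_tokens :: "edge \<Rightarrow> nat list" where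
  "edge_tokens e = fst e # fst (snd e) @ [snd (snd e)]"

text \<open>The order is reversed because each transition that is read is put in front of the list
  of its source; \<open>Suc\<close> keeps 0 free as the end of a list.\<close>

definition edges :: "edge list \<Rightarrow> nat \<Rightarrow> nat \<Rightarrow> nat list" where
  "edges ts i p = rev (map Suc (filter (\<lambda>j. fst (ts ! j) = p) [0..<i]))"

lemma edges_0 [simp]: "edges ts 0 p = []"
  by (simp add: edges_def)

lemma edges_Suc: "edges ts (Suc i) p = (if fst (ts ! i) = p then Suc i # edges ts i p else edges ts i p)"
  by (simp add: edges_def)

lemma set_edges: "set (edges ts i p) = {Suc j | j. j < i \<and> fst (ts ! j) = p}"
  by (auto simp: edges_def)

text \<open>Register 2 holds the code of the parameters, 4 the input position, 8 the number of types, 15 the height of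
  the stack, 20 the result and 21 the constant 1. Bank 0 is the input. Transitions are numbered from 1:
  bank 2 gives the next transition with the same source, with 0 for none, bank 3 the first transition of a
  state, banks 4 and 5 the symbol and the target of a transition; bank 6 marks the visited pairs at the address given by
  the base address of the state (bank 10) plus the type; banks 7 and 8 are the stack; bank 9 marks final states.\<close>

definition read_states :: com where
  "read_states = Seq (Load 9 0 4) (Seq (Add 4 4 21) (Seq (Const 10 0) (While 9
     (Seq (Load 11 0 4) (Seq (Add 4 4 21) (Seq (Store 10 11 10) (Seq (Add 10 10 8) (Sub 9 9 21))))))))"

text \<open>Register 16 holds 0, the type of the empty word; every initial state is marked and
  pushed together with it. With type 0 the mark is placed at the base address itself.\<close>

definition read_init :: com where
  "read_init = Seq (Load 9 0 4) (Seq (Add 4 4 21) (Seq (Const 15 0) (Seq (Const 16 0) (While 9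
     (Seq (Load 11 0 4) (Seq (Add 4 4 21) (Seq (Load 18 10 11) (Seq (Store 6 18 21) (Seq (Store 7 15 11)
     (Seq (Store 8 15 16) (Seq (Add 15 15 21) (Sub 9 9 21))))))))))))"

definition read_final :: com where
  "read_final = Seq (Load 9 0 4) (Seq (Add 4 4 21) (While 9
     (Seq (Load 11 0 4) (Seq (Add 4 4 21) (Seq (Store 9 11 21) (Sub 9 9 21))))))"

text \<open>The program \<open>cC\<close> computes \<open>Suc\<close>; called on two registers it
  first pairs them, and the successor of a pair is the code of a nonempty list. It thus conses a
  token to the accumulator.\<close>

locale main_ram = params_ram +
  fixes cC cS cD cA :: com and fS fD fA TC TS TD TA :: "nat \<Rightarrow> nat"
  assumes C: "impl cC 30 Suc TC" and S: "impl cS 30 fS TS" and D: "impl cD 30 fD TD"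
    and A: "impl cA 30 fA TA"
begin

definition read_symbol :: com where
  "read_symbol = While 13 (Seq (Load 6 0 4) (Seq (Add 4 4 21) (Seq (call2 cC 12 6 12) (call2 cS 13 2 12))))"

definition store_edge :: com where
  "store_edge = Seq (Load 17 0 4) (Seq (Add 4 4 21) (Seq (Load 6 3 11) (Seq (Store 2 14 6)
     (Seq (Store 3 11 14) (Seq (Store 4 14 12) (Seq (Store 5 14 17) (Sub 9 9 21)))))))"

definition read_trans :: com where
  "read_trans = Seq (Load 9 0 4) (Seq (Add 4 4 21) (Seq (Const 14 0) (While 9
     (Seq (Add 14 14 21) (Seq (Load 11 0 4) (Seq (Add 4 4 21) (Seq (Const 12 0) (Seq (Const 13 1)
     (Seq read_symbol store_edge)))))))))"

definition edge_step :: com where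
  "edge_step = Seq (Load 12 4 14) (Seq (call3 cD 19 2 16 12) (Seq (Load 17 5 14) (Seq (Load 14 2 14)
     (Seq (Load 18 10 17) (Seq (Add 18 18 19) (Seq (Load 6 6 18) (If 6 (Const 6 0)
     (Seq (Store 6 18 21) (Seq (Store 7 15 17) (Seq (Store 8 15 19) (Add 15 15 21)))))))))))"

definition pop_step :: com where
  "pop_step = Seq (Sub 15 15 21) (Seq (Load 11 7 15) (Seq (Load 16 8 15) (Seq (Load 14 3 11)
     (Seq (Load 6 9 11) (If 6 (Seq (call2 cA 6 2 16) (Add 20 20 6)) (Const 6 0))))))"

text \<open>One flat loop that follows a pending edge, pops a pair or stops, instead of a loop over
  edges inside a loop over pairs. A single credit then accounts for the whole search.\<close>

definition explore :: com where
  "explore = Seq (Const 20 0) (Seq (Const 14 0) (Seq (Const 13 1)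
     (While 13 (If 14 edge_step (If 15 pop_step (Const 13 0))))))"

definition solve :: com where
  "solve = Seq search (Seq (call1 cN 8 2) (Seq read_states (Seq read_trans (Seq read_init
     (Seq read_final (Seq explore (mov 0 20)))))))"

end

text \<open>Here \<open>K\<close> bounds the tokens of a symbol, \<open>U\<close> the cost of a
  single call while symbols are read or the product is explored, and \<open>N\<close> the number of
  types. All three will be functions of the parameter code \<open>n\<close>, which makes the final
  factor independent of the automaton.\<close>

locale main_ram_input = main_ram +
  fixes n N U K :: nat and M :: "nat \<Rightarrow> nat" and qs :: "nat list" and ts :: "edge list"
    and ini fin :: "nat list"
  assumes qs: "distinct qs" and ini: "distinct ini" "set ini \<subseteq> set qs" and N0: "0 < N"
    and ts: "\<And>p tk q. (p, tk, q) \<in> set ts \<Longrightarrow> p \<in> set qs \<and> q \<in> set qs \<and> tk \<noteq> [] \<and> length tk \<le> K"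
    and complete: "\<And>p tk q i. (p, tk, q) \<in> set ts \<Longrightarrow> i < length tk \<Longrightarrow>
      fS (prod_encode (n, enc (rev (take (Suc i) tk)))) \<noteq> 0 \<longleftrightarrow> Suc i < length tk"
    and bound_C: "\<And>p tk q i. (p, tk, q) \<in> set ts \<Longrightarrow> i < length tk \<Longrightarrow>
      call2_time TC (tk ! i) (enc (rev (take i tk))) \<le> U"
    and bound_S: "\<And>p tk q i. (p, tk, q) \<in> set ts \<Longrightarrow> i < length tk \<Longrightarrow>
      call2_time TS n (enc (rev (take (Suc i) tk))) \<le> U"
    and bound_D: "\<And>p tk q t. (p, tk, q) \<in> set ts \<Longrightarrow> t < N \<Longrightarrow> call3_time TD n t (enc (rev tk)) \<le> U"
    and bound_A: "\<And>t. t < N \<Longrightarrow> call2_time TA n t \<le> U"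
    and types: "\<And>p tk q t. (p, tk, q) \<in> set ts \<Longrightarrow> t < N \<Longrightarrow>
      fD (prod_encode (n, prod_encode (t, enc (rev tk)))) < N"
begin

definition globals :: "store \<Rightarrow> nat \<Rightarrow> bool" where
  "globals s p \<longleftrightarrow> fst s 21 = 1 \<and> fst s 2 = n \<and> fst s 8 = N \<and> fst s 4 = p \<and> snd s 0 = M"

text \<open>The pairs of a state occupy one block of \<open>N\<close> cells. The base addresses are
  accumulated while the states are read, as the machine has no multiplication.\<close>

definition based :: "(nat \<Rightarrow> nat) \<Rightarrow> bool" where
  "based b \<longleftrightarrow> (\<forall>j<length qs. b (qs ! j) = j * N)"

lemma wp_read_states:
  assumes "globals s p" "stored M p (length qs # qs)"
  shows "wp read_states (\<lambda>t s'. t \<le> 4 + 6 * length qs \<and> globals s' (p + Suc (length qs)) \<and>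
    based (snd s' 10) \<and> (\<forall>b. b \<noteq> 10 \<longrightarrow> snd s' b = snd s b)) s"
proof -
  obtain r m where s: "s = (r, m)" by force
  have g: "r 21 = 1" "r 2 = n" "r 8 = N" "r 4 = p" "m 0 = M" using assms(1) by (simp_all add: globals_def s)
  let ?B = "Seq (Load 11 0 4) (Seq (Add 4 4 21) (Seq (Store 10 11 10) (Seq (Add 10 10 8) (Sub 9 9 21))))"
  let ?I = "\<lambda>i s'. globals s' (Suc p + i) \<and> fst s' 9 = length qs - i \<and> fst s' 10 = i * N \<and> i \<le> length qs \<and>
    (\<forall>j<i. snd s' 10 (qs ! j) = j * N) \<and> (\<forall>b. b \<noteq> 10 \<longrightarrow> snd s' b = m b)"
  have loop: "wp (While 9 ?B) (\<lambda>t s'. t \<le> Suc (length qs * Suc 5) \<and> ?I (length qs) s') s'"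
    if "?I 0 s'" for s'
  proof (rule wp_While_le[where I = ?I])
    fix i and s' :: store
    assume i: "i < length qs" and I: "?I i s'"
    obtain r1 m1 where s': "s' = (r1, m1)" by force
    have "M (Suc p + i) = qs ! i" using stored_nth[of M "Suc p" qs i] assms(2) i by simp
    then have "wp ?B (\<lambda>t s'. t \<le> 5 \<and> ?I (Suc i) s') s'"
      unfolding s' using I i qs by (auto simp: s' globals_def less_Suc_eq nth_eq_iff_index_eq)
    then show "fst s' 9 \<noteq> 0 \<and> wp ?B (\<lambda>t s'. t \<le> 5 \<and> ?I (Suc i) s') s'" using I i by simp
  qed (use that in auto)
  show ?thesis
    unfolding read_states_def s
    apply simp
    apply (rule wp_mono)
     apply (rule loop)
    using assms(2) g by (auto simp: globals_def based_def)
qed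

lemma wp_read_final:
  assumes "globals s p" "stored M p (length fin # fin)" "snd s 9 = (\<lambda>_. 0)"
  shows "wp read_final (\<lambda>t s'. t \<le> 3 + 5 * length fin \<and> globals s' (p + Suc (length fin)) \<and>
    (\<forall>q. snd s' 9 q \<noteq> 0 \<longleftrightarrow> q \<in> set fin) \<and> (\<forall>b. b \<noteq> 9 \<longrightarrow> snd s' b = snd s b) \<and> fst s' 15 = fst s 15) s"
proof -
  obtain r m where s: "s = (r, m)" by force
  have g: "r 21 = 1" "r 2 = n" "r 8 = N" "r 4 = p" "m 0 = M" using assms(1) by (simp_all add: globals_def s)
  let ?B = "Seq (Load 11 0 4) (Seq (Add 4 4 21) (Seq (Store 9 11 21) (Sub 9 9 21)))"
  let ?I = "\<lambda>i s'. globals s' (Suc p + i) \<and> fst s' 9 = length fin - i \<and> i \<le> length fin \<and>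
    (\<forall>q. snd s' 9 q \<noteq> 0 \<longleftrightarrow> q \<in> set (take i fin)) \<and> (\<forall>b. b \<noteq> 9 \<longrightarrow> snd s' b = m b) \<and> fst s' 15 = r 15"
  have loop: "wp (While 9 ?B) (\<lambda>t s'. t \<le> Suc (length fin * Suc 4) \<and> ?I (length fin) s') s'"
    if "?I 0 s'" for s'
  proof (rule wp_While_le[where I = ?I])
    fix i and s' :: store
    assume i: "i < length fin" and I: "?I i s'"
    obtain r1 m1 where s': "s' = (r1, m1)" by force
    have "M (Suc p + i) = fin ! i" using stored_nth[of M "Suc p" fin i] assms(2) i by simp
    then have "wp ?B (\<lambda>t s'. t \<le> 4 \<and> ?I (Suc i) s') s'"
      unfolding s' using I i by (auto simp: s' globals_def take_Suc_conv_app_nth)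
    then show "fst s' 9 \<noteq> 0 \<and> wp ?B (\<lambda>t s'. t \<le> 4 \<and> ?I (Suc i) s') s'" using I i by simp
  qed (use that in auto)
  show ?thesis
    unfolding read_final_def s
    apply simp
    apply (rule wp_mono)
     apply (rule loop)
    using assms(2,3) g by (auto simp: globals_def s)
qed

definition visited :: "(nat \<Rightarrow> nat) \<Rightarrow> (nat \<Rightarrow> nat) \<Rightarrow> (nat \<times> nat) set \<Rightarrow> bool" where
  "visited b v V \<longleftrightarrow> (\<forall>q\<in>set qs. \<forall>t<N. v (b q + t) \<noteq> 0 \<longleftrightarrow> (q, t) \<in> V)"

lemma address_inj:
  assumes "based b" "q \<in> set qs" "q' \<in> set qs" "t < N" "t' < N" "b q + t = b q' + t'"
  shows "q = q' \<and> t = t'"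
proof -
  obtain i i' where i: "i < length qs" "q = qs ! i" "i' < length qs" "q' = qs ! i'"
    using assms(2,3) by (auto simp: in_set_conv_nth)
  then have eq: "i * N + t = i' * N + t'" using assms(1,6) by (simp add: based_def)
  have "(i * N + t) div N = i" "(i' * N + t') div N = i'" using assms(4,5) by auto
  then have "i = i'" using eq by metis
  then show ?thesis using eq i by simp
qed

lemma visited_insert:
  assumes "based b" "visited b v V" "q \<in> set qs" "t < N" "x \<noteq> 0"
  shows "visited b (v(b q + t := x)) (insert (q, t) V)"
  unfolding visited_def
proof (intro ballI allI impI)
  fix q' t' assume "q' \<in> set qs" "t' < N"
  then show "(v(b q + t := x)) (b q' + t') \<noteq> 0 \<longleftrightarrow> (q', t') \<in> insert (q, t) V"
    using assms address_inj[of b q' q t' t] by (auto simp: visited_def)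
qed

lemma wp_read_init:
  assumes "globals s p" "stored M p (length ini # ini)" "snd s 6 = (\<lambda>_. 0)" "based (snd s 10)"
  shows "wp read_init (\<lambda>t s'. t \<le> 5 + 9 * length ini \<and> globals s' (p + Suc (length ini)) \<and>
    fst s' 15 = length ini \<and> (\<forall>j<length ini. snd s' 7 j = ini ! j \<and> snd s' 8 j = 0) \<and>
    visited (snd s 10) (snd s' 6) (set ini \<times> {0}) \<and>
    (\<forall>b. b \<notin> {6, 7, 8} \<longrightarrow> snd s' b = snd s b)) s"
proof -
  obtain r m where s: "s = (r, m)" by force
  have g: "r 21 = 1" "r 2 = n" "r 8 = N" "r 4 = p" "m 0 = M" using assms(1) by (simp_all add: globals_def s)
  let ?B = "Seq (Load 11 0 4) (Seq (Add 4 4 21) (Seq (Load 18 10 11) (Seq (Store 6 18 21) (Seq (Store 7 15 11)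
     (Seq (Store 8 15 16) (Seq (Add 15 15 21) (Sub 9 9 21)))))))"
  let ?I = "\<lambda>i s'. globals s' (Suc p + i) \<and> fst s' 9 = length ini - i \<and> i \<le> length ini \<and> fst s' 15 = i \<and>
    fst s' 16 = 0 \<and> (\<forall>j<i. snd s' 7 j = ini ! j \<and> snd s' 8 j = 0) \<and>
    visited (m 10) (snd s' 6) (set (take i ini) \<times> {0}) \<and> (\<forall>b. b \<notin> {6, 7, 8} \<longrightarrow> snd s' b = m b)"
  have loop: "wp (While 9 ?B) (\<lambda>t s'. t \<le> Suc (length ini * Suc 8) \<and> ?I (length ini) s') s'"
    if "?I 0 s'" for s'
  proof (rule wp_While_le[where I = ?I])
    fix i and s' :: store
    assume i: "i < length ini" and I: "?I i s'"
    obtain r1 m1 where s': "s' = (r1, m1)" by force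
    have "M (Suc p + i) = ini ! i" using stored_nth[of M "Suc p" ini i] assms(2) i by simp
    moreover have "visited (m 10) ((m1 6)(m 10 (ini ! i) := 1)) (set (take (Suc i) ini) \<times> {0})"
    proof -
      have "set (take (Suc i) ini) \<times> {0::nat} = insert (ini ! i, 0) (set (take i ini) \<times> {0})"
        using i by (auto simp: take_Suc_conv_app_nth)
      moreover have "ini ! i \<in> set qs" using ini(2) i nth_mem by blast
      ultimately show ?thesis
        using visited_insert[of "m 10" "m1 6" _ "ini ! i" 0 1] I assms(4) N0 by (simp add: s s')
    qed
    ultimately have "wp ?B (\<lambda>t s'. t \<le> 8 \<and> ?I (Suc i) s') s'"
      unfolding s' using I i by (auto simp: s' globals_def less_Suc_eq)
    then show "fst s' 9 \<noteq> 0 \<and> wp ?B (\<lambda>t s'. t \<le> 8 \<and> ?I (Suc i) s') s'" using I i by simp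
  qed (use that in auto)
  show ?thesis
    unfolding read_init_def s
    apply simp
    apply (rule wp_mono)
     apply (rule loop)
    using assms(2-) g by (auto simp: globals_def s visited_def)
qed

lemma wp_read_symbol:
  assumes "globals s p" "(p', tk, q) \<in> set ts" "stored M p tk" "fst s 12 = 0" "fst s 13 = 1"
  shows "wp read_symbol (\<lambda>t s'. t \<le> Suc (K * (2 * U + 3)) \<and> globals s' (p + length tk) \<and> snd s' = snd s \<and>
    fst s' 12 = enc (rev tk) \<and> fst s' 9 = fst s 9 \<and> fst s' 11 = fst s 11 \<and> fst s' 14 = fst s 14) s"
proof -
  let ?B = "Seq (Load 6 0 4) (Seq (Add 4 4 21) (Seq (call2 cC 12 6 12) (call2 cS 13 2 12)))"
  let ?I = "\<lambda>i s'. globals s' (p + i) \<and> snd s' = snd s \<and> i \<le> length tk \<and> fst s' 12 = enc (rev (take i tk)) \<and>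
    (fst s' 13 \<noteq> 0 \<longleftrightarrow> i < length tk) \<and> fst s' 9 = fst s 9 \<and> fst s' 11 = fst s 11 \<and> fst s' 14 = fst s 14"
  have "wp (While 13 ?B) (\<lambda>t s'. t \<le> Suc (length tk * Suc (2 * U + 2)) \<and> ?I (length tk) s') s"
  proof (rule wp_While_le[where I = ?I])
    show "?I 0 s" using assms ts[OF assms(2)] by simp
    fix i and s' :: store
    assume i: "i < length tk" and I: "?I i s'"
    obtain r1 m1 where s': "s' = (r1, m1)" by force
    have g: "r1 21 = 1" "r1 2 = n" "r1 8 = N" "r1 4 = p + i" "m1 0 = M"
      using I unfolding globals_def s' fst_conv snd_conv by blast+
    have x: "M (p + i) = tk ! i" using stored_nth[OF assms(3) i] .
    have e: "enc (rev (take (Suc i) tk)) = Suc (prod_encode (tk ! i, enc (rev (take i tk))))"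
      using i by (simp add: take_Suc_conv_app_nth)
    have b: "call2_time TC (tk ! i) (enc (rev (take i tk))) \<le> U"
      "call2_time TS n (enc (rev (take (Suc i) tk))) \<le> U"
      using bound_C[OF assms(2) i] bound_S[OF assms(2) i] by auto
    have c: "fS (prod_encode (n, enc (rev (take (Suc i) tk)))) \<noteq> 0 \<longleftrightarrow> Suc i < length tk"
      using complete[OF assms(2) i] .
    have "wp ?B (\<lambda>t s'. t \<le> 2 * U + 2 \<and> ?I (Suc i) s') s'"
      unfolding s' wp_Seq wp_Load wp_Add
      apply (rule wp_call2[OF C]; simp)
      apply (rule wp_call2[OF S]; simp)
      using I i g x e b c by (simp add: s' globals_def)
    then show "fst s' 13 \<noteq> 0 \<and> wp ?B (\<lambda>t s'. t \<le> 2 * U + 2 \<and> ?I (Suc i) s') s'" using I i by simp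
  qed simp
  moreover have "length tk * Suc (2 * U + 2) \<le> K * (2 * U + 3)"
    using ts[OF assms(2)] by (intro mult_mono) auto
  ultimately show ?thesis
    unfolding read_symbol_def by (elim wp_mono) auto
qed

definition graph :: "(nat \<Rightarrow> nat \<Rightarrow> nat) \<Rightarrow> nat \<Rightarrow> bool" where
  "graph m i \<longleftrightarrow> (\<forall>p. linked (m 2) (m 3 p) (edges ts i p)) \<and>
     (\<forall>j<i. m 4 (Suc j) = enc (rev (fst (snd (ts ! j)))) \<and> m 5 (Suc j) = snd (snd (ts ! j)))"

text \<open>The number \<open>Suc i\<close> occurs in no list built so far, so storing its link
  leaves these lists intact; only the list of its source gets a new head.\<close>

lemma graph_Suc:
  assumes "graph m i"
    and "m' 2 = (m 2)(Suc i := m 3 (fst (ts ! i)))" "m' 3 = (m 3)(fst (ts ! i) := Suc i)"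
    and "m' 4 = (m 4)(Suc i := enc (rev (fst (snd (ts ! i)))))" "m' 5 = (m 5)(Suc i := snd (snd (ts ! i)))"
  shows "graph m' (Suc i)"
proof -
  have "Suc i \<notin> set (edges ts i p)" for p by (auto simp: set_edges)
  then show ?thesis using assms by (auto simp: graph_def edges_Suc linked_upd less_Suc_eq)
qed

lemma wp_read_trans:
  assumes "globals s p" "stored M p (length ts # concat (map edge_tokens ts))" "graph (snd s) 0"
  shows "wp read_trans (\<lambda>t s'. t \<le> 4 + length ts * (K * (2 * U + 3) + 15) \<and>
    globals s' (p + Suc (length (concat (map edge_tokens ts)))) \<and> graph (snd s') (length ts) \<and>
    (\<forall>b. b \<notin> {2, 3, 4, 5} \<longrightarrow> snd s' b = snd s b)) s"
proof -
  obtain r m where s: "s = (r, m)" by force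
  have g: "r 21 = 1" "r 2 = n" "r 8 = N" "r 4 = p" "m 0 = M" using assms(1) by (simp_all add: globals_def s)
  let ?B = "Seq (Add 14 14 21) (Seq (Load 11 0 4) (Seq (Add 4 4 21) (Seq (Const 12 0) (Seq (Const 13 1)
     (Seq read_symbol store_edge)))))"
  let ?pos = "\<lambda>i. Suc p + length (concat (map edge_tokens (take i ts)))"
  let ?I = "\<lambda>i s'. globals s' (?pos i) \<and> fst s' 9 = length ts - i \<and> i \<le> length ts \<and> fst s' 14 = i \<and>
    graph (snd s') i \<and> (\<forall>b. b \<notin> {2, 3, 4, 5} \<longrightarrow> snd s' b = m b)"
  \<comment> \<open>Five instructions, the failing test that ends the symbol, and the eight
    instructions of \<open>store_edge\<close> make up the 14.\<close>
  let ?k = "K * (2 * U + 3) + 14"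
  have loop: "wp (While 9 ?B) (\<lambda>t s'. t \<le> Suc (length ts * Suc ?k) \<and> ?I (length ts) s') s'"
    if "?I 0 s'" for s'
  proof (rule wp_While_le[where I = ?I])
    fix i and s' :: store
    assume i: "i < length ts" and I: "?I i s'"
    obtain r1 m1 where s': "s' = (r1, m1)" by force
    obtain a tk b where e: "ts ! i = (a, tk, b)" by (cases "ts ! i")
    then have mem: "(a, tk, b) \<in> set ts" using i nth_mem by metis
    have g1: "r1 21 = 1" "r1 2 = n" "r1 8 = N" "r1 4 = ?pos i" "m1 0 = M" using I by (simp_all add: globals_def s')
    have "stored M (?pos i) (edge_tokens (ts ! i))"
      using stored_concat[of M "Suc p" edge_tokens ts i] assms(2) i by simp
    then have x: "M (?pos i) = a" "stored M (Suc (?pos i)) tk" "M (Suc (?pos i) + length tk) = b"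
      by (simp_all add: edge_tokens_def e)
    have pos: "?pos (Suc i) = ?pos i + Suc (Suc (length tk))"
      using i by (simp add: take_Suc_conv_app_nth edge_tokens_def e)
    let ?r = "r1(14 := Suc i, 11 := a, 4 := Suc (?pos i), 12 := 0, 13 := 1)"
    have sym: "wp read_symbol (\<lambda>t s'. t \<le> Suc (K * (2 * U + 3)) \<and> globals s' (Suc (?pos i) + length tk) \<and>
      snd s' = m1 \<and> fst s' 12 = enc (rev tk) \<and> fst s' 9 = r1 9 \<and> fst s' 11 = a \<and> fst s' 14 = Suc i) (?r, m1)"
      by (rule wp_mono, rule wp_read_symbol[OF _ mem x(2)]) (use g1 in \<open>auto simp: globals_def\<close>)
    have rest: "wp store_edge (\<lambda>t s'. t \<le> 8 \<and> ?I (Suc i) s') s''"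
      if s2: "globals s'' (Suc (?pos i) + length tk) \<and> snd s'' = m1 \<and> fst s'' 12 = enc (rev tk) \<and>
        fst s'' 9 = r1 9 \<and> fst s'' 11 = a \<and> fst s'' 14 = Suc i" for s''
    proof -
      obtain r2 where s'': "s'' = (r2, m1)" using s2 by (cases s'') auto
      have g2: "r2 21 = 1" "r2 2 = n" "r2 8 = N" "r2 4 = Suc (?pos i) + length tk" "r2 12 = enc (rev tk)"
        "r2 9 = r1 9" "r2 11 = a" "r2 14 = Suc i" using s2 by (simp_all add: globals_def s'')
      let ?m = "m1(2 := (m1 2)(Suc i := m1 3 a), 3 := (m1 3)(a := Suc i), 4 := (m1 4)(Suc i := enc (rev tk)),
        5 := (m1 5)(Suc i := b))"
      have gr: "graph ?m (Suc i)" by (rule graph_Suc[of m1]) (use I s' e in auto)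
      show ?thesis
        unfolding s'' store_edge_def using I i g1 g2 x(3) pos gr
        by (simp add: s' globals_def)
    qed
    have "wp ?B (\<lambda>t s'. t \<le> ?k \<and> ?I (Suc i) s') s'"
      unfolding s' wp_Seq[of "Add _ _ _"] wp_Seq[of "Load _ _ _"] wp_Seq[of "Const _ _"] wp_Add wp_Load wp_Const
        wp_Seq[of read_symbol]
      using g1 x(1) I s' apply (simp del: wp_Seq)
      apply (rule wp_mono[OF sym[simplified]])
      apply (rule wp_mono[OF rest])
      by auto
    then show "fst s' 9 \<noteq> 0 \<and> wp ?B (\<lambda>t s'. t \<le> ?k \<and> ?I (Suc i) s') s'" using I i by simp
  qed (use that in auto)
  show ?thesis
    unfolding read_trans_def s wp_Seq[of "Load _ _ _"] wp_Seq[of "Add _ _ _"] wp_Seq[of "Const _ _"]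
      wp_Load wp_Add wp_Const
    apply (rule wp_mono)
     apply (rule loop)
    using assms(2,3) g by (auto simp: globals_def s add.commute[of _ 15])
qed

end

section \<open>Correctness and cost of the search in the product graph\<close>

context main_ram_input
begin

definition d :: "nat \<Rightarrow> nat list \<Rightarrow> nat" where
  "d t tk = fD (prod_encode (n, prod_encode (t, enc (rev tk))))"

definition steps :: "((nat \<times> nat) \<times> (nat \<times> nat)) set" where
  "steps = {((p, t), (q, d t tk)) | p t q tk. (p, tk, q) \<in> set ts}"

definition reach :: "(nat \<times> nat) set" where
  "reach = steps\<^sup>* `` (set ini \<times> {0})"

definition space :: "(nat \<times> nat) set" where
  "space = set qs \<times> {..<N}"

definition out_edges :: "nat \<Rightarrow> nat list" where
  "out_edges q = edges ts (length ts) q"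

definition weight :: "nat \<times> nat \<Rightarrow> nat" where
  "weight x = Suc (length (out_edges (fst x)))"

text \<open>A pair has to pay for its pop and for each outgoing edge, whether it waits on the stack
  or is still undiscovered. Discovery moves its weight from one sum to the other, so a push leaves
  the potential unchanged.\<close>

definition pot :: "(nat \<times> nat) set \<Rightarrow> (nat \<times> nat) list \<Rightarrow> nat" where
  "pot V stk = sum_list (map weight stk) + sum weight (space - V)"

definition target :: "nat \<Rightarrow> nat \<Rightarrow> nat \<times> nat" where
  "target j t = (snd (snd (ts ! j)), d t (fst (snd (ts ! j))))"

text \<open>The pairs in \<open>W\<close> have been popped. Their successors are all visited, with
  the exception of the pair \<open>y\<close> in progress, whose edges in \<open>l\<close> are still
  to be followed.\<close>

definition closed_under :: "(nat \<times> nat) set \<Rightarrow> (nat \<times> nat) set \<Rightarrow> nat list \<Rightarrow> nat \<times> nat \<Rightarrow> bool" where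
  "closed_under V W l y \<longleftrightarrow> (\<forall>x\<in>W. \<forall>j<length ts. fst (ts ! j) = fst x \<longrightarrow>
     target j (snd x) \<in> V \<or> x = y \<and> Suc j \<in> set l)"

definition hit :: "(nat \<times> nat) set \<Rightarrow> bool" where
  "hit W \<longleftrightarrow> (\<exists>x\<in>W. fst x \<in> set fin \<and> fA (prod_encode (n, snd x)) \<noteq> 0)"

text \<open>Visited pairs \<open>V\<close> split into those waiting on the stack and those already
  popped. Acceptance is tested when a pair is popped, so \<open>res\<close> speaks about the popped
  ones only.\<close>

definition invar :: "(nat \<times> nat) set \<Rightarrow> (nat \<times> nat) list \<Rightarrow> nat list \<Rightarrow> nat \<Rightarrow> nat \<Rightarrow> nat \<Rightarrow> bool" where
  "invar V stk l q t res \<longleftrightarrow> V \<subseteq> space \<and> V \<subseteq> reach \<and> set ini \<times> {0} \<subseteq> V \<and> distinct stk \<and> set stk \<subseteq> V \<and>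
     (l \<noteq> [] \<longrightarrow> (q, t) \<in> V - set stk \<and> set l \<subseteq> set (out_edges q)) \<and>
     closed_under V (V - set stk) l (q, t) \<and> (res \<noteq> 0 \<longleftrightarrow> hit (V - set stk))"

lemma out_edges_nth: "Suc j \<in> set (out_edges q) \<longleftrightarrow> j < length ts \<and> fst (ts ! j) = q"
  by (auto simp: out_edges_def set_edges)

lemma space_step:
  assumes "j < length ts" "x \<in> space"
  shows "target j (snd x) \<in> space"
proof -
  obtain p tk q where e: "ts ! j = (p, tk, q)" by (cases "ts ! j")
  then have "(p, tk, q) \<in> set ts" using assms(1) nth_mem by metis
  then show ?thesis using ts[of p tk q] types[of p tk q "snd x"] assms(2)
    by (auto simp: space_def target_def d_def e)
qed

lemma finite_space: "finite space"
  by (simp add: space_def)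

lemma closed_under_skip:
  assumes "closed_under V W (Suc j # l) (q, t)" "target j t \<in> V"
  shows "closed_under V W l (q, t)"
  unfolding closed_under_def
proof (intro ballI allI impI)
  fix x k assume *: "x \<in> W" "k < length ts" "fst (ts ! k) = fst x"
  have "target k (snd x) \<in> V \<or> x = (q, t) \<and> Suc k \<in> set (Suc j # l)"
    by (rule assms(1)[unfolded closed_under_def, rule_format, OF *])
  then show "target k (snd x) \<in> V \<or> x = (q, t) \<and> Suc k \<in> set l"
    using assms(2) by auto
qed

lemma closed_under_mono:
  assumes "closed_under V W l y" "V \<subseteq> V'"
  shows "closed_under V' W l y"
  unfolding closed_under_def
proof (intro ballI allI impI)
  fix x k assume *: "x \<in> W" "k < length ts" "fst (ts ! k) = fst x"
  from assms(1)[unfolded closed_under_def, rule_format, OF *]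
  show "target k (snd x) \<in> V' \<or> x = y \<and> Suc k \<in> set l"
    using assms(2) by blast
qed

lemma closed_under_pop:
  assumes "closed_under V W [] y"
  shows "closed_under V (insert x W) (out_edges (fst x)) x"
  unfolding closed_under_def
proof (intro ballI allI impI)
  fix z k assume *: "z \<in> insert x W" "k < length ts" "fst (ts ! k) = fst z"
  show "target k (snd z) \<in> V \<or> z = x \<and> Suc k \<in> set (out_edges (fst x))"
  proof (cases "z = x")
    case True
    then show ?thesis using * by (simp add: out_edges_nth)
  next
    case False
    then have "z \<in> W" using *(1) by simp
    from assms[unfolded closed_under_def, rule_format, OF this *(2,3)] show ?thesis by simp
  qed
qed

lemma invar_skip:
  assumes "invar V stk (Suc j # l) q t res" "target j t \<in> V"
  shows "invar V stk l q t res"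
  using assms closed_under_skip[of V "V - set stk" j l q t] unfolding invar_def by simp

text \<open>The new target joins \<open>V\<close> and the stack at the same time, so the set of
  popped pairs, and with it the result, does not change.\<close>

lemma invar_push:
  assumes I: "invar V stk (Suc j # l) q t res"
    and x: "x = target j t" "x \<notin> V"
  shows "invar (insert x V) (stk @ [x]) l q t res" "pot (insert x V) (stk @ [x]) = pot V stk" "x \<in> space"
proof -
  have qt: "(q, t) \<in> V" "(q, t) \<notin> set stk" "j < length ts" "fst (ts ! j) = q" "V \<subseteq> space" "V \<subseteq> reach"
    using I by (auto simp: invar_def out_edges_nth)
  show xs: "x \<in> space" using space_step[OF qt(3), of "(q, t)"] qt x(1) by auto
  have "((q, t), x) \<in> steps"
  proof -
    obtain tk q' where e: "ts ! j = (q, tk, q')" using qt(4) by (cases "ts ! j") auto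
    then have "(q, tk, q') \<in> set ts" using qt(3) nth_mem by metis
    then show ?thesis unfolding steps_def x(1) target_def e by auto
  qed
  moreover have "(q, t) \<in> reach" using qt by blast
  ultimately have xr: "x \<in> reach"
    unfolding reach_def by (auto intro: rtrancl_into_rtrancl)
  have V: "insert x V - set (stk @ [x]) = V - set stk" using x(2) I by (auto simp: invar_def)
  have "closed_under V (V - set stk) (Suc j # l) (q, t)" using I by (simp add: invar_def)
  then have "closed_under (insert x V) (V - set stk) (Suc j # l) (q, t)"
    by (rule closed_under_mono) blast
  then have "closed_under (insert x V) (V - set stk) l (q, t)"
    by (rule closed_under_skip) (simp add: x(1))
  then show "invar (insert x V) (stk @ [x]) l q t res"
    unfolding invar_def V
    using I xs xr x(2) unfolding invar_def by auto
  have eq: "space - V = insert x (space - insert x V)" using xs x(2) by auto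
  have "sum weight (insert x (space - insert x V)) = weight x + sum weight (space - insert x V)"
    by (rule sum.insert) (auto simp: finite_space)
  then have "sum weight (space - V) = weight x + sum weight (space - insert x V)"
    by (subst eq)
  then show "pot (insert x V) (stk @ [x]) = pot V stk" by (simp add: pot_def)
qed

lemma invar_pop:
  assumes I: "invar V (stk @ [(q', t')]) [] q t res"
  shows "invar V stk (out_edges q') q' t' (res + (if q' \<in> set fin then fA (prod_encode (n, t')) else 0))"
    and "pot V (stk @ [(q', t')]) = pot V stk + Suc (length (out_edges q'))"
proof -
  have V: "V - set stk = insert (q', t') (V - set (stk @ [(q', t')]))"
    using I by (auto simp: invar_def)
  show "invar V stk (out_edges q') q' t' (res + (if q' \<in> set fin then fA (prod_encode (n, t')) else 0))"
    unfolding invar_def V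
    using I closed_under_pop[of V "V - set (stk @ [(q', t')])" "(q, t)" "(q', t')"]
    unfolding invar_def hit_def by auto
  show "pot V (stk @ [(q', t')]) = pot V stk + Suc (length (out_edges q'))"
    by (simp add: pot_def weight_def)
qed

text \<open>With an empty stack and no pending edge, \<open>V\<close> contains the starting pairs
  and is closed under steps, hence contains everything reachable; the converse inclusion is part of
  the invariant.\<close>

lemma invar_done:
  assumes I: "invar V [] [] q t res"
  shows "res \<noteq> 0 \<longleftrightarrow> hit reach"
proof -
  have cl: "closed_under V V [] (q, t)" and V: "V \<subseteq> reach" "set ini \<times> {0} \<subseteq> V" and h: "res \<noteq> 0 \<longleftrightarrow> hit V"
    using I by (simp_all add: invar_def)
  have "y \<in> V" if "(x, y) \<in> steps\<^sup>*" "x \<in> set ini \<times> {0}" for x y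
    using that(1)
  proof (induction rule: rtrancl_induct)
    case base
    then show ?case using V(2) that(2) by blast
  next
    case (step y z)
    then obtain p t q tk where e: "y = (p, t)" "z = (q, d t tk)" "(p, tk, q) \<in> set ts"
      unfolding steps_def by auto
    then obtain j where j: "j < length ts" "ts ! j = (p, tk, q)" by (auto simp: in_set_conv_nth)
    from cl[unfolded closed_under_def, rule_format, OF step.IH j(1)]
    show ?case using j(2) e by (simp add: target_def)
  qed
  then have "reach \<subseteq> V" by (auto simp: reach_def)
  then show ?thesis using h V(1) by auto
qed

definition mem_ok :: "(nat \<times> nat) set \<Rightarrow> (nat \<times> nat) list \<Rightarrow> nat list \<Rightarrow> nat \<Rightarrow> store \<Rightarrow> bool" where
  "mem_ok V stk l t s \<longleftrightarrow> fst s 21 = 1 \<and> fst s 2 = n \<and> based (snd s 10) \<and> visited (snd s 10) (snd s 6) V \<and>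
     graph (snd s) (length ts) \<and> (\<forall>q. snd s 9 q \<noteq> 0 \<longleftrightarrow> q \<in> set fin) \<and> fst s 15 = length stk \<and>
     (\<forall>j<length stk. (snd s 7 j, snd s 8 j) = stk ! j) \<and> linked (snd s 2) (fst s 14) l \<and>
     (l \<noteq> [] \<longrightarrow> fst s 16 = t)"

lemma graph_cong: "m 2 = m' 2 \<Longrightarrow> m 3 = m' 3 \<Longrightarrow> m 4 = m' 4 \<Longrightarrow> m 5 = m' 5 \<Longrightarrow> graph m i \<longleftrightarrow> graph m' i"
  by (simp add: graph_def)

lemma wp_edge_step:
  assumes I: "invar V stk (j # l) q t (fst s 20)" and M: "mem_ok V stk (j # l) t s"
  shows "wp edge_step (\<lambda>tm s'. tm \<le> U + 12 \<and> (\<exists>V' stk'. invar V' stk' l q t (fst s' 20) \<and>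
    mem_ok V' stk' l t s' \<and> pot V' stk' = pot V stk) \<and> fst s' 13 = fst s 13) s"
proof -
  obtain r m where s: "s = (r, m)" by force
  have lookup: "r 14 = j" "j \<noteq> 0" "linked (m 2) (m 2 j) l" using M by (simp_all add: mem_ok_def s)
  then obtain i where j: "j = Suc i" by (cases j) auto
  have i: "i < length ts" "fst (ts ! i) = q" "(q, t) \<in> V" "V \<subseteq> space"
    using I by (auto simp: invar_def j out_edges_nth)
  obtain tk q' where e: "ts ! i = (q, tk, q')" using i(2) by (cases "ts ! i") auto
  then have mem: "(q, tk, q') \<in> set ts" using i(1) nth_mem by metis
  have tN: "t < N" using i(3,4) by (auto simp: space_def)
  have g: "r 21 = 1" "r 2 = n" "r 16 = t" "r 15 = length stk" "m 4 j = enc (rev tk)" "m 5 j = q'"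
    "based (m 10)" "visited (m 10) (m 6) V" "graph m (length ts)"
    "\<forall>q. m 9 q \<noteq> 0 \<longleftrightarrow> q \<in> set fin" "\<forall>j<length stk. (m 7 j, m 8 j) = stk ! j"
    using M i(1) by (simp_all add: mem_ok_def s j graph_def e)
  let ?x = "(q', d t tk)"
  have xs: "q' \<in> set qs" "d t tk < N"
    using space_step[OF i(1), of "(q, t)"] i(3,4) by (auto simp: e space_def target_def)
  have vis: "m 6 (m 10 q' + d t tk) \<noteq> 0 \<longleftrightarrow> ?x \<in> V"
    using g(8) xs by (auto simp: visited_def)
  have tm: "call3_time TD n t (enc (rev tk)) \<le> U" using bound_D[OF mem tN] .
  have dd: "fD (prod_encode (n, prod_encode (t, enc (rev tk)))) = d t tk" by (simp add: d_def)
  show ?thesis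
  proof (cases "?x \<in> V")
    case True
    have I': "invar V stk l q t (r 20)"
      using invar_skip[of V stk i l q t "r 20"] I True by (simp add: j e s target_def)
    show ?thesis
      unfolding edge_step_def s wp_Seq[of "Load _ _ _"] wp_Load wp_Seq[of "call3 _ _ _ _ _"]
      apply (rule wp_call3[OF D]; simp)
      using g lookup tm True vis xs I'
      apply (simp add: dd)
      by (intro conjI exI[of _ V] exI[of _ stk]) (simp_all add: mem_ok_def)
  next
    case False
    have x: "?x = target i t" by (simp add: e target_def)
    have I': "invar (insert ?x V) (stk @ [?x]) l q t (r 20)" "pot (insert ?x V) (stk @ [?x]) = pot V stk"
      using invar_push[OF I[unfolded j] x False] by (auto simp: s)
    have vi: "visited (m 10) ((m 6)(m 10 q' + d t tk := Suc 0)) (insert ?x V)"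
      using visited_insert[OF g(7,8) xs, of "Suc 0"] by simp
    let ?m = "m(6 := (m 6)(m 10 q' + d t tk := Suc 0), 7 := (m 7)(length stk := q'), 8 := (m 8)(length stk := d t tk))"
    have gr: "graph ?m (length ts)" using g(9) by (subst graph_cong[of ?m m]) auto
    have st: "\<forall>j<length (stk @ [?x]). (?m 7 j, ?m 8 j) = (stk @ [?x]) ! j"
      using g(11) by (auto simp: nth_append less_Suc_eq)
    have M': "mem_ok (insert ?x V) (stk @ [?x]) l t (r', ?m)"
      if "r' 21 = 1" "r' 2 = n" "r' 15 = Suc (length stk)" "r' 14 = m 2 j" "r' 16 = t" for r'
      using that g(7,10) vi gr st lookup(3) by (simp add: mem_ok_def)
    show ?thesis
      unfolding edge_step_def s wp_Seq[of "Load _ _ _"] wp_Load wp_Seq[of "call3 _ _ _ _ _"]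
      apply (rule wp_call3[OF D]; simp)
      using g(1-6) lookup(1) tm False vis I'
      apply (simp add: dd)
      by (intro conjI exI[of _ "insert ?x V"] exI[of _ "stk @ [?x]"]) (simp_all add: M')
  qed
qed

lemma wp_pop_step:
  assumes I: "invar V (stk @ [(q', t')]) [] q t (fst s 20)" and M: "mem_ok V (stk @ [(q', t')]) [] t s"
  shows "wp pop_step (\<lambda>tm s'. tm \<le> U + 12 \<and> invar V stk (out_edges q') q' t' (fst s' 20) \<and>
    mem_ok V stk (out_edges q') t' s' \<and> fst s' 13 = fst s 13) s"
proof -
  obtain r m where s: "s = (r, m)" by force
  have g: "r 21 = 1" "r 2 = n" "r 15 = Suc (length stk)"
    "based (m 10)" "visited (m 10) (m 6) V" "graph m (length ts)"
    "\<forall>q. m 9 q \<noteq> 0 \<longleftrightarrow> q \<in> set fin"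
    and st: "\<forall>j<length (stk @ [(q', t')]). (m 7 j, m 8 j) = (stk @ [(q', t')]) ! j"
    using M by (simp_all add: mem_ok_def s)
  have top: "m 7 (length stk) = q'" "m 8 (length stk) = t'" using st[rule_format, of "length stk"] by auto
  have st': "\<forall>j<length stk. (m 7 j, m 8 j) = stk ! j"
    using st by (metis length_append_singleton less_Suc_eq nth_append)
  have tN: "t' < N" using I by (auto simp: invar_def space_def)
  have lookup: "linked (m 2) (m 3 q') (out_edges q')" using g(6) by (simp add: graph_def out_edges_def)
  have tm: "call2_time TA n t' \<le> U" using bound_A[OF tN] .
  note I' = invar_pop(1)[OF I[unfolded s fst_conv]]
  have M': "mem_ok V stk (out_edges q') t' (r', m)"
    if "r' 21 = 1" "r' 2 = n" "r' 15 = length stk" "r' 14 = m 3 q'" "r' 16 = t'" for r'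
    using that g st' lookup by (simp add: mem_ok_def)
  show ?thesis
  proof (cases "q' \<in> set fin")
    case True
    then have f: "m 9 q' \<noteq> 0" using g(7) by blast
    show ?thesis
      unfolding pop_step_def s using g(1-3) top f
      apply simp
      apply (rule wp_call2[OF A]; simp)
      using g(1-3) top I' True tm by (simp add: M')
  next
    case False
    then have f: "m 9 q' = 0" using g(7) by blast
    show ?thesis
      unfolding pop_step_def s using g(1-3) top f I' False by (simp add: M')
  qed
qed

lemma length_out_edges: "(\<Sum>q\<in>set qs. length (out_edges q)) = length ts"
proof -
  have e: "length (out_edges q) = (\<Sum>j<length ts. if fst (ts ! j) = q then 1 else 0)" for q
    by (simp add: out_edges_def edges_def distinct_length_filter sum.If_cases atLeast0LessThan Int_commute)
  have "(\<Sum>q\<in>set qs. length (out_edges q)) = (\<Sum>j<length ts. \<Sum>q\<in>set qs. if fst (ts ! j) = q then 1 else 0)"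
    unfolding e by (rule sum.swap)
  also have "\<dots> = (\<Sum>j<length ts. 1)"
  proof (rule sum.cong[OF refl])
    fix j assume "j \<in> {..<length ts}"
    then have "fst (ts ! j) \<in> set qs"
      using ts[of "fst (ts ! j)" "fst (snd (ts ! j))" "snd (snd (ts ! j))"] by simp
    then show "(\<Sum>q\<in>set qs. if fst (ts ! j) = q then 1 else 0) = (1::nat)" by simp
  qed
  finally show ?thesis by simp
qed

text \<open>The source of linearity: each state has \<open>N\<close> copies, each with weight one
  plus its out-degree, and the out-degrees add up to the number of transitions.\<close>

lemma sum_weight_space: "sum weight space = N * (length qs + length ts)"
proof -
  have "sum weight space = (\<Sum>q\<in>set qs. \<Sum>t<N. Suc (length (out_edges q)))"
    by (subst sum.cartesian_product) (simp add: space_def weight_def split_def)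
  also have "\<dots> = N * (\<Sum>q\<in>set qs. Suc (length (out_edges q)))"
    by (simp add: sum_distrib_left)
  also have "(\<Sum>q\<in>set qs. Suc (length (out_edges q))) = length qs + length ts"
    using length_out_edges distinct_card[OF qs] by (simp add: sum_Suc)
  finally show ?thesis .
qed

lemma wp_explore:
  assumes "globals s p" "based (snd s 10)" "graph (snd s) (length ts)" "\<forall>q. snd s 9 q \<noteq> 0 \<longleftrightarrow> q \<in> set fin"
    "fst s 15 = length ini" "\<forall>j<length ini. snd s 7 j = ini ! j \<and> snd s 8 j = 0"
    "visited (snd s 10) (snd s 6) (set ini \<times> {0})"
  shows "wp explore (\<lambda>t s'. t \<le> 4 + (U + 15) * Suc (N * (length qs + length ts)) \<and>
    (fst s' 20 \<noteq> 0 \<longleftrightarrow> hit reach)) s"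
proof -
  obtain r m where s: "s = (r, m)" by force
  let ?B = "If 14 edge_step (If 15 pop_step (Const 13 0))"
  let ?J = "\<lambda>V stk l q t s. invar V stk l q t (fst s 20) \<and> mem_ok V stk l t s \<and> fst s 13 \<le> 1 \<and>
    (fst s 13 = 0 \<longrightarrow> stk = [] \<and> l = [])"
  \<comment> \<open>Each iteration lowers the second factor by one: a step along an edge shortens
    \<open>l\<close>, a pop trades the weight of a pair for its edges, and stopping clears the flag
    in register 13. An iteration costs at most \<open>U + 12\<close> steps, up to two branch tests
    and the loop test, hence \<open>U + 15\<close>.\<close>
  let ?I = "\<lambda>k s. \<exists>V stk l q t. ?J V stk l q t s \<and> k = (U + 15) * (fst s 13 + length l + pot V stk)"
  let ?V0 = "set ini \<times> {0::nat}" and ?S0 = "map (\<lambda>q. (q, 0::nat)) ini"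
  let ?r0 = "r(20 := 0, 14 := 0, 13 := 1)"
  have loop: "wp (While 13 ?B) (\<lambda>t s'. (\<exists>k'. ?I k' s') \<and> fst s' 13 = 0 \<and> t \<le> Suc k) s" if "?I k s" for k s
  proof (rule wp_While_ghost[where I = ?I and x = 13, OF that])
    fix k s assume I: "?I k s" and nz: "fst s 13 \<noteq> 0"
    then obtain V stk l q t where J: "invar V stk l q t (fst s 20)" "mem_ok V stk l t s" "fst s 13 = 1"
      and k: "k = (U + 15) * (1 + length l + pot V stk)"
      by (metis One_nat_def le_SucE le_zero_eq)
    obtain r m where s: "s = (r, m)" by force
    show "wp ?B (\<lambda>t s'. \<exists>k'. ?I k' s' \<and> Suc t + k' \<le> k) s"
    proof (cases l)
      case (Cons j l')
      have "r 14 \<noteq> 0" using J(2) by (simp add: mem_ok_def s Cons)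
      moreover have "wp edge_step (\<lambda>t s'. \<exists>k'. ?I k' s' \<and> Suc (Suc t) + k' \<le> k) s"
      proof (rule wp_mono[OF wp_edge_step[OF J(1,2)[unfolded Cons]]], elim conjE exE)
        fix tm s' V' stk'
        assume *: "tm \<le> U + 12" "fst s' 13 = fst s 13" "invar V' stk' l' q t (fst s' 20)"
          "mem_ok V' stk' l' t s'" "pot V' stk' = pot V stk"
        show "\<exists>k'. ?I k' s' \<and> Suc (Suc tm) + k' \<le> k"
          by (intro exI[of _ "(U + 15) * (fst s' 13 + length l' + pot V' stk')"] conjI exI[of _ V'] exI[of _ stk']
              exI[of _ l'] exI[of _ q] exI[of _ t])
            (use * J(3) k Cons in \<open>simp_all add: algebra_simps\<close>)
      qed
      ultimately show ?thesis by (simp add: s)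
    next
      case Nil
      have z: "r 14 = 0" using J(2) by (simp add: mem_ok_def s Nil)
      show ?thesis
      proof (cases stk rule: rev_cases)
        case (snoc ys x)
        obtain q' t' where x: "x = (q', t')" by force
        have "r 15 \<noteq> 0" using J(2) by (simp add: mem_ok_def s snoc)
        moreover have "wp pop_step (\<lambda>t s'. \<exists>k'. ?I k' s' \<and> Suc (Suc (Suc t)) + k' \<le> k) s"
        proof (rule wp_mono[OF wp_pop_step[OF J(1,2)[unfolded Nil snoc x]]], elim conjE)
          fix tm s'
          assume *: "tm \<le> U + 12" "fst s' 13 = fst s 13" "invar V ys (out_edges q') q' t' (fst s' 20)"
            "mem_ok V ys (out_edges q') t' s'"
          have p: "pot V stk = pot V ys + Suc (length (out_edges q'))"
            using invar_pop(2) J(1) unfolding Nil snoc x by blast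
          show "\<exists>k'. ?I k' s' \<and> Suc (Suc (Suc tm)) + k' \<le> k"
            by (intro exI[of _ "(U + 15) * (fst s' 13 + length (out_edges q') + pot V ys)"] conjI
                exI[of _ V] exI[of _ ys] exI[of _ "out_edges q'"] exI[of _ q'] exI[of _ t'])
              (use * J(3) k Nil p in \<open>simp_all add: algebra_simps\<close>)
        qed
        ultimately show ?thesis using z by (simp add: s)
      next
        case N: Nil
        have "r 15 = 0" using J(2) by (simp add: mem_ok_def s N)
        then have step: "wp ?B (\<lambda>t s'. t = 3 \<and> s' = (r(13 := 0), m)) s"
          using z by (simp add: s)
        have a: "?I ((U + 15) * pot V []) (r(13 := 0), m)"
          by (intro exI[of _ V] exI[of _ "[]"] exI[of _ q] exI[of _ t])
            (use J Nil N in \<open>simp add: s mem_ok_def\<close>)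
        have b: "Suc 3 + (U + 15) * pot V [] \<le> k"
          using k Nil N by (simp add: algebra_simps)
        show ?thesis
        proof (rule wp_mono[OF step])
          fix t :: nat and s' assume "t = 3 \<and> s' = (r(13 := 0), m)"
          then have e: "t = 3" "s' = (r(13 := 0), m)" by auto
          show "\<exists>k'. ?I k' s' \<and> Suc t + k' \<le> k"
            unfolding e by (intro exI[of _ "(U + 15) * pot V []"] conjI a b)
        qed
      qed
    qed
  qed
  have inv0: "invar ?V0 ?S0 [] 0 0 0"
    unfolding invar_def using ini N0
    by (auto simp: space_def reach_def distinct_map inj_on_def closed_under_def hit_def)
  have mem0: "mem_ok ?V0 ?S0 [] 0 (?r0, m)"
    using assms by (simp add: mem_ok_def s globals_def)
  have pot0: "pot ?V0 ?S0 = sum weight space"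
  proof -
    have "sum_list (map weight ?S0) = sum weight (set ?S0)"
      using ini(1) by (subst sum_list_distinct_conv_sum_set) (auto simp: distinct_map inj_on_def)
    moreover have "set ?S0 = ?V0" by auto
    moreover have "?V0 \<subseteq> space" using inv0 by (simp add: invar_def)
    ultimately show ?thesis
      using sum.subset_diff[of ?V0 space weight] finite_space by (simp add: pot_def)
  qed
  have I0: "?I ((U + 15) * Suc (sum weight space)) (?r0, m)"
    by (intro exI[of _ ?V0] exI[of _ ?S0] exI[of _ "[]"] exI[of _ 0] exI[of _ 0])
      (use inv0 mem0 pot0 in simp)
  have "wp explore (\<lambda>t s'. t \<le> 3 + Suc ((U + 15) * Suc (sum weight space)) \<and> (\<exists>k'. ?I k' s') \<and> fst s' 13 = 0) s"
    unfolding explore_def s wp_Seq wp_Const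
    by (rule wp_mono[OF loop[OF I0]], elim conjE, intro conjI, simp, assumption, assumption)
  then show ?thesis
  proof (rule wp_mono, elim conjE exE)
    fix t s' k' V stk l q t'
    assume *: "t \<le> 3 + Suc ((U + 15) * Suc (sum weight space))" "fst s' 13 = 0"
      "invar V stk l q t' (fst s' 20)" "fst s' 13 = 0 \<longrightarrow> stk = [] \<and> l = []"
    then show "t \<le> 4 + (U + 15) * Suc (N * (length qs + length ts)) \<and>
      (fst s' 20 \<noteq> 0 \<longleftrightarrow> hit reach)"
      using invar_done[of V q t' "fst s' 20"] sum_weight_space by auto
  qed
qed

end

lemma wp_seq_bound:
  assumes "wp c (\<lambda>t s. t \<le> a \<and> P s) s" "\<And>s. P s \<Longrightarrow> wp e (\<lambda>t s. t \<le> b \<and> Q s) s"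
  shows "wp (Seq c e) (\<lambda>t s. t \<le> a + b \<and> Q s) s"
  unfolding wp_Seq
proof (rule wp_mono[OF assms(1)])
  fix t s' assume *: "t \<le> a \<and> P s'"
  then show "wp e (\<lambda>t' s''. t + t' \<le> a + b \<and> Q s'') s'"
    by (intro wp_mono[OF assms(2)]) auto
qed

context main_ram_input
begin

definition solve_bound :: nat where
  "solve_bound = search_time n + call1_time TN n + 42 + (K * (2 * U + 3) + 15) + (U + 15) * Suc N"

lemma solve_bound_mult:
  assumes len: "length ini \<le> length qs" "length fin \<le> length qs" "qs \<noteq> []"
  shows "search_time n + (call1_time TN n + (4 + 6 * length qs + (4 + length ts * (K * (2 * U + 3) + 15) +
    (5 + 9 * length ini + (3 + 5 * length fin + (4 + (U + 15) * Suc (N * (length qs + length ts)) + 2))))))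
    \<le> solve_bound * (length qs + length ts)" (is "_ \<le> _ * ?X")
proof -
  have X: "1 \<le> ?X" "length qs \<le> ?X" "length ts \<le> ?X" using len(3) by (cases qs; simp)+
  have a: "search_time n \<le> search_time n * ?X" "call1_time TN n \<le> call1_time TN n * ?X" using X by simp_all
  have b: "length ts * (K * (2 * U + 3) + 15) \<le> (K * (2 * U + 3) + 15) * ?X"
    by (subst mult.commute) (rule mult_le_mono2[OF X(3)])
  have "Suc (N * ?X) \<le> Suc N * ?X" using X by simp
  then have c: "(U + 15) * Suc (N * ?X) \<le> (U + 15) * Suc N * ?X"
    by (metis mult.assoc mult_le_mono2)
  \<comment> \<open>The phases contribute 22 constant steps and at most 6, 9 and 5 steps per state.
    As there is at least one state, everything is covered by 42 steps per state.\<close>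
  have e: "22 + 20 * length qs \<le> 42 * ?X" using len(3) by (cases qs) simp_all
  have "search_time n + (call1_time TN n + (4 + 6 * length qs + (4 + length ts * (K * (2 * U + 3) + 15) +
    (5 + 9 * length ini + (3 + 5 * length fin + (4 + (U + 15) * Suc (N * ?X) + 2)))))) \<le>
      search_time n * ?X + call1_time TN n * ?X + 42 * ?X + (K * (2 * U + 3) + 15) * ?X + (U + 15) * Suc N * ?X"
    using a b c e len by linarith
  then show ?thesis unfolding solve_bound_def by (simp only: distrib_right)
qed

lemma wp_solve:
  assumes n: "diff M n = 0" "\<And>i. i < n \<Longrightarrow> diff M i \<noteq> 0" and fN: "fN n = N"
    and m: "m 0 = M" "\<And>b. b \<noteq> 0 \<Longrightarrow> m b = (\<lambda>_. 0)"
    and inp: "stored M (fL n) ((length qs # qs) @ (length ts # concat (map edge_tokens ts)) @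
      (length ini # ini) @ (length fin # fin))"
    and len: "length ini \<le> length qs" "length fin \<le> length qs" "qs \<noteq> []"
  shows "wp solve (\<lambda>t s. t \<le> solve_bound * (length qs + length ts) \<and> (fst s 0 \<noteq> 0 \<longleftrightarrow> hit reach)) (r, m)"
proof -
  let ?p0 = "fL n" and ?p1 = "fL n + Suc (length qs)"
  let ?p2 = "?p1 + Suc (length (concat (map edge_tokens ts)))"
  let ?p3 = "?p2 + Suc (length ini)"
  have st: "stored M ?p0 (length qs # qs)" "stored M ?p1 (length ts # concat (map edge_tokens ts))"
    "stored M ?p2 (length ini # ini)" "stored M ?p3 (length fin # fin)"
    using inp by simp_all
  let ?Q = "\<lambda>s :: store. fst s 0 \<noteq> 0 \<longleftrightarrow> hit reach"
  define A5 where "A5 s \<longleftrightarrow> (\<exists>p. globals s p) \<and> based (snd s 10) \<and> graph (snd s) (length ts) \<and>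
    (\<forall>q. snd s 9 q \<noteq> 0 \<longleftrightarrow> q \<in> set fin) \<and> fst s 15 = length ini \<and>
    (\<forall>j<length ini. snd s 7 j = ini ! j \<and> snd s 8 j = 0) \<and> visited (snd s 10) (snd s 6) (set ini \<times> {0})" for s :: store
  define A4 where "A4 s \<longleftrightarrow> globals s ?p3 \<and> based (snd s 10) \<and> graph (snd s) (length ts) \<and> snd s 9 = (\<lambda>_. 0) \<and>
    fst s 15 = length ini \<and>
    (\<forall>j<length ini. snd s 7 j = ini ! j \<and> snd s 8 j = 0) \<and> visited (snd s 10) (snd s 6) (set ini \<times> {0})" for s :: store
  define A3 where "A3 s \<longleftrightarrow> globals s ?p2 \<and> based (snd s 10) \<and> graph (snd s) (length ts) \<and> snd s 9 = (\<lambda>_. 0) \<and>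
    snd s 6 = (\<lambda>_. 0)" for s :: store
  define A2 where "A2 s \<longleftrightarrow> globals s ?p1 \<and> based (snd s 10) \<and> (\<forall>b. b \<noteq> 0 \<and> b \<noteq> 10 \<longrightarrow> snd s b = (\<lambda>_. 0))" for s :: store
  define A1 where "A1 s \<longleftrightarrow> globals s ?p0 \<and> snd s = m" for s :: store
  define A0 where "A0 s \<longleftrightarrow> snd s = m \<and> fst s 21 = 1 \<and> fst s 2 = n \<and> fst s 4 = fL n" for s :: store
  have p6: "wp (Seq explore (mov 0 20)) (\<lambda>t s. t \<le> 4 + (U + 15) * Suc (N * (length qs + length ts)) + 2 \<and> ?Q s) s"
    if "A5 s" for s
  proof (rule wp_seq_bound)
    show "wp explore (\<lambda>t s. t \<le> 4 + (U + 15) * Suc (N * (length qs + length ts)) \<and>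
        (fst s 20 \<noteq> 0 \<longleftrightarrow> hit reach)) s"
      using wp_explore that unfolding A5_def by blast
    show "wp (mov 0 20) (\<lambda>t s. t \<le> 2 \<and> ?Q s) s'" if "fst s' 20 \<noteq> 0 \<longleftrightarrow> hit reach" for s'
      using that by (cases s') simp
  qed
  have p5: "wp read_final (\<lambda>t s. t \<le> 3 + 5 * length fin \<and> A5 s) s" if a: "A4 s" for s
  proof -
    have "wp read_final (\<lambda>t s'. t \<le> 3 + 5 * length fin \<and> globals s' (?p3 + Suc (length fin)) \<and>
      (\<forall>q. snd s' 9 q \<noteq> 0 \<longleftrightarrow> q \<in> set fin) \<and> (\<forall>b. b \<noteq> 9 \<longrightarrow> snd s' b = snd s b) \<and> fst s' 15 = fst s 15) s"
      by (rule wp_read_final) (use a st in \<open>simp_all add: A4_def\<close>)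
    then show ?thesis
      by (rule wp_mono) (use a in \<open>auto simp: A4_def A5_def graph_def\<close>)
  qed
  have p4: "wp read_init (\<lambda>t s. t \<le> 5 + 9 * length ini \<and> A4 s) s" if a: "A3 s" for s
  proof -
    have "wp read_init (\<lambda>t s'. t \<le> 5 + 9 * length ini \<and> globals s' ?p3 \<and>
      fst s' 15 = length ini \<and> (\<forall>j<length ini. snd s' 7 j = ini ! j \<and> snd s' 8 j = 0) \<and>
      visited (snd s 10) (snd s' 6) (set ini \<times> {0}) \<and> (\<forall>b. b \<notin> {6, 7, 8} \<longrightarrow> snd s' b = snd s b)) s"
      by (rule wp_read_init) (use a st in \<open>simp_all add: A3_def\<close>)
    then show ?thesis
      by (rule wp_mono) (use a in \<open>auto simp: A3_def A4_def graph_def\<close>)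
  qed
  have p3: "wp read_trans (\<lambda>t s. t \<le> 4 + length ts * (K * (2 * U + 3) + 15) \<and> A3 s) s" if a: "A2 s" for s
  proof -
    have "wp read_trans (\<lambda>t s'. t \<le> 4 + length ts * (K * (2 * U + 3) + 15) \<and> globals s' ?p2 \<and>
      graph (snd s') (length ts) \<and> (\<forall>b. b \<notin> {2, 3, 4, 5} \<longrightarrow> snd s' b = snd s b)) s"
      by (rule wp_read_trans) (use a st in \<open>simp_all add: A2_def graph_def\<close>)
    then show ?thesis
      by (rule wp_mono) (use a in \<open>auto simp: A3_def A2_def\<close>)
  qed
  have p2: "wp read_states (\<lambda>t s. t \<le> 4 + 6 * length qs \<and> A2 s) s" if a: "A1 s" for s
  proof -
    have "wp read_states (\<lambda>t s'. t \<le> 4 + 6 * length qs \<and> globals s' ?p1 \<and>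
      based (snd s' 10) \<and> (\<forall>b. b \<noteq> 10 \<longrightarrow> snd s' b = snd s b)) s"
      by (rule wp_read_states) (use a st in \<open>simp_all add: A1_def\<close>)
    then show ?thesis
      by (rule wp_mono) (use a m in \<open>auto simp: A1_def A2_def\<close>)
  qed
  have p1: "wp (call1 cN 8 2) (\<lambda>t s. t \<le> call1_time TN n \<and> A1 s) s" if a: "A0 s" for s
  proof -
    obtain r1 where s: "s = (r1, m)" using a by (cases s) (auto simp: A0_def)
    show ?thesis
      unfolding s by (rule wp_call1[OF N]) (use a m fN s in \<open>simp_all add: A0_def A1_def globals_def\<close>)
  qed
  have p0: "wp search (\<lambda>t s. t \<le> search_time n \<and> A0 s) (r, m)"
    by (rule wp_mono[OF wp_search[of m n r]]) (use n m in \<open>auto simp: A0_def\<close>)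
  have "wp solve (\<lambda>t s. t \<le> search_time n + (call1_time TN n + (4 + 6 * length qs +
    (4 + length ts * (K * (2 * U + 3) + 15) + (5 + 9 * length ini + (3 + 5 * length fin +
    (4 + (U + 15) * Suc (N * (length qs + length ts)) + 2)))))) \<and> ?Q s) (r, m)"
    unfolding solve_def
    by (rule wp_seq_bound[OF p0], rule wp_seq_bound[OF p1], assumption,
        rule wp_seq_bound[OF p2], assumption, rule wp_seq_bound[OF p3], assumption,
        rule wp_seq_bound[OF p4], assumption, rule wp_seq_bound[OF p5], assumption, rule p6, assumption)
  then show ?thesis
    by (rule wp_mono) (use solve_bound_mult[OF len] in linarith)
qed

end

section \<open>The decision procedure\<close>

lemma cmp_cmpn: "cmpn f \<Longrightarrow> cmp f"
  by (rule cmpI) simp_all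

lemma cmpn_dec: "cmp g \<Longrightarrow> cmpn (\<lambda>c. g (dec c) :: nat)"
  using cmpD[of g] by simp

lemma dec_prod_encode [simp]: "dec (prod_encode (a, b)) = (dec a, dec b)"
  by (metis dec_enc enc_Pair enc_dec)

lemma cmp_prod_encode [cmp]:
  fixes a b :: "_ \<Rightarrow> nat"
  assumes "cmp a" "cmp b"
  shows "cmp (\<lambda>x. prod_encode (a x, b x))"
  using cmp_enc[OF cmp_Pair[OF assms]] by simp

lemma cmp_sum [cmp]:
  fixes f :: "'a::enc \<Rightarrow> nat \<Rightarrow> nat"
  assumes "cmp (\<lambda>p. f (fst p) (snd p))" "cmp k"
  shows "cmp (\<lambda>x. \<Sum>j<k x. f x j)"
proof -
  have "cmp (\<lambda>x. sum_list (map (f x) [0..<k x]))"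
    by (intro cmp assms)
  then show ?thesis by (simp add: interv_sum_list_conv_sum_set_nat atLeast0LessThan)
qed

lemma cmpn_impl_30:
  assumes "cmpn f"
  obtains c T where "impl c 30 f T" "cmp T"
proof -
  obtain T where "\<forall>k. \<exists>c. impl c k f T" using assms unfolding cmpn_def by blast
  then obtain c where c: "\<And>k. impl (c k) k f T" by metis
  show thesis by (rule that[OF c cmp_cmpn[OF cmpn_time[OF c]]])
qed

lemma cmp_call1_time:
  assumes "cmp T" "cmp x"
  shows "cmp (\<lambda>z. call1_time T (x z))"
  unfolding call1_time_def by (intro cmp cmp_comp[OF assms(1)] assms(2-))

lemma cmp_call2_time:
  assumes "cmp T" "cmp x" "cmp y"
  shows "cmp (\<lambda>z. call2_time T (x z) (y z))"
  unfolding call2_time_def by (intro cmp cmp_comp[OF assms(1)] assms(2-))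

lemma cmp_call3_time:
  assumes "cmp T" "cmp x" "cmp y" "cmp u"
  shows "cmp (\<lambda>z. call3_time T (x z) (y z) (u z))"
  unfolding call3_time_def by (intro cmp cmp_comp[OF assms(1)] assms(2-))

section \<open>The functions computed by the subprograms and a bound on their cost\<close>

definition par_ok :: "par \<Rightarrow> bool" where
  "par_ok P \<longleftrightarrow> length (token_run (snd (snd (snd P)))) = 1"

definition invalid_num :: "par \<Rightarrow> nat" where
  "invalid_num P = b2n (\<not> par_ok P)"

definition length_num :: "par \<Rightarrow> nat" where
  "length_num P = length (par_tokens P)"

definition token_num :: "par \<times> nat \<Rightarrow> nat" where
  "token_num x = nthd 0 (par_tokens (fst x)) (snd x)"

definition incomplete_num :: "par \<times> nat list \<Rightarrow> nat" where
  "incomplete_num x = b2n (parse_symbol (fst x) (snd x) = [])"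

definition step_num :: "par \<times> nat \<times> nat list \<Rightarrow> nat" where
  "step_num x = type_step (fst x) (fst (snd x)) (hd (parse_symbol (fst x) (snd (snd x))))"

definition accepts_num :: "par \<times> nat \<Rightarrow> nat" where
  "accepts_num x = b2n (type_accepts (fst x) (snd x))"

lemma cmp_g: "cmp invalid_num" "cmp length_num" "cmp token_num" "cmp incomplete_num" "cmp step_num" "cmp accepts_num"
  unfolding invalid_num_def par_ok_def length_num_def token_num_def incomplete_num_def step_num_def accepts_num_def by (intro cmp)+

text \<open>Dropping from the front of the reversed tokens yields the reversed prefixes, which are
  exactly the accumulators that can occur while a listed symbol is read.\<close>

definition token_prefixes :: "par \<Rightarrow> nat list list" where
  "token_prefixes P = concat (map (\<lambda>s. map (\<lambda>k. drop k (rev (symbol_tokens s))) [0..<Suc (length (symbol_tokens s))]) (symbols P))"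

lemma cmp_token_prefixes [cmp]: "cmp P \<Longrightarrow> cmp (\<lambda>x. token_prefixes (P x))"
  by (rule cmp_comp[of token_prefixes]; (unfold token_prefixes_def)?; (intro cmp)?)

lemma rev_take_token_prefixes:
  assumes "s \<in> set (symbols P)" "i \<le> length (symbol_tokens s)"
  shows "rev (take i (symbol_tokens s)) \<in> set (token_prefixes P)"
proof -
  have "rev (take i (symbol_tokens s)) = drop (length (symbol_tokens s) - i) (rev (symbol_tokens s))"
    by (simp add: rev_take)
  then have "rev (take i (symbol_tokens s)) \<in> set (map (\<lambda>k. drop k (rev (symbol_tokens s))) [0..<Suc (length (symbol_tokens s))])"
    unfolding set_map set_upt by (rule image_eqI) simp
  then show ?thesis
    unfolding token_prefixes_def using assms(1) by (simp only: set_concat set_map image_image UN_iff) (rule bexI)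
qed

definition token_bound :: "par \<Rightarrow> nat" where
  "token_bound P = sum_list (map (\<lambda>s. length (symbol_tokens s)) (symbols P))"

lemma cmp_token_bound [cmp]: "cmp P \<Longrightarrow> cmp (\<lambda>x. token_bound (P x))"
  by (rule cmp_comp[of token_bound]; (unfold token_bound_def)?; (intro cmp)?)

lemma le_sum_list_map: "x \<in> set l \<Longrightarrow> f x \<le> (sum_list (map f l) :: nat)"
  by (induction l) (auto intro: trans_le_add2)

text \<open>A sum instead of a maximum, because sums already have computability rules and bound each
  of their terms. For a nonempty accumulator \<open>a\<close>, consing was called on its head and
  tail. The times are computable since they come from clocked programs.\<close>

definition call_bound ::
    "(nat \<Rightarrow> nat) \<Rightarrow> (nat \<Rightarrow> nat) \<Rightarrow> (nat \<Rightarrow> nat) \<Rightarrow> (nat \<Rightarrow> nat) \<Rightarrow> nat \<Rightarrow> nat" where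
  "call_bound TC TS TD TA n =
     sum_list (map (\<lambda>a. call2_time TC (hd a) (enc (tl a)) + call2_time TS n (enc a) +
       (\<Sum>t<num_types (dec n). call3_time TD n t (enc a))) (token_prefixes (dec n))) +
     (\<Sum>t<num_types (dec n). call2_time TA n t)"

lemma cmp_call_bound:
  assumes "cmp TC" "cmp TS" "cmp TD" "cmp TA"
  shows "cmp (call_bound TC TS TD TA)"
  unfolding call_bound_def
  by (intro cmp cmp_call2_time[OF assms(1)] cmp_call2_time[OF assms(2)] cmp_call3_time[OF assms(3)] cmp_call2_time[OF assms(4)])

lemma call_bound_acc:
  assumes "a \<in> set (token_prefixes (dec n))"
  shows "call2_time TC (hd a) (enc (tl a)) \<le> call_bound TC TS TD TA n"
    and "call2_time TS n (enc a) \<le> call_bound TC TS TD TA n"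
    and "t < num_types (dec n) \<Longrightarrow> call3_time TD n t (enc a) \<le> call_bound TC TS TD TA n"
proof -
  let ?f = "\<lambda>a. call2_time TC (hd a) (enc (tl a)) + call2_time TS n (enc a) + (\<Sum>t<num_types (dec n). call3_time TD n t (enc a))"
  have f: "?f a \<le> call_bound TC TS TD TA n"
    using le_sum_list_map[OF assms, of ?f] unfolding call_bound_def by linarith
  then show "call2_time TC (hd a) (enc (tl a)) \<le> call_bound TC TS TD TA n"
    "call2_time TS n (enc a) \<le> call_bound TC TS TD TA n" by linarith+
  assume "t < num_types (dec n)"
  then have "call3_time TD n t (enc a) \<le> (\<Sum>t<num_types (dec n). call3_time TD n t (enc a))"
    by (intro member_le_sum) auto
  then show "call3_time TD n t (enc a) \<le> call_bound TC TS TD TA n" using f by linarith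
qed

lemma call_bound_A:
  assumes "t < num_types (dec n)"
  shows "call2_time TA n t \<le> call_bound TC TS TD TA n"
proof -
  have "call2_time TA n t \<le> (\<Sum>t<num_types (dec n). call2_time TA n t)"
    using assms by (intro member_le_sum) auto
  then show ?thesis unfolding call_bound_def by linarith
qed

definition stream :: "nat list \<Rightarrow> nat \<Rightarrow> nat" where
  "stream ys i = (if i < length ys then ys ! i else 0)"

lemma init_store_eq: "init_store ys = (fst (init_store ys), snd (init_store ys))"
  "snd (init_store ys) 0 = stream ys" "b \<noteq> 0 \<Longrightarrow> snd (init_store ys) b = (\<lambda>_. 0)"
  by (auto simp: init_store_def stream_def)

lemma stored_stream: "ys = xs @ zs @ us \<Longrightarrow> stored (stream ys) (length xs) zs"
  by (auto simp: stored_def stream_def nth_append)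

lemma par_tokens_match:
  assumes "finite \<Sigma>"
  shows "(par_ok P \<and> (\<forall>j<length (par_tokens P). par_tokens P ! j = stream (enc_parameters \<Sigma> w \<tau> \<phi> @ xs) j)) \<longleftrightarrow>
    par_ok P \<and> par_tokens P = enc_parameters \<Sigma> w \<tau> \<phi>"
proof (intro iffI conjI; elim conjE)
  assume ok: "par_ok P" and eq: "\<forall>j<length (par_tokens P). par_tokens P ! j = stream (enc_parameters \<Sigma> w \<tau> \<phi> @ xs) j"
  let ?L = "par_tokens P" and ?E = "enc_parameters \<Sigma> w \<tau> \<phi>"
  \<comment> \<open>A candidate may have more tokens than the input, and the machine then reads
    zeros. With enough zeros appended, agreement cell by cell becomes a statement about prefixes, to
    which prefix-freeness applies.\<close>
  let ?Z = "?E @ xs @ replicate (length ?L) 0"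
  have "?L = take (length ?L) ?Z"
    by (rule nth_equalityI) (use eq in \<open>auto simp: stream_def nth_append\<close>)
  then have "?L @ drop (length ?L) ?Z = ?E @ xs @ replicate (length ?L) 0"
    by (metis append_take_drop_id)
  then show "?L = ?E"
    using par_tokens_prefix(2)[OF assms] ok unfolding par_ok_def by blast
next
  assume "par_tokens P = enc_parameters \<Sigma> w \<tau> \<phi>"
  then show "\<forall>j<length (par_tokens P). par_tokens P ! j = stream (enc_parameters \<Sigma> w \<tau> \<phi> @ xs) j"
    by (auto simp: stream_def nth_append)
qed

text \<open>The first code that the search accepts. It depends on the parameters only, so the factor
  can be defined as a function of it.\<close>

definition par_code :: "nat set \<Rightarrow> nat \<Rightarrow> nat list \<Rightarrow> fo \<Rightarrow> nat" where
  "par_code \<Sigma> w \<tau> \<phi> = (LEAST n. par_ok (dec n) \<and> par_tokens (dec n) = enc_parameters \<Sigma> w \<tau> \<phi>)"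

lemma par_code:
  "par_ok (dec (par_code \<Sigma> w \<tau> \<phi>))" "par_tokens (dec (par_code \<Sigma> w \<tau> \<phi>)) = enc_parameters \<Sigma> w \<tau> \<phi>"
proof -
  have "par_ok (dec (enc (par_rep \<Sigma> w \<tau> \<phi>))) \<and> par_tokens (dec (enc (par_rep \<Sigma> w \<tau> \<phi>))) = enc_parameters \<Sigma> w \<tau> \<phi>"
    unfolding dec_enc par_tokens_par_rep by (simp add: par_ok_def par_rep_def token_run_formula_run formula_run_postfix)
  from LeastI[of "\<lambda>n. par_ok (dec n) \<and> par_tokens (dec n) = enc_parameters \<Sigma> w \<tau> \<phi>", OF this]
  show "par_ok (dec (par_code \<Sigma> w \<tau> \<phi>))" "par_tokens (dec (par_code \<Sigma> w \<tau> \<phi>)) = enc_parameters \<Sigma> w \<tau> \<phi>"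
    unfolding par_code_def by blast+
qed

context params_ram
begin

lemma diff_eq_0: "diff M n = 0 \<longleftrightarrow> fV n = 0 \<and> (\<forall>j<fL n. fT (prod_encode (n, j)) = M j)"
  by (auto simp: diff_def dist_eq_0)

lemma diff_par_code:
  assumes "fV = (\<lambda>c. invalid_num (dec c))" "fL = (\<lambda>c. length_num (dec c))" "fT = (\<lambda>c. token_num (dec c))" "finite \<Sigma>"
  shows "diff (stream (enc_parameters \<Sigma> w \<tau> \<phi> @ xs)) (par_code \<Sigma> w \<tau> \<phi>) = 0"
    and "i < par_code \<Sigma> w \<tau> \<phi> \<Longrightarrow> diff (stream (enc_parameters \<Sigma> w \<tau> \<phi> @ xs)) i \<noteq> 0"
proof -
  have e: "diff (stream (enc_parameters \<Sigma> w \<tau> \<phi> @ xs)) n = 0 \<longleftrightarrow>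
      par_ok (dec n) \<and> par_tokens (dec n) = enc_parameters \<Sigma> w \<tau> \<phi>" for n
    unfolding diff_eq_0 par_tokens_match[OF assms(4), of "dec n" w \<tau> \<phi> xs, symmetric]
    by (simp add: assms invalid_num_def length_num_def token_num_def)
  show "diff (stream (enc_parameters \<Sigma> w \<tau> \<phi> @ xs)) (par_code \<Sigma> w \<tau> \<phi>) = 0"
    unfolding e using par_code by blast
  show "diff (stream (enc_parameters \<Sigma> w \<tau> \<phi> @ xs)) i \<noteq> 0" if "i < par_code \<Sigma> w \<tau> \<phi>"
    unfolding e using not_less_Least[OF that[unfolded par_code_def]] .
qed

end

lemma nfa_code_tokens:
  assumes "nfa_code A xs"
  obtains qs ts ini fin where "distinct qs" "set qs = nfa_states A" "distinct ts" "set ts = nfa_trans A"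
    "distinct ini" "set ini = nfa_init A" "distinct fin" "set fin = nfa_final A"
    "xs = (length qs # qs) @ (length (map (\<lambda>(p, x, q). (p, enc_symbol x, q)) ts) #
      concat (map edge_tokens (map (\<lambda>(p, x, q). (p, enc_symbol x, q)) ts))) @ (length ini # ini) @ (length fin # fin)"
proof -
  obtain qs ts ini fin where *: "distinct qs" "set qs = nfa_states A" "distinct ts" "set ts = nfa_trans A"
    "distinct ini" "set ini = nfa_init A" "distinct fin" "set fin = nfa_final A"
    "xs = enc_list enc_nat qs @ enc_list (enc_triple enc_nat enc_symbol enc_nat) ts @
          enc_list enc_nat ini @ enc_list enc_nat fin"
    using assms unfolding nfa_code_def by blast
  have "map edge_tokens (map (\<lambda>(p, x, q). (p, enc_symbol x, q)) ts) = map (enc_triple enc_nat enc_symbol enc_nat) ts"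
    by (simp add: edge_tokens_def enc_triple_def enc_nat_def split_def)
  then show thesis
    by (intro that[OF *(1-8)]) (simp only: *(9) enc_list_def concat_map_single length_map append_Cons)
qed

lemma computes_wp:
  assumes "wp c (\<lambda>t s. Q t (fst s 0)) (init_store xs)"
  shows "\<exists>t y. computes c xs t y \<and> Q t y"
  using assms unfolding wp_def computes_def by blast

lemma run_append:
  assumes "\<forall>i<length us. (\<rho> i, us ! i, \<rho> (Suc i)) \<in> \<Delta>" "(\<rho> (length us), x, q) \<in> \<Delta>"
  shows "\<forall>i<length (us @ [x]). ((\<rho>(Suc (length us) := q)) i, (us @ [x]) ! i, (\<rho>(Suc (length us) := q)) (Suc i)) \<in> \<Delta>"
  using assms by (auto simp: less_Suc_eq nth_append)

text \<open>A path in the product graph is a run of the automaton whose second component is the type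
  of the word read so far. One direction collects the word along the path, the other follows the
  types of the prefixes.\<close>

lemma (in main_ram_input) hit_reach_iff:
  assumes ts_eq: "set ts = (\<lambda>(p, x, q). (p, enc_symbol x, q)) ` nfa_trans A"
    and ini_eq: "set ini = nfa_init A" and fin_eq: "set fin = nfa_final A"
    and d_eq: "\<And>p x q t. (p, x, q) \<in> nfa_trans A \<Longrightarrow> d t (enc_symbol x) = type_step P t (rep_sym x)"
    and acc_eq: "\<And>t. fA (prod_encode (n, t)) \<noteq> 0 \<longleftrightarrow> type_accepts P t"
  shows "hit reach \<longleftrightarrow> (\<exists>us\<in>nfa_lang A. type_accepts P (foldl (type_step P) 0 (map rep_sym us)))"
proof
  assume "hit reach"
  then obtain q t q0 where qt: "((q0, 0), (q, t)) \<in> steps\<^sup>*" "q0 \<in> nfa_init A" "q \<in> nfa_final A" "type_accepts P t"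
    unfolding hit_def reach_def using acc_eq ini_eq fin_eq by auto
  have "\<exists>us \<rho>. \<rho> 0 = q0 \<and> \<rho> (length us) = fst y \<and> (\<forall>i<length us. (\<rho> i, us ! i, \<rho> (Suc i)) \<in> nfa_trans A) \<and>
      snd y = foldl (type_step P) 0 (map rep_sym us)" if "((q0, 0), y) \<in> steps\<^sup>*" for y
    using that
  proof (induction rule: rtrancl_induct)
    case base
    show ?case by (intro exI[of _ "[]"] exI[of _ "\<lambda>_. q0"]) simp
  next
    case (step y z)
    then obtain us \<rho> where IH: "\<rho> 0 = q0" "\<rho> (length us) = fst y"
      "\<forall>i<length us. (\<rho> i, us ! i, \<rho> (Suc i)) \<in> nfa_trans A" "snd y = foldl (type_step P) 0 (map rep_sym us)"
      by blast
    from step(2) obtain p s x q' where yz: "y = (p, s)" "z = (q', d s (enc_symbol x))" "(p, x, q') \<in> nfa_trans A"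
      unfolding steps_def ts_eq by auto
    show ?case
    proof (intro exI[of _ "us @ [x]"] exI[of _ "\<rho>(Suc (length us) := q')"] conjI)
      show "\<forall>i<length (us @ [x]). ((\<rho>(Suc (length us) := q')) i, (us @ [x]) ! i,
          (\<rho>(Suc (length us) := q')) (Suc i)) \<in> nfa_trans A"
        by (rule run_append[OF IH(3)]) (use IH(2) yz in simp)
    qed (use IH yz d_eq[OF yz(3)] in auto)
  qed
  from this[OF qt(1)] obtain us \<rho> where "\<rho> 0 = q0" "\<rho> (length us) = q"
    "\<forall>i<length us. (\<rho> i, us ! i, \<rho> (Suc i)) \<in> nfa_trans A" "t = foldl (type_step P) 0 (map rep_sym us)"
    by auto
  then show "\<exists>us\<in>nfa_lang A. type_accepts P (foldl (type_step P) 0 (map rep_sym us))"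
    using qt unfolding nfa_lang_def by blast
next
  assume "\<exists>us\<in>nfa_lang A. type_accepts P (foldl (type_step P) 0 (map rep_sym us))"
  then obtain us \<rho> where us: "\<rho> 0 \<in> nfa_init A" "\<rho> (length us) \<in> nfa_final A"
    "\<forall>i<length us. (\<rho> i, us ! i, \<rho> (Suc i)) \<in> nfa_trans A" "type_accepts P (foldl (type_step P) 0 (map rep_sym us))"
    unfolding nfa_lang_def by blast
  let ?t = "\<lambda>i. foldl (type_step P) 0 (map rep_sym (take i us))"
  have "((\<rho> 0, 0), (\<rho> i, ?t i)) \<in> steps\<^sup>*" if "i \<le> length us" for i
    using that
  proof (induction i)
    case (Suc i)
    have tr: "(\<rho> i, us ! i, \<rho> (Suc i)) \<in> nfa_trans A" using us(3) Suc.prems by simp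
    have "?t (Suc i) = d (?t i) (enc_symbol (us ! i))"
      using Suc.prems d_eq[OF tr] by (simp add: take_Suc_conv_app_nth)
    moreover have "(\<rho> i, enc_symbol (us ! i), \<rho> (Suc i)) \<in> set ts"
      unfolding ts_eq by (rule image_eqI[OF _ tr]) simp
    ultimately have "((\<rho> i, ?t i), (\<rho> (Suc i), ?t (Suc i))) \<in> steps"
      unfolding steps_def by blast
    then show ?case using Suc by (meson Suc_leD rtrancl.rtrancl_into_rtrancl)
  qed simp
  from this[of "length us"] have "(\<rho> (length us), ?t (length us)) \<in> reach"
    unfolding reach_def using us(1) ini_eq by auto
  then show "hit reach"
    unfolding hit_def using us(2,4) fin_eq acc_eq by (intro bexI[of _ "(\<rho> (length us), ?t (length us))"]) auto
qed

theorem theorem2: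
  shows "\<exists>f. computable_parameter_function f \<and>
    (\<exists>P. \<forall>\<Sigma> w \<tau> \<phi>. parameters \<Sigma> w \<tau> \<phi> \<longrightarrow>
      (\<forall>A (C :: ('u::infinite) struc set) xs.
        regular_decisional \<Sigma> w \<tau> C \<and> represents \<Sigma> w \<tau> A C \<and> nfa_code A xs \<longrightarrow>
        (\<exists>t y. computes P (enc_parameters \<Sigma> w \<tau> \<phi> @ xs) t y \<and>
          real t \<le> real (f \<Sigma> w \<tau> \<phi>) * nfa_size (odd_alphabet \<Sigma> w \<tau>) A \<and>
          (y \<noteq> 0 \<longleftrightarrow> (\<exists>S\<in>C. fo_models S \<phi>)))))"
proof -
  define fV where "fV = (\<lambda>c. invalid_num (dec c))"
  define fL where "fL = (\<lambda>c. length_num (dec c))"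
  define fT where "fT = (\<lambda>c. token_num (dec c))"
  define fS where "fS = (\<lambda>c. incomplete_num (dec c))"
  define fD where "fD = (\<lambda>c. step_num (dec c))"
  define fA where "fA = (\<lambda>c. accepts_num (dec c))"
  define fN where "fN = (\<lambda>c. num_types (dec c))"
  obtain cV TV where impl_V: "impl cV 30 fV TV" "cmp TV"
    unfolding fV_def by (rule cmpn_impl_30[OF cmpn_dec[OF cmp_g(1)]])
  obtain cL TL where impl_L: "impl cL 30 fL TL" "cmp TL"
    unfolding fL_def by (rule cmpn_impl_30[OF cmpn_dec[OF cmp_g(2)]])
  obtain cT TT where impl_T: "impl cT 30 fT TT" "cmp TT"
    unfolding fT_def by (rule cmpn_impl_30[OF cmpn_dec[OF cmp_g(3)]])
  obtain cS TS where impl_S: "impl cS 30 fS TS" "cmp TS"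
    unfolding fS_def by (rule cmpn_impl_30[OF cmpn_dec[OF cmp_g(4)]])
  obtain cD TD where impl_D: "impl cD 30 fD TD" "cmp TD"
    unfolding fD_def by (rule cmpn_impl_30[OF cmpn_dec[OF cmp_g(5)]])
  obtain cA TA where impl_A: "impl cA 30 fA TA" "cmp TA"
    unfolding fA_def by (rule cmpn_impl_30[OF cmpn_dec[OF cmp_g(6)]])
  obtain cN TN where impl_N: "impl cN 30 fN TN" "cmp TN"
    unfolding fN_def by (rule cmpn_impl_30[OF cmpn_dec[OF cmp_num_types[OF cmp_id]]])
  obtain cC TC where impl_C: "impl cC 30 Suc TC" "cmp TC"
    using cmpn_dec[OF cmp_Suc[OF cmp_id]] by (auto elim: cmpn_impl_30)
  interpret main_ram cV cL cT cN fV fL fT fN TV TL TT TN cC cS cD cA fS fD fA TC TS TD TA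
    by unfold_locales (fact impl_V(1) impl_L(1) impl_T(1) impl_N(1) impl_C(1) impl_S(1) impl_D(1) impl_A(1))+
  define U where "U = call_bound TC TS TD TA"
  define K where "K = (\<lambda>n. token_bound (dec n))"
  \<comment> \<open>This is \<open>solve_bound\<close> with \<open>K\<close>, \<open>U\<close> and
    the number of types read off the parameter code \<open>n\<close>.\<close>
  define F where "F n = search_time n + call1_time TN n + 42 + (K n * (2 * U n + 3) + 15) + (U n + 15) * Suc (fN n)" for n
  have cmp_F: "cmp F"
  proof -
    have U: "cmp U" unfolding U_def by (rule cmp_call_bound[OF impl_C(2) impl_S(2) impl_D(2) impl_A(2)])
    have fL: "cmp fL" unfolding fL_def by (intro cmp cmp_comp[OF cmp_g(2)])
    have bt: "cmp body_time"
      unfolding body_time_def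
      by (intro cmp cmp_call1_time[OF impl_V(2)] cmp_call1_time[OF impl_L(2)] cmp_call2_time[OF impl_T(2)] fL cmp_comp[OF fL])
    have sr: "cmp search_time"
      unfolding search_time_def by (intro cmp cmp_comp[OF bt])
    have fN: "cmp fN" unfolding fN_def by (intro cmp)
    show ?thesis
      unfolding F_def K_def by (intro cmp sr cmp_call1_time[OF impl_N(2)] U fN)
  qed
  obtain cF TF where F: "impl cF 30 F TF"
    using cmpn_dec[OF cmp_F] by (auto elim: cmpn_impl_30)
  define f where "f \<Sigma> w \<tau> \<phi> = F (par_code \<Sigma> w \<tau> \<phi>)" for \<Sigma> w \<tau> \<phi>
  have "computable_parameter_function f"
    unfolding computable_parameter_function_def
  \<comment> \<open>The factor is computed by the same search, which leaves the parameter code in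
    register 2, followed by a program for \<open>F\<close>.\<close>
  proof (intro exI[of _ "Seq search (call1 cF 0 2)"] allI impI)
    fix \<Sigma> w \<tau> \<phi> assume "parameters \<Sigma> w \<tau> \<phi>"
    then have fin: "finite \<Sigma>" by (simp add: parameters_def)
    let ?n = "par_code \<Sigma> w \<tau> \<phi>" and ?xs = "enc_parameters \<Sigma> w \<tau> \<phi>"
    have dp: "diff (stream ?xs) ?n = 0" "\<And>i. i < ?n \<Longrightarrow> diff (stream ?xs) i \<noteq> 0"
      using diff_par_code[OF fV_def fL_def fT_def fin, where xs = "[]" and w = w and \<tau> = \<tau> and \<phi> = \<phi>]
      unfolding append_Nil2 by blast+
    have "wp (Seq search (call1 cF 0 2)) (\<lambda>t s. fst s 0 = f \<Sigma> w \<tau> \<phi>) (init_store ?xs)"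
      unfolding wp_Seq
    proof (subst init_store_eq(1), rule wp_mono[OF wp_search[where n = ?n]])
      fix t :: nat and s :: store
      assume a: "t = search_time ?n \<and> snd s = snd (init_store ?xs) \<and> fst s 21 = 1 \<and> fst s 2 = ?n \<and>
        fst s 4 = fL ?n \<and> fst s 0 = fst (init_store ?xs) 0"
      obtain r m where s: "s = (r, m)" by force
      show "wp (call1 cF 0 2) (\<lambda>t' s. fst s 0 = f \<Sigma> w \<tau> \<phi>) s"
        unfolding s by (rule wp_call1[OF F]) (use a s in \<open>simp_all add: f_def\<close>)
    qed (unfold init_store_eq(2), fact dp(1), erule dp(2))
    from computes_wp[OF this] show "\<exists>t. computes (Seq search (call1 cF 0 2)) ?xs t (f \<Sigma> w \<tau> \<phi>)"
      by blast
  qed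
  moreover have "\<exists>t y. computes solve (enc_parameters \<Sigma> w \<tau> \<phi> @ xs) t y \<and>
      real t \<le> real (f \<Sigma> w \<tau> \<phi>) * nfa_size (odd_alphabet \<Sigma> w \<tau>) A \<and>
      (y \<noteq> 0 \<longleftrightarrow> (\<exists>S\<in>C. fo_models S \<phi>))"
    if par: "parameters \<Sigma> w \<tau> \<phi>" and rep: "represents \<Sigma> w \<tau> A C" and code: "nfa_code A xs"
    for \<Sigma> w \<tau> \<phi> A and C :: "'u struc set" and xs
  proof -
    have fin: "finite \<Sigma>" using par by (simp add: parameters_def)
    have nfa: "is_nfa (odd_alphabet \<Sigma> w \<tau>) A" using rep by (simp add: represents_def)
    define n where "n = par_code \<Sigma> w \<tau> \<phi>"
    define P :: par where "P = dec n"
    have P: "par_ok P" "par_tokens P = enc_parameters \<Sigma> w \<tau> \<phi>"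
      using par_code unfolding P_def n_def by blast+
    have isP: "is_par \<Sigma> w \<tau> \<phi> P"
      using par_tokens_prefix(1)[OF fin, of P "[]" w \<tau> \<phi> "[]"] P by (simp add: par_ok_def)
    obtain \<Sigma>s p where Pe: "P = (\<Sigma>s, w, \<tau>, p)" "set \<Sigma>s = \<Sigma>" using isP by (auto simp: is_par_def)
    obtain qs ts0 ini fi where tok: "distinct qs" "set qs = nfa_states A" "distinct ts0" "set ts0 = nfa_trans A"
      "distinct ini" "set ini = nfa_init A" "distinct fi" "set fi = nfa_final A"
      "xs = (length qs # qs) @ (length (map (\<lambda>(p, x, q). (p, enc_symbol x, q)) ts0) #
        concat (map edge_tokens (map (\<lambda>(p, x, q). (p, enc_symbol x, q)) ts0))) @ (length ini # ini) @ (length fi # fi)"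
      by (rule nfa_code_tokens[OF code])
    define ts where "ts = map (\<lambda>(p, x, q). (p, enc_symbol x, q)) ts0"
    have ts_eq: "set ts = (\<lambda>(p, x, q). (p, enc_symbol x, q)) ` nfa_trans A" by (simp add: ts_def tok(4))
    have edge: "\<exists>x. (p, x, q) \<in> nfa_trans A \<and> tk = enc_symbol x \<and> x \<in> odd_alphabet (set \<Sigma>s) w \<tau> \<and>
        p \<in> set qs \<and> q \<in> set qs \<and> tk = symbol_tokens (rep_sym x) \<and> rep_sym x \<in> set (symbols P)"
      if e: "(p, tk, q) \<in> set ts" for p tk q
    proof -
      obtain x where x: "(p, x, q) \<in> nfa_trans A" "tk = enc_symbol x" using e unfolding ts_eq by auto
      have "(p, x, q) \<in> nfa_states A \<times> odd_alphabet (set \<Sigma>s) w \<tau> \<times> nfa_states A"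
        using nfa x(1) unfolding is_nfa_def Pe(2) by blast
      moreover from this have "rep_sym x \<in> set (symbols P)"
        unfolding Pe(1) by (intro rep_sym_in_symbols) auto
      ultimately show ?thesis
        using x tok(2) by (intro exI[of _ x]) (simp add: symbol_tokens_rep_sym)
    qed
    have parse_symbol: "parse_symbol P (rev (take (Suc i) tk)) = [] \<longleftrightarrow> Suc i < length tk"
      and parse_symbol_hd: "hd (parse_symbol P (rev tk)) = rep_sym x"
      if "x \<in> odd_alphabet (set \<Sigma>s) w \<tau>" "tk = enc_symbol x" for x tk i
    proof -
      show "parse_symbol P (rev (take (Suc i) tk)) = [] \<longleftrightarrow> Suc i < length tk"
        unfolding Pe(1) using parse_symbol_prefix(1)[OF that(1), of "take (Suc i) tk" "drop (Suc i) tk"] that(2)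
        by (simp add: not_le)
      show "hd (parse_symbol P (rev tk)) = rep_sym x"
        unfolding Pe(1) using parse_symbol_prefix(2)[OF that(1), of tk "[]"] that(2) by simp
    qed
    have enc_dec: "dec (prod_encode (n, enc a)) = (P, a)" for a :: "nat list"
      by (simp add: P_def)
    have enc_dec3: "dec (prod_encode (n, prod_encode (t, enc a))) = (P, t, a)" for t and a :: "nat list"
      by (simp add: P_def)
    have enc_dec2: "dec (prod_encode (n, t)) = (P, t)" for t :: nat
      by (simp add: P_def)
    interpret I: main_ram_input cV cL cT cN fV fL fT fN TV TL TT TN cC cS cD cA fS fD fA TC TS TD TA
      n "num_types P" "U n" "K n" "stream (enc_parameters \<Sigma> w \<tau> \<phi> @ xs)" qs ts ini fi
    proof
      show "set ini \<subseteq> set qs" using nfa tok by (simp add: is_nfa_def)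
      show "0 < num_types P" by (rule num_types_pos)
      fix p tk q assume "(p, tk, q) \<in> set ts"
      from edge[OF this] obtain x where x: "(p, x, q) \<in> nfa_trans A" "tk = enc_symbol x"
        "x \<in> odd_alphabet (set \<Sigma>s) w \<tau>" "p \<in> set qs" "q \<in> set qs" "tk = symbol_tokens (rep_sym x)" "rep_sym x \<in> set (symbols P)"
        by blast
      have "length tk \<le> K n"
        using le_sum_list_map[OF x(7), of "\<lambda>s. length (symbol_tokens s)"] by (simp add: K_def token_bound_def P_def x(6))
      moreover have "tk \<noteq> []" by (cases x) (simp add: x(2) enc_symbol_def enc_list_def)
      ultimately show "p \<in> set qs \<and> q \<in> set qs \<and> tk \<noteq> [] \<and> length tk \<le> K n" using x by blast
      {
        fix i assume i: "i < length tk"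
        show "fS (prod_encode (n, enc (rev (take (Suc i) tk)))) \<noteq> 0 \<longleftrightarrow> Suc i < length tk"
          unfolding fS_def enc_dec incomplete_num_def using parse_symbol[OF x(3,2)] by simp
        have mem: "rev (take (Suc i) tk) \<in> set (token_prefixes P)"
          using rev_take_token_prefixes[OF x(7), of "Suc i"] i x(6) by simp
        have r: "rev (take (Suc i) tk) = tk ! i # rev (take i tk)"
          using i by (simp add: take_Suc_conv_app_nth)
        show "call2_time TC (tk ! i) (enc (rev (take i tk))) \<le> U n"
          using call_bound_acc(1)[OF mem[unfolded P_def], of TC TS TD TA] by (simp add: r U_def)
        show "call2_time TS n (enc (rev (take (Suc i) tk))) \<le> U n"
          unfolding U_def by (rule call_bound_acc(2)[OF mem[unfolded P_def]])
      }
      fix t assume t: "t < num_types P"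
      have "rev tk \<in> set (token_prefixes P)" using rev_take_token_prefixes[OF x(7), of "length tk"] x(6) by simp
      then show "call3_time TD n t (enc (rev tk)) \<le> U n"
        unfolding U_def using call_bound_acc(3)[of "rev tk" n t TD TC TS TA] t by (simp add: P_def)
      show "fD (prod_encode (n, prod_encode (t, enc (rev tk)))) < num_types P"
        unfolding fD_def enc_dec3 step_num_def using parse_symbol_hd[OF x(3,2)] type_step_less_num_types[OF t x(7)] by simp
    next
      fix t assume "t < num_types P"
      then show "call2_time TA n t \<le> U n" unfolding U_def P_def by (rule call_bound_A)
    qed (fact tok)+
    let ?ys = "enc_parameters \<Sigma> w \<tau> \<phi> @ xs"
    have "wp solve (\<lambda>t s. t \<le> I.solve_bound * (length qs + length ts) \<and> (fst s 0 \<noteq> 0 \<longleftrightarrow> I.hit I.reach))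
      (init_store ?ys)"
    proof (subst init_store_eq(1), rule I.wp_solve)
      show "diff (stream ?ys) n = 0" "\<And>i. i < n \<Longrightarrow> diff (stream ?ys) i \<noteq> 0"
        using diff_par_code[OF fV_def fL_def fT_def fin] unfolding n_def by blast+
      show "fN n = num_types P" by (simp add: fN_def P_def)
      show "stored (stream ?ys) (fL n) ((length qs # qs) @ (length ts # concat (map edge_tokens ts)) @
          (length ini # ini) @ (length fi # fi))"
        using stored_stream[of ?ys "enc_parameters \<Sigma> w \<tau> \<phi>" xs "[]"] P(2)
        by (simp add: fL_def length_num_def P_def[symmetric] tok(9) ts_def del: stored_Cons stored_append)
      show "length ini \<le> length qs" "length fi \<le> length qs"
        using nfa tok card_mono[of "set qs" "set ini"] card_mono[of "set qs" "set fi"]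
        by (simp_all add: is_nfa_def flip: distinct_card)
      show "qs \<noteq> []" using nfa tok(2) by (auto simp: is_nfa_def)
    qed (simp_all add: init_store_eq(2,3))
    from computes_wp[OF this] obtain t y where ty: "computes solve ?ys t y"
      "t \<le> I.solve_bound * (length qs + length ts)" "y \<noteq> 0 \<longleftrightarrow> I.hit I.reach"
      by blast
    have "I.solve_bound = f \<Sigma> w \<tau> \<phi>"
      unfolding I.solve_bound_def f_def F_def n_def[symmetric] by (simp add: fN_def P_def)
    moreover have "length qs + length ts = card (nfa_states A) + card (nfa_trans A)"
      using tok distinct_card[of qs] distinct_card[of ts0] by (simp add: ts_def)
    ultimately have "real t \<le> real (f \<Sigma> w \<tau> \<phi>) * real (card (nfa_states A) + card (nfa_trans A))"
      using ty(2) by (metis of_nat_le_iff of_nat_mult)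
    also have "\<dots> \<le> real (f \<Sigma> w \<tau> \<phi>) * nfa_size (odd_alphabet \<Sigma> w \<tau>) A"
      by (intro mult_left_mono nfa_size_ge[OF fin]) simp
    finally have time: "real t \<le> real (f \<Sigma> w \<tau> \<phi>) * nfa_size (odd_alphabet \<Sigma> w \<tau>) A" .
    have "I.hit I.reach \<longleftrightarrow> (\<exists>us\<in>nfa_lang A. type_accepts P (foldl (type_step P) 0 (map rep_sym us)))"
    proof (rule I.hit_reach_iff[OF ts_eq tok(6,8)])
      fix p x q t assume tr: "(p, x, q) \<in> nfa_trans A"
      then have "x \<in> odd_alphabet (set \<Sigma>s) w \<tau>" using nfa unfolding is_nfa_def Pe(2) by blast
      then show "I.d t (enc_symbol x) = type_step P t (rep_sym x)"
        unfolding I.d_def unfolding fD_def enc_dec3 step_num_def by (simp add: parse_symbol_hd)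
    next
      fix t show "fA (prod_encode (n, t)) \<noteq> 0 \<longleftrightarrow> type_accepts P t"
        unfolding fA_def enc_dec2 accepts_num_def by simp
    qed
    then have "y \<noteq> 0 \<longleftrightarrow> (\<exists>S\<in>C. fo_models S \<phi>)"
      using class_satisfiable_iff[OF par isP rep] ty(3) by blast
    then show ?thesis using ty(1) time by blast
  qed
  ultimately show ?thesis by (intro exI[of _ f] conjI exI[of _ solve]) blast+
qed

end
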